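(* Let $W=(W_t)_{t\in[0,1]}$ be the standard $n$-dimensional Brownian motion on its canonical Wiener space, and let $t\mapsto\gamma(t)$, $t\in[0,1]$, be a non-random, Lebesgue measurable function whose values are real $n\times n$ unitary (i.e. orthogonal) matrices. Let $T$ be the measure-preserving transformation $W\mapsto Y=T(W)$ of the Wiener space given by $$dY_t=\gamma(t)\,dW_t,\qquad Y_0=0,\quad t\in[0,1].$$ Let $e^{i\psi_j(t)}$, $0<\psi_j(t)\le2\pi$, $j=1,\dots,n$, be the eigenvalues of $\gamma(t)$. Let $u(\alpha)=1$ for $\alpha\ge0$ and $u(\alpha)=0$ for $\alpha<0$. Then $T$ is ergodic if and only if, for every $j=1,\dots,n$, the function $$\theta\mapsto\int_0^1u(\theta-\psi_j(t))\,dt$$ is continuous on $[0,2\pi]$. Equivalently, $T$ is ergodic if and only if the set $C^j(\theta)=\{t\in[0,1]:\psi_j(t)=\theta\}$ has Lebesgue measure zero for every $\theta\in[0,2\pi]$ and every $j=1,\dots,n$.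
   Context: The Wiener space is $C_0([0,1];\mathbb{R}^n)$ with the $n$-dimensional Wiener measure $\mu$, and $W$ is the coordinate process. The eigenvalue arguments are listed with multiplicity and in nondecreasing order, $\psi_1(t)\le\dots\le\psi_n(t)$; in particular the eigenvalue $1$ is represented by the argument $2\pi$. $T$ is ergodic if every measurable $F$ with $F\circ T=F$ $\mu$-a.s. is $\mu$-a.s. constant. *)

theory Defs
  imports "HOL-Probability.Probability" "HOL-Computational_Algebra.Polynomial"
begin

text \<open>A path on \<open>[0,1]\<close> is a function on the reals that takes the value \<^term>\<open>undefined\<close>
  outside \<open>[0,1]\<close>, so that equality of elements of \<open>C0\<close> is equality of paths.\<close>

definition C0 :: "(real \<Rightarrow> real ^ 'n) set" where
  "C0 = {w. continuous_on {0..1} w \<and> w 0 = 0 \<and> w \<in> extensional {0..1}}"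

text \<open>Only the \<open>\<sigma>\<close>-algebra of \<open>wiener_space\<close> is meaningful: it is generated by the coordinate
  maps, and coincides with the Borel \<open>\<sigma>\<close>-algebra of the supremum norm.\<close>

definition wiener_space :: "(real \<Rightarrow> real ^ 'n) measure" where
  "wiener_space = restrict_space (PiM {0..1} (\<lambda>_. borel)) C0"

text \<open>Wiener measure is the law on \<open>C0\<close> under which the coordinate process is a standard Brownian
  motion: increments over successive intervals are independent, and \<open>W t - W s\<close> has law
  \<open>N(0, (t - s) I)\<close>.\<close>

definition wiener_measure :: "(real \<Rightarrow> real ^ 'n) measure \<Rightarrow> bool" where
  "wiener_measure M \<longleftrightarrow>
     prob_space M \<and> sets M = sets wiener_space \<and>
     (\<forall>s t. 0 \<le> s \<and> s < t \<and> t \<le> 1 \<longrightarrow>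
        distributed M lborel (\<lambda>w. w t - w s)
          (\<lambda>x. ennreal (\<Prod>i\<in>UNIV. normal_density 0 (sqrt (t - s)) (x $ i)))) \<and>
     (\<forall>(m::nat) \<tau>. mono_on {..m} \<tau> \<and> \<tau> ` {..m} \<subseteq> {0..1} \<longrightarrow>
        prob_space.indep_vars M (\<lambda>_. borel) (\<lambda>k w. w (\<tau> (Suc k)) - w (\<tau> k)) {..<m})"

text \<open>A list of triples \<open>(a, b, C)\<close> represents the step function \<open>\<Sum> C 1\<^bsub>(a,b]\<^esub>\<close>.\<close>

type_synonym 'n step = "(real \<times> real \<times> (real ^ 'n ^ 'n)) list"

definition valid_step :: "'n step \<Rightarrow> bool" where
  "valid_step S \<longleftrightarrow> (\<forall>(a, b, C) \<in> set S. 0 \<le> a \<and> a \<le> b \<and> b \<le> 1)"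

definition step_fun :: "'n step \<Rightarrow> real \<Rightarrow> real ^ 'n ^ 'n" where
  "step_fun S s = (\<Sum>(a, b, C)\<leftarrow>S. indicat_real {a<..b} s *\<^sub>R C)"

definition step_integral :: "'n step \<Rightarrow> (real \<Rightarrow> real ^ 'n) \<Rightarrow> real ^ 'n" where
  "step_integral S w = (\<Sum>(a, b, C)\<leftarrow>S. C *v (w b - w a))"

text \<open>\<open>X\<close> is a version of \<open>\<integral>\<^sub>0\<^sup>1 G(s) dW(s)\<close>: it is the \<open>L\<^sup>2\<close>-limit of the elementary integrals of
  step functions converging to \<open>G\<close> in \<open>L\<^sup>2([0,1])\<close>. By the Ito isometry \<open>X\<close> is determined up to a
  null set and does not depend on the approximating sequence.\<close>

definition wiener_integral ::
  "(real \<Rightarrow> real ^ 'n) measure \<Rightarrow> (real \<Rightarrow> real ^ 'n ^ 'n) \<Rightarrow>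
   ((real \<Rightarrow> real ^ 'n) \<Rightarrow> real ^ 'n) \<Rightarrow> bool" where
  "wiener_integral M G X \<longleftrightarrow>
     G \<in> borel_measurable (lebesgue_on {0..1}) \<and> X \<in> borel_measurable M \<and>
     (\<exists>S. (\<forall>m. valid_step (S m)) \<and>
       (\<lambda>m. \<integral>\<^sup>+ s. ennreal ((norm (step_fun (S m) s - G s))\<^sup>2) \<partial>lebesgue_on {0..1})
          \<longlonglongrightarrow> 0 \<and>
       (\<lambda>m. \<integral>\<^sup>+ w. ennreal ((norm (step_integral (S m) w - X w))\<^sup>2) \<partial>M)
          \<longlonglongrightarrow> 0)"

text \<open>\<open>T\<close> is (a version of) the transformation \<open>W \<mapsto> Y\<close> with \<open>dY = \<gamma> dW\<close>, \<open>Y 0 = 0\<close>: for every \<open>t\<close>,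
  \<open>Y t = \<integral>\<^sub>0\<^sup>t \<gamma>(s) dW(s)\<close> almost surely. Continuity of \<open>Y\<close> and \<open>Y 0 = 0\<close> are part of \<open>T\<close> mapping
  into \<open>C0\<close>.\<close>

definition driven_transformation ::
  "(real \<Rightarrow> real ^ 'n) measure \<Rightarrow> (real \<Rightarrow> real ^ 'n ^ 'n) \<Rightarrow>
   ((real \<Rightarrow> real ^ 'n) \<Rightarrow> (real \<Rightarrow> real ^ 'n)) \<Rightarrow> bool" where
  "driven_transformation M \<gamma> T \<longleftrightarrow>
     T \<in> M \<rightarrow>\<^sub>M M \<and>
     (\<forall>t\<in>{0..1}. wiener_integral M (\<lambda>s. indicat_real {0..t} s *\<^sub>R \<gamma> s) (\<lambda>w. T w t))"

definition measure_preserving :: "'a measure \<Rightarrow> ('a \<Rightarrow> 'a) \<Rightarrow> bool" where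
  "measure_preserving M T \<longleftrightarrow> T \<in> M \<rightarrow>\<^sub>M M \<and> distr M M T = M"

definition ergodic :: "'a measure \<Rightarrow> ('a \<Rightarrow> 'a) \<Rightarrow> bool" where
  "ergodic M T \<longleftrightarrow>
     (\<forall>F :: 'a \<Rightarrow> real. F \<in> borel_measurable M \<and> (AE w in M. F (T w) = F w) \<longrightarrow>
        (\<exists>c. AE w in M. F w = c))"

definition charpoly :: "complex ^ 'n ^ 'n \<Rightarrow> complex poly" where
  "charpoly A = det (mat [:0, 1:] - map_matrix (\<lambda>a. [:a:]) A)"

lemma poly_charpoly: "poly (charpoly A) z = det (mat z - A)"
proof -
  have "poly ((mat [:0, 1:] - map_matrix (\<lambda>a. [:a:]) A) $ i $ j) z = (mat z - A) $ i $ j" for i j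
    by (simp add: mat_def map_matrix_def)
  then show ?thesis
    unfolding charpoly_def det_def
    by (simp add: poly_sum poly_prod)
qed

text \<open>Multiplicity is multiplicity as a root of the characteristic polynomial. The range of \<open>p\<close>
  represents the eigenvalue \<open>1\<close> by \<open>2\<pi>\<close>, not \<open>0\<close>.\<close>

definition eigenvalue_arguments :: "real ^ 'n ^ 'n \<Rightarrow> (nat \<Rightarrow> real) \<Rightarrow> bool" where
  "eigenvalue_arguments A p \<longleftrightarrow>
     (\<forall>j\<in>{1..CARD('n)}. 0 < p j \<and> p j \<le> 2 * pi) \<and>
     mono_on {1..CARD('n)} p \<and>
     (\<forall>z. order z (charpoly (map_matrix complex_of_real A)) =
          card {j\<in>{1..CARD('n)}. exp (\<i> * complex_of_real (p j)) = z})"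

definition unit_step :: "real \<Rightarrow> real" where
  "unit_step \<alpha> = (if \<alpha> \<ge> 0 then 1 else 0)"

end

theory Submission
  imports Defs "HOL-Computational_Algebra.Fundamental_Theorem_Algebra"
begin

text \<open>
  On a Wiener integral \<open>W(h) = \<integral>\<^sub>0\<^sup>1 h \<bullet> dW\<close> the transformation acts by \<open>W(h) \<circ> T = W(\<gamma>\<^sup>T h)\<close>, an isometry of
  \<open>L\<^sup>2([0,1]; \<real>\<^sup>n)\<close>; characteristic functions show that it preserves Wiener measure.

  Suppose that all level sets of the \<open>\<psi>\<^sub>j\<close> are null, and let \<open>g\<^sub>k = (\<gamma>\<^sup>T)\<^sup>k g\<close> and \<open>c\<^sub>k\<^sub>l = \<langle>g\<^sub>k, g\<^sub>l\<rangle>\<close> for a step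
  function \<open>g\<close>. The mean of \<open>c\<^sub>k\<^sub>l\<^sup>2\<close> over \<open>k, l < N\<close> is \<open>\<integral>\<integral> |N\<^sup>-\<^sup>1 \<Sum>\<^sub>k g\<^sub>k(s) \<otimes> g\<^sub>k(t)|\<^sup>2 ds dt\<close>. By the mean
  ergodic theorem for the isometry \<open>X \<mapsto> \<gamma>(s)\<^sup>T X \<gamma>(t)\<close> the integrand tends to \<open>0\<close> unless \<open>\<gamma>(s)\<close> and \<open>\<gamma>(t)\<close> have
  a common eigenvalue, which for fixed \<open>s\<close> happens only for \<open>t\<close> in a null set. Since
  \<open>E exp (i W(g\<^sub>k) - i W(g\<^sub>l)) = exp (c\<^sub>k\<^sub>l - |g|\<^sup>2)\<close>, the ergodic means of \<open>exp (i W(g))\<close> tend to a constant, so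
  an invariant bounded \<open>G\<close> is uncorrelated with every \<open>exp (i W(g))\<close> and is therefore constant.

  If \<open>e^(i\<theta>)\<close> is an eigenvalue of \<open>\<gamma>(t)\<close> on a set of positive measure, then the means of \<open>e^(-ik\<theta>) g\<^sub>k\<close> tend, for
  a suitable \<open>g\<close>, to some \<open>h \<noteq> 0\<close> with \<open>\<gamma>\<^sup>T h = e^(i\<theta>) h\<close>, and \<open>|W(h)|\<^sup>2\<close> is invariant but not constant.
\<close>

section \<open>Uniqueness of measures from characteristic functions\<close>

text \<open>The hypothesis on \<open>T\<close> gives, for each fixed time, a version of an integral
  and no pathwise formula. The proof therefore works with a relation between integrands and
  versions, and all probabilistic information enters through values \<open>E exp (i X)\<close>:
  those at step integrals determine a finite measure on path space. This is why an invariant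
  function is first made bounded and nonnegative: as a density it yields a finite measure that can
  be compared with a multiple of Wiener measure. Two obstacles come from measurability. Eigenvectors
  of \<open>\<gamma> t\<close> are not chosen for each \<open>t\<close>, as the choice would have to
  be measurable; they arise as pointwise limits of means of measurable functions. Measurability of
  the \<open>\<psi> j\<close> is derived from that of \<open>\<gamma>\<close>, although the sorted
  arguments jump when an eigenvalue passes through 1 and so are not continuous in the matrix.
  Absence of a common eigenvalue is used in the form that \<open>A X = X B\<close> has only the
  solution \<open>X = 0\<close>; this is what the mean ergodic theorem asks for, and it stays within
  real matrices.\<close>

lemma finite_measure_eqI_iexp:
  fixes N1 N2 :: "real measure"
  assumes "finite_measure N1" "finite_measure N2"
    and s1: "sets N1 = sets borel" and s2: "sets N2 = sets borel"
    and eq: "\<And>t. (CLINT x|N1. iexp (t * x)) = (CLINT x|N2. iexp (t * x))"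
  shows "N1 = N2"
proof -
  interpret N1: finite_measure N1 by fact
  interpret N2: finite_measure N2 by fact
  have sp: "space N1 = UNIV" "space N2 = UNIV"
    using sets_eq_imp_space_eq[OF s1] sets_eq_imp_space_eq[OF s2] by simp_all
  \<comment> \<open>The value at \<open>t = 0\<close> is the total mass. A positive mass is
    normalised to reach Levy uniqueness for probability measures; mass 0 is treated apart.\<close>
  define m where "m = measure N1 UNIV"
  have "complex_of_real (measure N1 UNIV) = complex_of_real (measure N2 UNIV)"
    using eq[of 0] by (simp add: sp)
  then have m2: "m = measure N2 UNIV" by (simp add: m_def)
  show ?thesis
  proof (cases "m = 0")
    case True
    have "emeasure N1 A = emeasure N2 A" for A
    proof -
      have "emeasure N1 UNIV = 0" "emeasure N2 UNIV = 0"
        using True m2 N1.emeasure_eq_measure N2.emeasure_eq_measure by (simp_all add: m_def)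
      then have "emeasure N1 A = 0" "emeasure N2 A = 0"
        using emeasure_space[of N1 A] emeasure_space[of N2 A] by (simp_all add: sp)
      then show ?thesis by simp
    qed
    then show ?thesis by (intro measure_eqI) (simp_all add: s1 s2)
  next
    case False
    then have m0: "m > 0" by (simp add: m_def measure_nonneg less_le)
    define c where "c = ennreal (1 / m)"
    have rd: "real_distribution (density N (\<lambda>_. c))"
      if f: "finite_measure N" and s: "sets N = sets borel" and m: "measure N UNIV = m" for N
    proof -
      interpret N: finite_measure N by fact
      have sp: "space N = UNIV" using sets_eq_imp_space_eq[OF s] by simp
      show ?thesis
      proof (intro real_distribution.intro prob_spaceI)
        show "emeasure (density N (\<lambda>_. c)) (space (density N (\<lambda>_. c))) = 1"
          using m m0 emeasure_density_const[of UNIV N c]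
          by (simp add: s sp c_def N.emeasure_eq_measure flip: ennreal_mult)
        show "real_distribution_axioms (density N (\<lambda>_. c))"
          by standard (simp_all add: s sp)
      qed
    qed
    have "density N1 (\<lambda>_. c) = density N2 (\<lambda>_. c)"
    proof (rule Levy_uniqueness)
      show "real_distribution (density N1 (\<lambda>_. c))" by (rule rd) (simp_all add: assms m_def)
      show "real_distribution (density N2 (\<lambda>_. c))" by (rule rd) (simp_all add: assms m2)
      have st: "(CLINT x|density N (\<lambda>_. c). iexp (t * x)) = (1/m) *\<^sub>R (CLINT x|N. iexp (t * x))"
        if "sets N = sets borel" for N t
        using m0 that unfolding c_def by (subst integral_density) (auto cong: measurable_cong_sets)
      show "char (density N1 (\<lambda>_. c)) = char (density N2 (\<lambda>_. c))"
        unfolding char_def by (intro ext) (simp only: st s1 s2 eq)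
    qed
    then have "c * emeasure N1 A = c * emeasure N2 A" if "A \<in> sets borel" for A
      using that emeasure_density_const[of A N1 c] emeasure_density_const[of A N2 c] by (simp add: s1 s2)
    moreover have "c \<noteq> 0" "c \<noteq> top" using m0 by (simp_all add: c_def ennreal_eq_0_iff)
    ultimately have "emeasure N1 A = emeasure N2 A" if "A \<in> sets borel" for A
      using ennreal_mult_cancel_left[of c] that by auto
    then show ?thesis by (intro measure_eqI) (simp_all add: s1 s2)
  qed
qed

text \<open>The signed weights \<open>cos (Y + c)\<close> are made positive by adding \<open>1\<close>, so that uniqueness for
  finite positive measures applies to the laws of \<open>X\<close>.\<close>

lemma set_integral_iexp_eq:
  fixes X Y :: "'a \<Rightarrow> real"
  assumes "finite_measure N1" "finite_measure N2" and s: "sets N1 = sets N2"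
    and X: "X \<in> borel_measurable N1" and Y: "Y \<in> borel_measurable N1"
    and eq: "\<And>u v. (CLINT w|N1. iexp (u * X w + v * Y w)) = (CLINT w|N2. iexp (u * X w + v * Y w))"
    and A: "A \<in> sets borel"
  shows "(CLINT w|N1. indicat_real A (X w) *\<^sub>R iexp (Y w)) = (CLINT w|N2. indicat_real A (X w) *\<^sub>R iexp (Y w))"
proof -
  interpret N1: finite_measure N1 by fact
  interpret N2: finite_measure N2 by fact
  have intg: "integrable N (\<lambda>w. f w)" if "finite_measure N" "f \<in> borel_measurable N" "\<And>w. norm (f w) \<le> B"
    for f :: "'a \<Rightarrow> 'b :: {banach, second_countable_topology}" and B and N :: "'a measure"
    using that by (intro finite_measure.integrable_const_bound[where B=B]) auto
  have meas [measurable]: "X \<in> borel_measurable N1" "Y \<in> borel_measurable N1"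
      "X \<in> borel_measurable N2" "Y \<in> borel_measurable N2"
    using X Y s by (simp_all cong: measurable_cong_sets)
  have [measurable]: "A \<in> sets borel" by fact
  let ?D = "\<lambda>N r c. distr (density N (\<lambda>w. ennreal (1 + r * cos (Y w + c)))) borel X"
  \<comment> \<open>In exponentials, the characteristic function of the law of \<open>X\<close>
    under the weight involves the joint characteristic function only at
    \<open>v = 0, 1, -1\<close>.\<close>
  have cosform: "complex_of_real (cos (y + c)) = (iexp c / 2) * iexp y + (iexp (-c) / 2) * iexp (- y)" for y c
    by (simp add: cos_of_real[symmetric] cos_exp_eq exp_add[symmetric] algebra_simps add_divide_distrib)
  have D: "?D N1 r c
      = ?D N2 r c"
    if r: "r = 0 \<or> r = 1" for r c
  proof (rule finite_measure_eqI_iexp)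
    have nn: "0 \<le> 1 + r * cos (Y w + c)" and le2: "\<bar>1 + r * cos (Y w + c)\<bar> \<le> 2" for w
      using cos_ge_minus_one[of "Y w + c"] cos_le_one[of "Y w + c"] r by (elim disjE; hypsubst; linarith)+
    have fin: "finite_measure (?D N r c)"
      if N: "finite_measure N" and [measurable]: "X \<in> borel_measurable N" "Y \<in> borel_measurable N"
      for N :: "'a measure"
    proof (rule finite_measure.finite_measure_distr)
      have "integrable N (\<lambda>w. 1 + r * cos (Y w + c))"
        using le2 by (intro intg[OF N, of _ 2]) auto
      then have "(\<integral>\<^sup>+ w. ennreal (1 + r * cos (Y w + c)) \<partial>N) < \<infinity>"
        using nn by (subst nn_integral_eq_integral) auto
      then show "finite_measure (density N (\<lambda>w. ennreal (1 + r * cos (Y w + c))))"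
        by (intro finite_measureI) (auto simp: emeasure_density less_top cong: nn_integral_cong)
    qed auto
    show "finite_measure (?D N1 r c)"
      by (rule fin) (use assms(1,2) meas in auto)
    show "finite_measure (?D N2 r c)"
      by (rule fin) (use assms(1,2) meas in auto)
    fix t
    have form: "(CLINT x|?D N r c. iexp (t * x))
      = (CLINT w|N. iexp (t * X w + 0 * Y w)) + r * ((iexp c / 2) * (CLINT w|N. iexp (t * X w + 1 * Y w))
          + (iexp (-c) / 2) * (CLINT w|N. iexp (t * X w + (-1) * Y w)))"
      if N: "finite_measure N" and [measurable]: "X \<in> borel_measurable N" "Y \<in> borel_measurable N"
      for N :: "'a measure"
    proof -
      have i: "integrable N (\<lambda>w. iexp (a * X w + b * Y w))" for a b
        by (rule intg[OF N, of _ 1]) auto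
      have lin: "(CLINT w|N. f w + r * (a * g w + b * h w)) = (CLINT w|N. f w) + r * (a * (CLINT w|N. g w) + b * (CLINT w|N. h w))"
        if "integrable N f" "integrable N g" "integrable N h" for f g h :: "'a \<Rightarrow> complex" and a b
        using that by simp
      have "(CLINT x|?D N r c. iexp (t * x))
         = (CLINT w|N. (1 + r * cos (Y w + c)) *\<^sub>R iexp (t * X w))"
        using nn by (subst integral_distr) (auto simp: integral_density)
      also have "\<dots> = (CLINT w|N. iexp (t * X w + 0 * Y w) + r * ((iexp c / 2) * iexp (t * X w + 1 * Y w)
          + (iexp (-c) / 2) * iexp (t * X w + (-1) * Y w)))"
      proof (rule Bochner_Integration.integral_cong[OF refl])
        fix w
        have "(1 + r * cos (Y w + c)) *\<^sub>R iexp (t * X w)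
          = iexp (t * X w) + r * (complex_of_real (cos (Y w + c)) * iexp (t * X w))"
          by (simp add: scaleR_conv_of_real algebra_simps)
        then show "(1 + r * cos (Y w + c)) *\<^sub>R iexp (t * X w) = iexp (t * X w + 0 * Y w) + r * ((iexp c / 2) * iexp (t * X w + 1 * Y w)
          + (iexp (-c) / 2) * iexp (t * X w + (-1) * Y w))"
          unfolding cosform by (simp add: algebra_simps exp_add exp_minus exp_diff field_simps)
      qed
      also have "\<dots> = (CLINT w|N. iexp (t * X w + 0 * Y w)) + r * ((iexp c / 2) * (CLINT w|N. iexp (t * X w + 1 * Y w))
          + (iexp (-c) / 2) * (CLINT w|N. iexp (t * X w + (-1) * Y w)))"
        by (rule lin) (rule i)+
      finally show ?thesis .
    qed
    show "(CLINT x|?D N1 r c. iexp (t * x))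
      = (CLINT x|?D N2 r c. iexp (t * x))"
      unfolding form[OF assms(1) meas(1,2)] form[OF assms(2) meas(3,4)] eq ..
  qed simp_all
  have E: "(LINT w|N1. indicat_real A (X w) * (1 + r * cos (Y w + c)))
      = (LINT w|N2. indicat_real A (X w) * (1 + r * cos (Y w + c)))" if r: "r = 0 \<or> r = 1" for r c
  proof -
    have nn: "0 \<le> 1 + r * cos (Y w + c)" for w
      using cos_ge_minus_one[of "Y w + c"] cos_le_one[of "Y w + c"] r by (elim disjE; hypsubst; linarith)+
    have "(LINT w|N. indicat_real A (X w) * (1 + r * cos (Y w + c)))
      = (LINT x|?D N r c. indicat_real A x)"
      if [measurable]: "X \<in> borel_measurable N" "Y \<in> borel_measurable N" for N
      using nn by (subst integral_distr) (auto simp: integral_density mult.commute)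
    then show ?thesis using D[OF r] meas by simp
  qed
  have F: "(LINT w|N1. indicat_real A (X w) * cos (Y w + c))
      = (LINT w|N2. indicat_real A (X w) * cos (Y w + c))" for c
  proof -
    have "(LINT w|N. indicat_real A (X w) * cos (Y w + c))
      = (LINT w|N. indicat_real A (X w) * (1 + 1 * cos (Y w + c))) - (LINT w|N. indicat_real A (X w) * (1 + 0 * cos (Y w + c)))"
      if N: "finite_measure N" and [measurable]: "X \<in> borel_measurable N" "Y \<in> borel_measurable N"
      for N :: "'a measure"
    proof -
      have b: "\<bar>1 + r * cos y\<bar> \<le> 2" if "r = 0 \<or> r = 1" for r y :: real
        using cos_ge_minus_one[of y] cos_le_one[of y] that by (elim disjE; hypsubst; linarith)
      have b1: "\<bar>1 + cos y\<bar> \<le> 2" for y :: real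
        using b[of 1 y] by simp
      show ?thesis
        by (subst Bochner_Integration.integral_diff[symmetric])
          (auto intro!: intg[OF N, of _ 2] b1 simp: abs_mult indicator_def algebra_simps
            intro: Bochner_Integration.integral_cong)
    qed
    from this[OF assms(1) meas(1,2)] this[OF assms(2) meas(3,4)] show ?thesis
      by (simp only: E[of 0] E[of 1] simp_thms)
  qed
  \<comment> \<open>The phases \<open>0\<close> and \<open>-pi/2\<close> give the real and the
    imaginary part of \<open>iexp (Y w)\<close>.\<close>
  have "(CLINT w|N. indicat_real A (X w) *\<^sub>R iexp (Y w))
    = complex_of_real (LINT w|N. indicat_real A (X w) * cos (Y w + 0))
      + \<i> * complex_of_real (LINT w|N. indicat_real A (X w) * cos (Y w + (-pi/2)))"
    if N: "finite_measure N" and [measurable]: "X \<in> borel_measurable N" "Y \<in> borel_measurable N"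
    for N :: "'a measure"
  proof -
    have cs: "cos (y + - pi / 2) = sin y" for y :: real
      using cos_diff[of y "pi/2"] by simp
    have i: "integrable N (\<lambda>w. indicat_real A (X w) * cos (Y w + c))" for c
      by (intro intg[OF N, of _ 1]) (auto simp: indicator_def)
    have lin: "(CLINT w|N. complex_of_real (f w) + \<i> * complex_of_real (g w)) = complex_of_real (LINT w|N. f w) + \<i> * complex_of_real (LINT w|N. g w)"
      if "integrable N f" "integrable N g" for f g :: "'a \<Rightarrow> real"
      using that by simp
    have "(CLINT w|N. indicat_real A (X w) *\<^sub>R iexp (Y w))
      = (CLINT w|N. complex_of_real (indicat_real A (X w) * cos (Y w + 0))
         + \<i> * complex_of_real (indicat_real A (X w) * cos (Y w + (-pi/2))))"
      by (rule Bochner_Integration.integral_cong)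
         (auto simp: cs[simplified] cis_conv_exp[symmetric] complex_eq_iff indicator_def)
    also have "\<dots> = complex_of_real (LINT w|N. indicat_real A (X w) * cos (Y w + 0))
      + \<i> * complex_of_real (LINT w|N. indicat_real A (X w) * cos (Y w + (-pi/2)))"
      by (rule lin) (rule i)+
    finally show ?thesis .
  qed
  from this[OF assms(1) meas(1,2)] this[OF assms(2) meas(3,4)] show ?thesis
    by (simp only: F)
qed

text \<open>One constraint \<open>X p w \<in> A p\<close> at a time is absorbed into the measures as
  a density. \<open>set_integral_iexp_eq\<close> shows that the new measures again agree on all
  remaining exponentials, so the induction runs over arbitrary \<open>N1\<close> and
  \<open>N2\<close>.\<close>

lemma measure_box_eqI_iexp:
  fixes X :: "'i \<Rightarrow> 'a \<Rightarrow> real"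
  assumes "finite J"
    and "finite_measure N1" "finite_measure N2" and "sets N1 = sets N2"
    and "\<And>p. p \<in> J \<Longrightarrow> X p \<in> borel_measurable N1"
    and "\<And>u. (CLINT w|N1. iexp (\<Sum>p\<in>J. u p * X p w)) = (CLINT w|N2. iexp (\<Sum>p\<in>J. u p * X p w))"
    and "\<And>p. p \<in> J \<Longrightarrow> A p \<in> sets borel"
  shows "emeasure N1 {w\<in>space N1. \<forall>p\<in>J. X p w \<in> A p} = emeasure N2 {w\<in>space N2. \<forall>p\<in>J. X p w \<in> A p}"
  using assms
proof (induction J arbitrary: N1 N2 rule: finite_induct)
  case empty
  interpret N1: finite_measure N1 by fact
  interpret N2: finite_measure N2 by fact
  have "complex_of_real (measure N1 (space N1)) = complex_of_real (measure N2 (space N2))"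
    using empty.prems(5)[of "\<lambda>_. 0"] by simp
  then show ?case
    by (simp add: N1.emeasure_eq_measure N2.emeasure_eq_measure)
next
  case (insert p J)
  have sp: "space N1 = space N2" using insert.prems(3) by (rule sets_eq_imp_space_eq)
  have m1 [measurable]: "\<And>q. q \<in> insert p J \<Longrightarrow> X q \<in> borel_measurable N1"
    using insert.prems by auto
  have m2 [measurable]: "\<And>q. q \<in> insert p J \<Longrightarrow> X q \<in> borel_measurable N2"
    using insert.prems by (metis measurable_cong_sets)
  have [measurable]: "X p \<in> borel_measurable N1" "X p \<in> borel_measurable N2" using m1 m2 by auto
  have [measurable]: "A p \<in> sets borel" using insert.prems by auto
  have [measurable]: "X q \<in> borel_measurable N1" "X q \<in> borel_measurable N2" "A q \<in> sets borel"
    if "q \<in> J" for q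
    using that m1 m2 insert.prems by auto
  have [measurable]: "finite J" by fact
  let ?D = "\<lambda>N. density N (\<lambda>w. ennreal (indicat_real (A p) (X p w)))"
  have fin: "finite_measure (?D N)" if N: "finite_measure N" and [measurable]: "X p \<in> borel_measurable N"
    for N
  proof (rule finite_measureI)
    interpret finite_measure N by fact
    have "(\<integral>\<^sup>+ w. ennreal (indicat_real (A p) (X p w)) \<partial>N) \<le> (\<integral>\<^sup>+ w. 1 \<partial>N)"
      by (intro nn_integral_mono) (auto simp: indicator_def)
    also have "\<dots> < \<infinity>" by (simp add: less_top[symmetric])
    finally show "emeasure (?D N) (space (?D N)) \<noteq> \<infinity>"
      by (auto simp: emeasure_density cong: nn_integral_cong)
  qed
  have "emeasure (?D N1) {w\<in>space (?D N1). \<forall>q\<in>J. X q w \<in> A q} = emeasure (?D N2) {w\<in>space (?D N2). \<forall>q\<in>J. X q w \<in> A q}"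
  proof (rule insert.IH)
    show "finite_measure (?D N1)" "finite_measure (?D N2)" using fin insert.prems by auto
    show "sets (?D N1) = sets (?D N2)" using insert.prems by simp
    fix u :: "'i \<Rightarrow> real"
    let ?Y = "\<lambda>w. \<Sum>q\<in>J. u q * X q w"
    have "(CLINT w|N1. iexp (a * X p w + b * ?Y w)) = (CLINT w|N2. iexp (a * X p w + b * ?Y w))" for a b
    proof -
      have "a * X p w + b * ?Y w = (\<Sum>q\<in>insert p J. (if q = p then a else b * u q) * X q w)" for w
      proof -
        have "(\<Sum>q\<in>J. (if q = p then a else b * u q) * X q w) = (\<Sum>q\<in>J. b * (u q * X q w))"
          using insert.hyps by (intro sum.cong) auto
        then show ?thesis using insert.hyps by (simp add: sum_distrib_left)
      qed
      then show ?thesis using insert.prems(5)[of "\<lambda>q. if q = p then a else b * u q"] by simp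
    qed
    then have "(CLINT w|N1. indicat_real (A p) (X p w) *\<^sub>R iexp (?Y w)) = (CLINT w|N2. indicat_real (A p) (X p w) *\<^sub>R iexp (?Y w))"
      using insert.prems by (intro set_integral_iexp_eq) auto
    then show "(CLINT w|?D N1. iexp (?Y w)) = (CLINT w|?D N2. iexp (?Y w))"
      by (subst (1 2) integral_density) auto
  qed (use insert.prems in auto)
  moreover have "emeasure (?D N) {w\<in>space (?D N). \<forall>q\<in>J. X q w \<in> A q} = emeasure N {w\<in>space N. \<forall>q\<in>insert p J. X q w \<in> A q}"
    if [measurable]: "\<And>q. q \<in> J \<Longrightarrow> X q \<in> borel_measurable N" "X p \<in> borel_measurable N" for N
  proof -
    have "emeasure (?D N) {w\<in>space N. \<forall>q\<in>J. X q w \<in> A q} = (\<integral>\<^sup>+ w. ennreal (indicat_real (A p) (X p w)) * indicator {w\<in>space N. \<forall>q\<in>J. X q w \<in> A q} w \<partial>N)"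
      by (rule emeasure_density) measurable
    also have "\<dots> = (\<integral>\<^sup>+ w. indicator {w\<in>space N. X p w \<in> A p \<and> (\<forall>q\<in>J. X q w \<in> A q)} w \<partial>N)"
      by (rule nn_integral_cong) (auto simp: indicator_def)
    also have "\<dots> = emeasure N {w\<in>space N. X p w \<in> A p \<and> (\<forall>q\<in>J. X q w \<in> A q)}"
      by (rule nn_integral_indicator) measurable
    finally show ?thesis by simp
  qed
  ultimately show ?case using m1 m2 by auto
qed

section \<open>Mean ergodic theorem and intertwining matrices in finite dimension\<close>

text \<open>Von Neumann's argument: split \<open>x = (V u - u) + y\<close> with \<open>y\<close>
  orthogonal to the range of \<open>V - 1\<close>. The sums over the first part telescope and stay
  bounded, while \<open>|V y - y|\<^sup>2 = 2 |y|\<^sup>2 - 2 (y \<bullet> V y) = 0\<close>.\<close>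

lemma mean_ergodic_finite_dim:
  fixes V :: "'b::euclidean_space \<Rightarrow> 'b"
  assumes "linear V" and iso: "\<And>x. norm (V x) = norm x"
  obtains y where "V y = y" "(\<lambda>N. (1 / real N) *\<^sub>R (\<Sum>k<N. (V ^^ k) x)) \<longlonglongrightarrow> y"
proof -
  interpret linear V by fact
  let ?S = "range (\<lambda>u. V u - u)"
  have "subspace ?S"
  proof (rule subspaceI)
    show "0 \<in> ?S" by (rule image_eqI[of _ _ 0]) (auto simp: zero)
    show "a + b \<in> ?S" if ab: "a \<in> ?S" "b \<in> ?S" for a b
    proof -
      obtain u v where "a = V u - u" "b = V v - v" using ab by auto
      then show ?thesis by (intro image_eqI[of _ _ "u + v"]) (auto simp: add algebra_simps)
    qed
    show "c *\<^sub>R a \<in> ?S" if a: "a \<in> ?S" for c a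
    proof -
      obtain u where "a = V u - u" using a by auto
      then show ?thesis by (intro image_eqI[of _ _ "c *\<^sub>R u"]) (auto simp: scale scaleR_diff_right)
    qed
  qed
  then obtain r y where ry: "r \<in> ?S" "\<And>w. w \<in> ?S \<Longrightarrow> orthogonal y w" "x = r + y"
    using orthogonal_subspace_decomp_exists[of ?S x] by (metis span_eq_iff)
  obtain u where u: "r = V u - u" using ry(1) by auto
  have Vy: "V y = y"
  proof -
    have "inner y (V y) = inner y y"
      using ry(2)[of "V y - y"] by (auto simp: orthogonal_def inner_diff_right)
    then have "(norm (V y - y))\<^sup>2 = 0"
      using iso[of y] by (simp add: power2_norm_eq_inner inner_diff inner_commute norm_eq)
    then show ?thesis by simp
  qed
  have Vk: "(V ^^ k) y = y" for k by (induction k) (simp_all add: Vy)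
  have lin: "linear (V ^^ k)" for k
    by (induction k) (auto intro: linear_compose[OF _ \<open>linear V\<close>, unfolded o_def] simp: linear_id[unfolded id_def] o_def)
  have isok: "norm ((V ^^ k) z) = norm z" for k z by (induction k) (simp_all add: iso)
  have s: "(\<Sum>k<N. (V ^^ k) x) = (V ^^ N) u - u + real N *\<^sub>R y" for N
  proof (induction N)
    case (Suc N)
    have VN: "(V ^^ N) x = (V ^^ N) (V u) - (V ^^ N) u + y"
      using lin[of N] Vk by (simp add: ry(3) u linear_add linear_diff)
    show ?case unfolding sum.lessThan_Suc Suc VN by (simp add: algebra_simps funpow_swap1)
  qed simp
  have "(\<lambda>N. (1 / real N) *\<^sub>R ((V ^^ N) u - u) + y) \<longlonglongrightarrow> 0 + y"
  proof (intro tendsto_add tendsto_const)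
    show "(\<lambda>N. (1 / real N) *\<^sub>R ((V ^^ N) u - u)) \<longlonglongrightarrow> 0"
    proof (rule Lim_null_comparison)
      show "\<forall>\<^sub>F N in sequentially. norm ((1 / real N) *\<^sub>R ((V ^^ N) u - u)) \<le> 2 * norm u * (1 / real N)"
      proof (rule always_eventually, rule allI)
        fix N
        have "norm ((V ^^ N) u - u) \<le> 2 * norm u"
          using norm_triangle_ineq4[of "(V ^^ N) u" u] by (simp add: isok)
        then show "norm ((1 / real N) *\<^sub>R ((V ^^ N) u - u)) \<le> 2 * norm u * (1 / real N)"
          by (simp add: divide_right_mono)
      qed
      show "(\<lambda>N. 2 * norm u * (1 / real N)) \<longlonglongrightarrow> 0"
        by (intro tendsto_mult_right_zero lim_1_over_n)
    qed
  qed
  moreover have "\<forall>\<^sub>F N in sequentially. (1 / real N) *\<^sub>R ((V ^^ N) u - u) + y = (1 / real N) *\<^sub>R (\<Sum>k<N. (V ^^ k) x)"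
    using eventually_gt_at_top[of 0] by eventually_elim (simp add: s scaleR_add_right)
  ultimately have "(\<lambda>N. (1 / real N) *\<^sub>R (\<Sum>k<N. (V ^^ k) x)) \<longlonglongrightarrow> y"
    by (simp add: Lim_transform_eventually)
  with Vy show ?thesis by (rule that)
qed

section \<open>Eigenvalues, and polynomials in a matrix acting on a matrix\<close>

definition is_eigenvalue :: "real ^ 'n ^ 'n \<Rightarrow> complex \<Rightarrow> bool" where
  "is_eigenvalue A z \<longleftrightarrow> det (mat z - map_matrix complex_of_real A) = 0"

lemma is_eigenvalue_transpose: "is_eigenvalue (transpose A) z \<longleftrightarrow> is_eigenvalue A z"
proof -
  have "mat z - map_matrix complex_of_real (transpose A) = transpose (mat z - map_matrix complex_of_real A)"
    by (simp add: vec_eq_iff transpose_def mat_def map_matrix_def)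
  then show ?thesis unfolding is_eigenvalue_def by (simp only: det_transpose)
qed

lemma det_zero_iff_kernel:
  fixes A :: "'a::field ^ 'n ^ 'n"
  shows "det A = 0 \<longleftrightarrow> (\<exists>x. x \<noteq> 0 \<and> A *v x = 0)"
  using invertible_det_nz[of A] matrix_left_invertible_ker[of A] invertible_left_inverse[of A] by metis

lemma is_eigenvalue_iff:
  "is_eigenvalue A z \<longleftrightarrow> (\<exists>x. x \<noteq> 0 \<and> map_matrix complex_of_real A *v x = z *s x)"
proof -
  have "(mat z - B) *v x = 0 \<longleftrightarrow> B *v x = z *s x" for B :: "complex ^ 'n ^ 'n" and x
  proof -
    have "mat z *v x = z *s x"
      by (simp add: vec_eq_iff matrix_vector_mult_def mat_def if_distrib[of "\<lambda>a. a * _"] cong: if_cong)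
    then show ?thesis by (auto simp: matrix_vector_mult_diff_rdistrib)
  qed
  then show ?thesis unfolding is_eigenvalue_def det_zero_iff_kernel by blast
qed

text \<open>More vectors than the dimension are dependent. Dependence concerns sets of vectors, so a
  repetition in the family is a separate case, with the relation
  \<open>f i - f j = 0\<close>.\<close>

lemma exists_linear_relation:
  fixes f :: "nat \<Rightarrow> 'b::euclidean_space"
  obtains a d where "\<exists>k\<le>d. a k \<noteq> 0" "(\<Sum>k\<le>d. a k *\<^sub>R f k) = 0"
proof (cases "inj_on f {..DIM('b)}")
  case True
  then have "card (f ` {..DIM('b)}) = DIM('b) + 1" by (simp add: card_image)
  then have "dependent (f ` {..DIM('b)})" by (intro dependent_biggerset) auto
  then obtain u where u: "\<exists>v\<in>f ` {..DIM('b)}. u v \<noteq> 0" "(\<Sum>v\<in>f ` {..DIM('b)}. u v *\<^sub>R v) = 0"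
    by (auto simp: dependent_finite)
  show ?thesis
    using u True by (intro that[of "DIM('b)" "\<lambda>k. u (f k)"]) (auto simp: sum.reindex)
next
  case False
  then obtain i j where ij: "i \<le> DIM('b)" "j \<le> DIM('b)" "i \<noteq> j" "f i = f j"
    by (auto simp: inj_on_def)
  let ?a = "\<lambda>k. (if k = i then 1 else 0) - (if k = j then 1 else 0) :: real"
  have "(\<Sum>k\<le>DIM('b). ?a k *\<^sub>R f k) = 0"
    using ij by (simp add: scaleR_left_diff_distrib sum_subtractf if_distrib[of "\<lambda>a. a *\<^sub>R _"] cong: if_cong)
  moreover have "?a i \<noteq> 0" using ij by simp
  ultimately show ?thesis using ij by (intro that[of "DIM('b)" ?a]) blast+
qed

text \<open>Complex multiples of a matrix: \<open>*\<^sub>R\<close> takes real scalars only, and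
  \<open>*s\<close> would scale by elements of the entry type, here whole rows.\<close>

definition cscale :: "complex \<Rightarrow> complex ^ 'n ^ 'm \<Rightarrow> complex ^ 'n ^ 'm" where
  "cscale z X = (\<chi> i j. z * X $ i $ j)"

text \<open>This is \<open>p(A) X\<close>, evaluated by Horner's scheme.\<close>

definition poly_act :: "complex ^ 'n ^ 'n \<Rightarrow> complex ^ 'm ^ 'n \<Rightarrow> complex poly \<Rightarrow> complex ^ 'm ^ 'n" where
  "poly_act A X p = fold_coeffs (\<lambda>a Y. cscale a X + A ** Y) p 0"

lemma matrix_add_rdistrib: "(A + B) ** C = A ** C + B ** (C :: 'a::semiring_1 ^ 'n ^ 'm)"
  by (simp add: vec_eq_iff matrix_matrix_mult_def algebra_simps sum.distrib)

lemma cscale_simps: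
  "cscale 0 X = 0" "cscale 1 X = X" "cscale (a + b) X = cscale a X + cscale b X"
  "cscale a (X + Y) = cscale a X + cscale a Y" "cscale a (cscale b X) = cscale (a * b) X"
  "A ** cscale a X = cscale a (A ** X)" "cscale a X ** B = cscale a (X ** B)"
  "cscale a 0 = 0"
  by (simp_all add: cscale_def vec_eq_iff algebra_simps matrix_matrix_mult_def sum_distrib_left)

lemma poly_act_0 [simp]: "poly_act A X 0 = 0"
  by (simp add: poly_act_def)

lemma poly_act_pCons [simp]: "poly_act A X (pCons a p) = cscale a X + A ** poly_act A X p"
  by (cases "a = 0 \<and> p = 0") (auto simp: poly_act_def cscale_simps)

lemma poly_act_add: "poly_act A X (p + q) = poly_act A X p + poly_act A X q"
  by (induction p q rule: poly_induct2) (simp_all add: cscale_simps matrix_add_ldistrib)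

lemma poly_act_smult: "poly_act A X (smult c p) = cscale c (poly_act A X p)"
  by (induction p) (simp_all add: cscale_simps)

lemma poly_act_sum: "finite I \<Longrightarrow> poly_act A X (\<Sum>i\<in>I. p i) = (\<Sum>i\<in>I. poly_act A X (p i))"
  by (induction I rule: finite_induct) (simp_all add: poly_act_add)

lemma poly_act_monom: "poly_act A X (monom c k) = cscale c (((**) A ^^ k) X)"
  by (induction k) (simp_all add: monom_0 monom_Suc cscale_simps)

text \<open>Factor a root \<open>z\<close> out of the annihilating polynomial,
  \<open>p = (x - z) q\<close>. Either \<open>q(A) X\<close> is nonzero and hence an eigenvector for
  \<open>z\<close>, or \<open>q\<close> annihilates \<open>X\<close> and has smaller degree.\<close>

lemma poly_act_eigen:
  assumes "p \<noteq> 0" "poly_act A X p = 0" "X \<noteq> 0"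
  shows "\<exists>q z. poly_act A X q \<noteq> 0 \<and> A ** poly_act A X q = cscale z (poly_act A X q)"
  using assms
proof (induction "degree p" arbitrary: p rule: less_induct)
  case less
  show ?case
  proof (cases "degree p = 0")
    case True
    then obtain c where c: "p = [:c:]" using degree_eq_zeroE by blast
    with less.prems have "c \<noteq> 0" "cscale c X = 0" by auto
    then have "cscale (inverse c) (cscale c X) = 0" by (simp add: cscale_simps)
    with \<open>c \<noteq> 0\<close> less.prems show ?thesis by (simp only: cscale_simps) (simp add: cscale_simps)
  next
    case False
    then have "\<not> constant (poly p)" by (simp add: constant_degree)
    then obtain z where "poly p z = 0" using fundamental_theorem_of_algebra by blast
    then obtain q where q: "p = [:-z, 1:] * q" by (auto simp: poly_eq_0_iff_dvd)
    have q0: "q \<noteq> 0" using q less.prems by auto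
    have "degree p = Suc (degree q)" using q0 unfolding q by (subst degree_mult_eq) auto
    have "poly_act A X p = cscale (-z) (poly_act A X q) + A ** poly_act A X q"
      unfolding q by (simp only: mult_pCons_left mult_zero_left add_0_right smult_1_left pCons_0_0 mult_1
          poly_act_add poly_act_smult poly_act_pCons cscale_simps add_0_left)
    then have e: "A ** poly_act A X q + cscale (-z) (poly_act A X q) = 0"
      using less.prems by (simp add: add.commute)
    show ?thesis
    proof (cases "poly_act A X q = 0")
      case True
      then show ?thesis using less.hyps[of q] q0 less.prems \<open>degree p = _\<close> by simp
    next
      case False
      have "A ** poly_act A X q = cscale z (poly_act A X q)"
        using e by (simp add: cscale_def vec_eq_iff)
      with False show ?thesis by blast
    qed
  qed
qed

text \<open>The solutions \<open>X\<close> of \<open>A X = X B\<close> form a space invariant under \<open>X \<mapsto> A X\<close>; over \<open>\<complex>\<close> this map has an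
  eigenvector in it, whose columns and rows are eigenvectors of \<open>A\<close> and of \<open>B\<^sup>T\<close>.\<close>

lemma common_eigenvalue:
  fixes A B M :: "real ^ 'n ^ 'n"
  assumes "M \<noteq> 0" and AM: "A ** M = M ** B"
  obtains z where "is_eigenvalue A z" "is_eigenvalue B z"
proof -
  define c :: "real ^ 'n ^ 'n \<Rightarrow> complex ^ 'n ^ 'n" where "c = map_matrix complex_of_real"
  have c_mult: "c (X ** Y) = c X ** c Y" for X Y
    by (simp add: c_def vec_eq_iff map_matrix_def matrix_matrix_mult_def)
  have c_pow: "c (((**) A ^^ k) X) = ((**) (c A) ^^ k) (c X)" for k X
    by (induction k) (simp_all add: c_mult)
  have c_inj: "c X = 0 \<longleftrightarrow> X = 0" for X
    by (simp add: c_def vec_eq_iff map_matrix_def)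
  \<comment> \<open>A linear relation among the matrices \<open>A^k M\<close> is a polynomial
    annihilating \<open>M\<close> under the action.\<close>
  obtain a d where ad: "\<exists>k\<le>d. a k \<noteq> 0" "(\<Sum>k\<le>d. a k *\<^sub>R ((**) A ^^ k) M) = 0"
    by (rule exists_linear_relation)
  define p where "p = (\<Sum>k\<le>d. monom (complex_of_real (a k)) k)"
  have cf: "coeff p k = (if k \<le> d then complex_of_real (a k) else 0)" for k
    by (auto simp: p_def coeff_sum)
  then have "p \<noteq> 0" using ad(1) by (metis coeff_0 of_real_eq_0_iff)
  moreover have "poly_act (c A) (c M) p = 0"
  proof -
    have "poly_act (c A) (c M) p = (\<Sum>k\<le>d. cscale (complex_of_real (a k)) (c (((**) A ^^ k) M)))"
      by (simp add: p_def poly_act_sum poly_act_monom c_pow)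
    also have "\<dots> = c (\<Sum>k\<le>d. a k *\<^sub>R ((**) A ^^ k) M)"
      by (simp add: c_def cscale_def vec_eq_iff map_matrix_def)
    finally show ?thesis using ad(2) c_inj by simp
  qed
  moreover have "c M \<noteq> 0" using assms c_inj by simp
  ultimately obtain q z where qz: "poly_act (c A) (c M) q \<noteq> 0"
      "c A ** poly_act (c A) (c M) q = cscale z (poly_act (c A) (c M) q)"
    using poly_act_eigen by blast
  define Y where "Y = poly_act (c A) (c M) q"
  \<comment> \<open>Solutions of the intertwining equation are stable under complex multiples and
    under \<open>X \<mapsto> A X\<close>, hence under every \<open>poly_act\<close>.\<close>
  have "c A ** poly_act (c A) (c M) q = poly_act (c A) (c M) q ** c B" for q
  proof (induction q)
    case (pCons a q)
    have "c A ** (c A ** poly_act (c A) (c M) q) = (c A ** poly_act (c A) (c M) q) ** c B"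
      by (simp only: pCons matrix_mul_assoc)
    then show ?case
      using AM by (simp add: matrix_add_ldistrib matrix_add_rdistrib cscale_simps c_mult[symmetric])
  qed simp
  then have YB: "Y ** c B = cscale z Y" and AY: "c A ** Y = cscale z Y" and Y: "Y \<noteq> 0"
    using qz by (simp_all add: Y_def)
  obtain i j where ij: "Y $ i $ j \<noteq> 0" using Y by (auto simp: vec_eq_iff)
  have "is_eigenvalue A z"
    unfolding is_eigenvalue_iff
  proof (intro exI conjI)
    show "column j Y \<noteq> 0" using ij by (auto simp: column_def vec_eq_iff)
    show "map_matrix complex_of_real A *v column j Y = z *s column j Y"
      using AY by (simp add: c_def column_def vec_eq_iff matrix_vector_mult_def matrix_matrix_mult_def cscale_def)
  qed
  moreover have "is_eigenvalue (transpose B) z"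
    unfolding is_eigenvalue_iff
  proof (intro exI conjI)
    show "row i Y \<noteq> 0" using ij by (auto simp: row_def vec_eq_iff)
    show "map_matrix complex_of_real (transpose B) *v row i Y = z *s row i Y"
      using YB by (simp add: c_def row_def vec_eq_iff matrix_vector_mult_def matrix_matrix_mult_def cscale_def
          transpose_def map_matrix_def mult.commute)
  qed
  ultimately show ?thesis using that by (simp add: is_eigenvalue_transpose)
qed

section \<open>Step integrands and the law of their integrals\<close>

text \<open>Scalar integrals of vector integrands are enough: a vector-valued integral is determined
  by its inner products with fixed vectors, and these have the rows \<open>u v* G\<close> as
  integrands.\<close>

type_synonym 'n vstep = "(real \<times> real \<times> (real ^ 'n)) list"

definition valid_vstep :: "'n vstep \<Rightarrow> bool" where
  "valid_vstep S \<longleftrightarrow> (\<forall>(a, b, c) \<in> set S. 0 \<le> a \<and> a \<le> b \<and> b \<le> 1)"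

definition vstep_fun :: "'n vstep \<Rightarrow> real \<Rightarrow> real ^ 'n" where
  "vstep_fun S s = (\<Sum>(a, b, c)\<leftarrow>S. indicat_real {a<..b} s *\<^sub>R c)"

definition vstep_int :: "'n vstep \<Rightarrow> (real \<Rightarrow> real ^ 'n) \<Rightarrow> real" where
  "vstep_int S w = (\<Sum>(a, b, c)\<leftarrow>S. c \<bullet> (w b - w a))"

lemma vstep_simps [simp]:
  "valid_vstep []" "vstep_fun [] s = 0" "vstep_int [] w = 0"
  "valid_vstep ((a, b, c) # S) \<longleftrightarrow> 0 \<le> a \<and> a \<le> b \<and> b \<le> 1 \<and> valid_vstep S"
  "vstep_fun ((a, b, c) # S) s = indicat_real {a<..b} s *\<^sub>R c + vstep_fun S s"
  "vstep_int ((a, b, c) # S) w = c \<bullet> (w b - w a) + vstep_int S w"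
  "valid_vstep (S @ S') \<longleftrightarrow> valid_vstep S \<and> valid_vstep S'"
  "vstep_fun (S @ S') s = vstep_fun S s + vstep_fun S' s"
  "vstep_int (S @ S') w = vstep_int S w + vstep_int S' w"
  by (simp_all add: valid_vstep_def vstep_fun_def vstep_int_def ball_Un conj_assoc)

lemma space_wiener_space: "space wiener_space = C0"
  by (auto simp: wiener_space_def space_restrict_space space_PiM C0_def PiE_def)

lemma measurable_coord:
  assumes "sets M = sets wiener_space" "t \<in> {0..1}"
  shows "(\<lambda>w. w t) \<in> borel_measurable M"
proof -
  have "(\<lambda>w. w t) \<in> borel_measurable wiener_space"
    unfolding wiener_space_def using assms(2)
    by (intro measurable_restrict_space1 measurable_component_singleton)
  then show ?thesis using assms(1) by (simp cong: measurable_cong_sets)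
qed

lemma measurable_vstep_int [measurable]:
  assumes "sets M = sets wiener_space" "valid_vstep S"
  shows "vstep_int S \<in> borel_measurable M"
  using assms(2)
proof (induction S)
  case Nil
  have "vstep_int ([] :: 'a vstep) = (\<lambda>_. 0)" by (simp add: fun_eq_iff)
  then show ?case by (simp only: borel_measurable_const)
next
  case (Cons x S)
  obtain a b c where x: "x = (a, b, c)" by (cases x)
  have "vstep_int (x # S) = (\<lambda>w. c \<bullet> (w b - w a) + vstep_int S w)" by (simp add: fun_eq_iff x)
  moreover have "(\<lambda>w. w a) \<in> borel_measurable M" "(\<lambda>w. w b) \<in> borel_measurable M"
    using Cons.prems assms(1) by (auto simp: x intro!: measurable_coord)
  ultimately show ?case using Cons by (simp add: x)
qed

lemma vstep_int_scale: "\<exists>S'. valid_vstep S' \<and> vstep_fun S' = (\<lambda>s. r *\<^sub>R vstep_fun S s) \<and> vstep_int S' = (\<lambda>w. r * vstep_int S w)"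
  if "valid_vstep S"
  using that
proof (induction S)
  case Nil
  show ?case by (rule exI[of _ "[]"]) (simp add: fun_eq_iff)
next
  case (Cons x S)
  obtain a b c where x: "x = (a, b, c)" by (cases x)
  obtain S' where S': "valid_vstep S'" "vstep_fun S' = (\<lambda>s. r *\<^sub>R vstep_fun S s)" "vstep_int S' = (\<lambda>w. r * vstep_int S w)"
    using Cons by (auto simp: x)
  show ?case
    using Cons.prems S' by (intro exI[of _ "(a, b, r *\<^sub>R c) # S'"]) (auto simp: fun_eq_iff x algebra_simps)
qed

text \<open>A path is encoded by \<open>\<Phi>\<close> as the family of its real coordinates indexed
  by time and component. A law on that product is determined by finite boxes, and a linear
  combination of finitely many coordinates is a step integral.\<close>

lemma wiener_space_measure_eqI:
  fixes N1 N2 :: "(real \<Rightarrow> real ^ 'n) measure"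
  assumes "finite_measure N1" "finite_measure N2"
    and s1: "sets N1 = sets wiener_space" and s2: "sets N2 = sets wiener_space"
    and eq: "\<And>S. valid_vstep S \<Longrightarrow> (CLINT w|N1. iexp (vstep_int S w)) = (CLINT w|N2. iexp (vstep_int S w))"
  shows "N1 = N2"
proof -
  define I :: "(real \<times> 'n) set" where "I = {0..1} \<times> UNIV"
  define X :: "real \<times> 'n \<Rightarrow> (real \<Rightarrow> real ^ 'n) \<Rightarrow> real" where "X p w = w (fst p) $ snd p" for p w
  define \<Phi> where "\<Phi> w = (\<lambda>p\<in>I. X p w)" for w
  define \<Psi> :: "(real \<times> 'n \<Rightarrow> real) \<Rightarrow> real \<Rightarrow> real ^ 'n" where "\<Psi> x = (\<lambda>t\<in>{0..1}. \<chi> i. x (t, i))" for x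
  have sp: "space N1 = C0" "space N2 = C0"
    using sets_eq_imp_space_eq[OF s1] sets_eq_imp_space_eq[OF s2] by (simp_all add: space_wiener_space)
  have X: "X p \<in> borel_measurable N" if s: "sets N = sets wiener_space" and p: "p \<in> I" for N p
  proof -
    have "(\<lambda>w. w (fst p) \<bullet> axis (snd p) 1) \<in> borel_measurable N"
      using measurable_coord[OF s, of "fst p"] p by (auto simp: I_def)
    then show ?thesis by (simp add: X_def[abs_def] inner_axis)
  qed
  have \<Phi>: "\<Phi> \<in> N \<rightarrow>\<^sub>M PiM I (\<lambda>_. borel)" if s: "sets N = sets wiener_space" for N
    unfolding \<Phi>_def by (intro measurable_restrict X s)
  have \<Psi>: "\<Psi> \<in> PiM I (\<lambda>_. borel) \<rightarrow>\<^sub>M PiM {0..1} (\<lambda>_. borel)"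
    unfolding \<Psi>_def
  proof (rule measurable_restrict)
    fix t :: real assume t: "t \<in> {0..1}"
    have "(\<lambda>x. (\<chi> i. x (t, i)) \<bullet> b) \<in> borel_measurable (PiM I (\<lambda>_. borel))" if bB: "b \<in> Basis" for b :: "real ^ 'n"
    proof -
      obtain i where b: "b = axis i 1" using bB by (auto simp: Basis_vec_def)
      show ?thesis using t by (auto simp: b inner_axis I_def intro!: measurable_component_singleton)
    qed
    then show "(\<lambda>x. \<chi> i. x (t, i)) \<in> borel_measurable (PiM I (\<lambda>_. borel :: real measure))"
      by (rule borel_measurable_euclidean_space[THEN iffD2, rule_format])
  qed
  have inv: "\<Psi> (\<Phi> w) = w" if "w \<in> C0" for w
    using that by (auto simp: \<Psi>_def \<Phi>_def X_def I_def C0_def fun_eq_iff extensional_def vec_eq_iff)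
  \<comment> \<open>Since \<open>w 0 = 0\<close>, the step \<open>(0, t, c)\<close> has integral
    \<open>c \<bullet> w t\<close>.\<close>
  have sint: "\<exists>S. valid_vstep S \<and> (\<forall>w\<in>C0. vstep_int S w = (\<Sum>p\<in>J. u p * X p w))"
    if "finite J" "J \<subseteq> I" for J u
    using that
  proof (induction J rule: finite_induct)
    case empty
    show ?case by (rule exI[of _ "[]"]) simp
  next
    case (insert p J)
    then obtain S where "valid_vstep S" "\<And>w. w \<in> C0 \<Longrightarrow> vstep_int S w = (\<Sum>p\<in>J. u p * X p w)" by auto
    with insert show ?case
      by (intro exI[of _ "(0, fst p, u p *\<^sub>R axis (snd p) 1) # S"])
        (auto simp: I_def C0_def X_def inner_commute[of "axis _ _"] inner_axis)
  qed
  have D: "distr N1 (PiM I (\<lambda>_. borel)) \<Phi> = distr N2 (PiM I (\<lambda>_. borel)) \<Phi>"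
  proof (rule measure_eqI_PiM_infinite)
    show "finite_measure (distr N1 (PiM I (\<lambda>_. borel)) \<Phi>)"
      by (rule finite_measure.finite_measure_distr[OF assms(1) \<Phi>[OF s1]])
    fix A :: "real \<times> 'n \<Rightarrow> real set" and J assume J: "finite J" "J \<subseteq> I" "\<And>i. i \<in> J \<Longrightarrow> A i \<in> sets borel"
    let ?B = "prod_emb I (\<lambda>_. borel) J (Pi\<^sub>E J A)"
    have e: "emeasure (distr N (PiM I (\<lambda>_. borel)) \<Phi>) ?B = emeasure N {w\<in>space N. \<forall>p\<in>J. X p w \<in> A p}"
      if s: "sets N = sets wiener_space" for N
    proof -
      have "?B \<in> sets (PiM I (\<lambda>_. borel))" using J by (intro sets_PiM_I) auto
      then have "emeasure (distr N (PiM I (\<lambda>_. borel)) \<Phi>) ?B = emeasure N (\<Phi> -` ?B \<inter> space N)"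
        by (rule emeasure_distr[OF \<Phi>[OF s]])
      also have "\<Phi> -` ?B \<inter> space N = {w\<in>space N. \<forall>p\<in>J. X p w \<in> A p}"
      proof -
        have "(\<forall>p\<in>J. restrict (\<lambda>p. X p w) I p \<in> A p) \<longleftrightarrow> (\<forall>p\<in>J. X p w \<in> A p)" for w
          using J(2) by (intro ball_cong) auto
        then show ?thesis
          by (auto simp: \<Phi>_def prod_emb_def PiE_iff Pi_iff)
      qed
      finally show ?thesis .
    qed
    have "emeasure N1 {w\<in>space N1. \<forall>p\<in>J. X p w \<in> A p} = emeasure N2 {w\<in>space N2. \<forall>p\<in>J. X p w \<in> A p}"
    proof (rule measure_box_eqI_iexp)
      fix u
      obtain S where S: "valid_vstep S" "\<forall>w\<in>C0. vstep_int S w = (\<Sum>p\<in>J. u p * X p w)"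
        using sint J by metis
      have "(CLINT w|N. iexp (\<Sum>p\<in>J. u p * X p w)) = (CLINT w|N. iexp (vstep_int S w))" if "space N = C0" for N
        using S(2) that by (intro Bochner_Integration.integral_cong) auto
      then show "(CLINT w|N1. iexp (\<Sum>p\<in>J. u p * X p w)) = (CLINT w|N2. iexp (\<Sum>p\<in>J. u p * X p w))"
        using eq[OF S(1)] sp by simp
    qed (use J X s1 s2 assms in auto)
    then show "emeasure (distr N1 (PiM I (\<lambda>_. borel)) \<Phi>) ?B = emeasure (distr N2 (PiM I (\<lambda>_. borel)) \<Phi>) ?B"
      by (simp add: e s1 s2)
  qed simp_all
  \<comment> \<open>\<open>\<Psi>\<close> is a measurable left inverse of \<open>\<Phi>\<close> on
    \<open>C0\<close>, so every event of path space is the preimage under \<open>\<Phi>\<close> of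
    an event of the product.\<close>
  show ?thesis
  proof (rule measure_eqI)
    fix A assume "A \<in> sets N1"
    then obtain B where B: "B \<in> sets (PiM {0..1} (\<lambda>_. borel))" "A = B \<inter> C0"
      unfolding s1 wiener_space_def by (auto simp: sets_restrict_space)
    let ?E = "\<Psi> -` B \<inter> space (PiM I (\<lambda>_. borel))"
    have E: "?E \<in> sets (PiM I (\<lambda>_. borel))" using \<Psi> B(1) by (rule measurable_sets)
    have "emeasure N A = emeasure (distr N (PiM I (\<lambda>_. borel)) \<Phi>) ?E"
      if s: "sets N = sets wiener_space" "space N = C0" for N
    proof -
      have "\<Phi> -` ?E \<inter> space N = A"
        using inv measurable_space[OF \<Phi>[OF s(1)]] s(2) B(2) by auto
      then show ?thesis using emeasure_distr[OF \<Phi>[OF s(1)] E] by simp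
    qed
    then show "emeasure N1 A = emeasure N2 A" using D s1 s2 sp by metis
  qed (simp add: s1 s2)
qed

section \<open>Gaussian characteristic functions of increments and step integrals\<close>

abbreviation "L01 \<equiv> lebesgue_on {0..1 :: real}"

lemma integral_normal_density_iexp:
  assumes "\<sigma> > 0"
  shows "(CLINT x|lborel. normal_density 0 \<sigma> x *\<^sub>R iexp (t * x)) = exp (- (\<sigma>\<^sup>2 * t\<^sup>2) / 2)"
    and "integrable lborel (\<lambda>x. normal_density 0 \<sigma> x *\<^sub>R iexp (t * x))"
proof -
  have "(CLINT x|lborel. normal_density 0 \<sigma> x *\<^sub>R iexp (t * x))
     = (CLINT x|lborel. std_normal_density x *\<^sub>R iexp ((t * \<sigma>) * x))"
    using assms by (subst lborel_integral_real_affine[where c=\<sigma> and t=0])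
      (auto simp: normal_density_def real_sqrt_mult power_mult_distrib scaleR_scaleR
           mult.assoc simp flip: integral_scaleR_right intro!: Bochner_Integration.integral_cong)
  also have "\<dots> = char std_normal_distribution (t * \<sigma>)"
    unfolding char_def by (subst integral_density) (auto simp: normal_density_nonneg)
  also have "\<dots> = exp (- (\<sigma>\<^sup>2 * t\<^sup>2) / 2)"
    by (simp add: char_std_normal_distribution power_mult_distrib mult.commute flip: exp_of_real)
  finally show "(CLINT x|lborel. normal_density 0 \<sigma> x *\<^sub>R iexp (t * x)) = exp (- (\<sigma>\<^sup>2 * t\<^sup>2) / 2)" .
  show "integrable lborel (\<lambda>x. normal_density 0 \<sigma> x *\<^sub>R iexp (t * x))"
    using integrable_normal_density[OF assms, of 0]
    by (rule Bochner_Integration.integrable_bound) (auto simp: normal_density_nonneg)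
qed

lemma integral_normal_density_vec_iexp:
  fixes c :: "real ^ 'n"
  assumes "\<sigma> > 0"
  shows "(CLINT x|lborel. (\<Prod>i\<in>UNIV. normal_density 0 \<sigma> (x $ i)) *\<^sub>R iexp (c \<bullet> x))
      = exp (- (\<sigma>\<^sup>2 * (norm c)\<^sup>2) / 2)"
proof -
  interpret product_sigma_finite "\<lambda>_. lborel :: real measure" ..
  let ?B = "Basis :: (real ^ 'n) set"
  have inj: "inj (\<lambda>i. axis i 1 :: real ^ 'n)" by (auto simp: inj_def axis_eq_axis)
  have B: "?B = range (\<lambda>i. axis i 1)" by (auto simp: Basis_vec_def)
  have prodB: "(\<Prod>i\<in>UNIV. g (axis i 1)) = (\<Prod>b\<in>?B. g b)" for g :: "real ^ 'n \<Rightarrow> 'c::comm_monoid_mult"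
    unfolding B using inj by (simp add: prod.reindex)
  have 1: "(\<Prod>i\<in>UNIV. normal_density 0 \<sigma> (x $ i)) *\<^sub>R iexp (c \<bullet> x)
      = (\<Prod>b\<in>?B. normal_density 0 \<sigma> (x \<bullet> b) *\<^sub>R iexp ((c \<bullet> b) * (x \<bullet> b)))" for x
  proof -
    have "(\<Prod>i\<in>UNIV. normal_density 0 \<sigma> (x $ i)) = (\<Prod>b\<in>?B. normal_density 0 \<sigma> (x \<bullet> b))"
      using prodB[of "\<lambda>b. normal_density 0 \<sigma> (x \<bullet> b)"] by (simp add: inner_axis)
    moreover have "iexp (c \<bullet> x) = (\<Prod>b\<in>?B. iexp ((c \<bullet> b) * (x \<bullet> b)))"
      by (simp add: euclidean_inner[of c x] exp_sum[symmetric] sum_distrib_left)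
    ultimately show ?thesis by (simp add: scaleR_conv_of_real prod.distrib)
  qed
  \<comment> \<open>Lebesgue measure on \<open>real ^ 'n\<close> is by definition the image of a
    product of one-dimensional Lebesgue measures, so the integral factorises over the basis.\<close>
  have "(CLINT x|lborel. (\<Prod>b\<in>?B. normal_density 0 \<sigma> (x \<bullet> b) *\<^sub>R iexp ((c \<bullet> b) * (x \<bullet> b))))
     = (CLINT f|(\<Pi>\<^sub>M b\<in>?B. lborel). (\<Prod>b\<in>?B. normal_density 0 \<sigma> (f b) *\<^sub>R iexp ((c \<bullet> b) * f b)))"
    unfolding lborel_def[where 'a="real ^ 'n"] lborel_eq_real[symmetric]
    by (subst integral_distr) (auto intro!: Bochner_Integration.integral_cong prod.cong simp: inner_sum_left_Basis)
  also have "\<dots> = (\<Prod>b\<in>?B. CLINT x|lborel. normal_density 0 \<sigma> x *\<^sub>R iexp ((c \<bullet> b) * x))"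
    using integral_normal_density_iexp(2)[OF assms] by (intro product_integral_prod) auto
  also have "\<dots> = exp (\<Sum>b\<in>?B. complex_of_real (- (\<sigma>\<^sup>2 * (c \<bullet> b)\<^sup>2) / 2))"
    by (simp only: integral_normal_density_iexp(1)[OF assms] exp_sum[OF finite_Basis] exp_of_real)
  also have "(\<Sum>b\<in>?B. complex_of_real (- (\<sigma>\<^sup>2 * (c \<bullet> b)\<^sup>2) / 2)) = complex_of_real (- (\<sigma>\<^sup>2 * (norm c)\<^sup>2) / 2)"
  proof -
    have "(\<Sum>b\<in>?B. - (\<sigma>\<^sup>2 * (c \<bullet> b)\<^sup>2) / 2) = - (\<sigma>\<^sup>2 * (norm c)\<^sup>2) / 2"
      unfolding power2_norm_eq_inner euclidean_inner[of c c]
      by (simp add: sum_distrib_left sum_negf power2_eq_square sum_divide_distrib)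
    then show ?thesis by (simp only: of_real_sum[symmetric])
  qed
  finally show ?thesis unfolding 1 by (simp only: exp_of_real)
qed

lemma wiener_increment_iexp:
  fixes M :: "(real \<Rightarrow> real ^ 'n) measure"
  assumes "wiener_measure M" "0 \<le> s" "s < t" "t \<le> 1"
  shows "(CLINT w|M. iexp (c \<bullet> (w t - w s))) = exp (- ((t - s) * (norm c)\<^sup>2) / 2)"
proof -
  let ?f = "\<lambda>x. \<Prod>i\<in>UNIV. normal_density 0 (sqrt (t - s)) (x $ i)"
  have d: "distributed M lborel (\<lambda>w. w t - w s) (\<lambda>x. ennreal (?f x))"
    using assms by (auto simp: wiener_measure_def)
  have [measurable]: "(\<lambda>w. w t - w s) \<in> borel_measurable M"
    using distributed_measurable[OF d] by simp
  have "(CLINT w|M. iexp (c \<bullet> (w t - w s))) = (CLINT x|distr M lborel (\<lambda>w. w t - w s). iexp (c \<bullet> x))"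
    by (subst integral_distr) auto
  also have "\<dots> = (CLINT x|density lborel (\<lambda>x. ennreal (?f x)). iexp (c \<bullet> x))"
    using distributed_distr_eq_density[OF d] by simp
  also have "\<dots> = (CLINT x|lborel. ?f x *\<^sub>R iexp (c \<bullet> x))"
  proof (subst integral_density)
    have "(\<lambda>x::real^'n. x $ i) \<in> borel_measurable borel" for i
      by (intro borel_measurable_continuous_onI continuous_intros)
    then show "?f \<in> borel_measurable lborel" by (auto intro!: borel_measurable_prod measurable_compose[OF _ borel_measurable_normal_density])
  qed (auto intro!: prod_nonneg)
  also have "\<dots> = exp (- ((t - s) * (norm c)\<^sup>2) / 2)"
    using assms by (subst integral_normal_density_vec_iexp) auto
  finally show ?thesis .
qed

lemma wiener_partition_iexp:
  fixes M :: "(real \<Rightarrow> real ^ 'n) measure"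
  assumes "wiener_measure M" and mono: "mono_on {..m} \<tau>" and "\<tau> ` {..m} \<subseteq> {0..1}"
  shows "(CLINT w|M. iexp (\<Sum>k<m. d k \<bullet> (w (\<tau> (Suc k)) - w (\<tau> k))))
     = exp (- (\<Sum>k<m. (\<tau> (Suc k) - \<tau> k) * (norm (d k))\<^sup>2) / 2)"
proof -
  interpret prob_space M using assms by (simp add: wiener_measure_def)
  have "indep_vars (\<lambda>_. borel) (\<lambda>k w. w (\<tau> (Suc k)) - w (\<tau> k)) {..<m}"
    using assms by (auto simp: wiener_measure_def)
  then have "indep_vars (\<lambda>_. borel) (\<lambda>k w. (\<lambda>x. iexp (d k \<bullet> x)) (w (\<tau> (Suc k)) - w (\<tau> k))) {..<m}"
    by (rule indep_vars_compose2) simp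
  then have i: "indep_vars (\<lambda>_. borel) (\<lambda>k w. iexp (d k \<bullet> (w (\<tau> (Suc k)) - w (\<tau> k)))) {..<m}" .
  have int: "integrable M (\<lambda>w. iexp (d k \<bullet> (w (\<tau> (Suc k)) - w (\<tau> k))))" if "k < m" for k
    using i that by (intro integrable_const_bound[where B=1]) (auto simp: indep_vars_def)
  have "(CLINT w|M. iexp (\<Sum>k<m. d k \<bullet> (w (\<tau> (Suc k)) - w (\<tau> k))))
     = (CLINT w|M. (\<Prod>k<m. iexp (d k \<bullet> (w (\<tau> (Suc k)) - w (\<tau> k)))))"
    by (simp add: exp_sum sum_distrib_left)
  also have "\<dots> = (\<Prod>k<m. CLINT w|M. iexp (d k \<bullet> (w (\<tau> (Suc k)) - w (\<tau> k))))"
    using i int by (intro indep_vars_lebesgue_integral) auto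
  also have "\<dots> = (\<Prod>k<m. complex_of_real (exp (- ((\<tau> (Suc k) - \<tau> k) * (norm (d k))\<^sup>2) / 2)))"
  proof (rule prod.cong[OF refl])
    fix k assume k: "k \<in> {..<m}"
    then have le: "\<tau> k \<le> \<tau> (Suc k)" "0 \<le> \<tau> k" "\<tau> (Suc k) \<le> 1"
      using mono_onD[OF mono, of k "Suc k"] assms(3) by (auto simp: image_subset_iff)
    \<comment> \<open>\<open>mono_on\<close> allows repeated times, whereas increments have a normal
      density only for \<open>s < t\<close>; an empty interval contributes the factor 1.\<close>
    show "(CLINT w|M. iexp (d k \<bullet> (w (\<tau> (Suc k)) - w (\<tau> k)))) = complex_of_real (exp (- ((\<tau> (Suc k) - \<tau> k) * (norm (d k))\<^sup>2) / 2))"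
    proof (cases "\<tau> k = \<tau> (Suc k)")
      case True
      then show ?thesis by (simp add: prob_space)
    next
      case False
      then show ?thesis using le assms(1) by (subst wiener_increment_iexp) auto
    qed
  qed
  also have "\<dots> = exp (- (\<Sum>k<m. (\<tau> (Suc k) - \<tau> k) * (norm (d k))\<^sup>2) / 2)"
    by (simp add: exp_sum[symmetric] sum_negf sum_divide_distrib flip: of_real_prod)
  finally show ?thesis .
qed

text \<open>The intervals of a step list may overlap. On a grid containing all endpoints, each cell
  collects the coefficients of the intervals that cover it, for the function and for the integral
  alike.\<close>

lemma vstep_partition:
  assumes "valid_vstep S" and "\<forall>(a, b, c)\<in>set S. a \<in> \<tau> ` {..m} \<and> b \<in> \<tau> ` {..m}"
    and smono: "strict_mono_on {..m} \<tau>"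
  shows "\<exists>d. (\<forall>s. vstep_fun S s = (\<Sum>k<m. indicat_real {\<tau> k<..\<tau> (Suc k)} s *\<^sub>R d k)) \<and>
    (\<forall>w. vstep_int S w = (\<Sum>k<m. d k \<bullet> (w (\<tau> (Suc k)) - w (\<tau> k))))"
  using assms(1,2)
proof (induction S)
  case Nil
  show ?case by (rule exI[of _ "\<lambda>_. 0"]) simp
next
  case (Cons x S)
  obtain a b c where x: "x = (a, b, c)" by (cases x)
  have "valid_vstep S" "\<forall>(a, b, c)\<in>set S. a \<in> \<tau> ` {..m} \<and> b \<in> \<tau> ` {..m}"
    using Cons.prems by (auto simp: x)
  from Cons.IH[OF this] obtain d where
    d: "\<And>s. vstep_fun S s = (\<Sum>k<m. indicat_real {\<tau> k<..\<tau> (Suc k)} s *\<^sub>R d k)"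
       "\<And>w. vstep_int S w = (\<Sum>k<m. d k \<bullet> (w (\<tau> (Suc k)) - w (\<tau> k)))" by blast
  have ab: "a \<le> b" "a \<in> \<tau> ` {..m}" "b \<in> \<tau> ` {..m}" using Cons.prems by (auto simp: x)
  then obtain i j where ij: "a = \<tau> i" "b = \<tau> j" "i \<le> m" "j \<le> m" by auto
  have "i \<le> j" using ab ij strict_mono_on_less_eq[OF smono, of i j] by auto
  define e where "e k = (if i \<le> k \<and> k < j then c else 0)" for k
  \<comment> \<open>The identity serves twice: for \<open>f = w\<close> it splits the increment of a
    path, and for \<open>f x = indicat_real {..x} s\<close> it splits the indicator of
    \<open>{a<..b}\<close>.\<close>
  have tel: "f b - f a = (\<Sum>k<m. if i \<le> k \<and> k < j then f (\<tau> (Suc k)) - f (\<tau> k) else 0)"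
    for f :: "real \<Rightarrow> 'v::ab_group_add"
  proof -
    have "f b - f a = (\<Sum>k\<in>{i..<j}. f (\<tau> (Suc k)) - f (\<tau> k))"
      using sum_Suc_diff'[OF \<open>i \<le> j\<close>, of "\<lambda>k. f (\<tau> k)"] ij by simp
    also have "\<dots> = (\<Sum>k<m. if i \<le> k \<and> k < j then f (\<tau> (Suc k)) - f (\<tau> k) else 0)"
      using ij by (subst sum.inter_filter[symmetric]) (auto intro!: sum.cong)
    finally show ?thesis .
  qed
  have ind: "indicat_real {u<..v} s = indicat_real {..v} s *\<^sub>R 1 - indicat_real {..u} s *\<^sub>R 1"
    if "u \<le> v" for u v and s :: real
    using that by (auto simp: indicator_def)
  have le: "\<tau> k \<le> \<tau> (Suc k)" if "k < m" for k
    using strict_mono_onD[OF smono, of k "Suc k"] that by simp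
  have f1: "indicat_real {a<..b} s *\<^sub>R c = (\<Sum>k<m. indicat_real {\<tau> k<..\<tau> (Suc k)} s *\<^sub>R e k)" for s
  proof -
    have "indicat_real {a<..b} s *\<^sub>R c = (\<Sum>k<m. if i \<le> k \<and> k < j then indicat_real {..\<tau> (Suc k)} s - indicat_real {..\<tau> k} s else 0) *\<^sub>R c"
      using ind[OF ab(1), of s] tel[of "\<lambda>x. indicat_real {..x} s"] by simp
    also have "\<dots> = (\<Sum>k<m. indicat_real {\<tau> k<..\<tau> (Suc k)} s *\<^sub>R e k)"
      unfolding scaleR_sum_left by (rule sum.cong) (auto simp: e_def ind[OF le])
    finally show ?thesis .
  qed
  have f2: "c \<bullet> (w b - w a) = (\<Sum>k<m. e k \<bullet> (w (\<tau> (Suc k)) - w (\<tau> k)))" for w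
    unfolding tel[of w] inner_sum_right by (rule sum.cong) (auto simp: e_def)
  show ?case
    by (rule exI[of _ "\<lambda>k. e k + d k"])
      (simp add: x f1 f2 d scaleR_add_right inner_add_left sum.distrib)
qed

lemma measure_L01_Ioc: "0 \<le> a \<Longrightarrow> a \<le> b \<Longrightarrow> b \<le> 1 \<Longrightarrow> measure L01 {a<..b} = b - a"
  by (subst measure_restrict_space) auto

text \<open>On the grid of all endpoints the cells are disjoint, so the squared norm of the
  integrand has no cross terms and its integral is the variance found from independent
  increments.\<close>

lemma vstep_int_iexp:
  fixes M :: "(real \<Rightarrow> real ^ 'n) measure"
  assumes M: "wiener_measure M" and S: "valid_vstep S"
  shows "(CLINT w|M. iexp (vstep_int S w)) = exp (- (LINT s|L01. (norm (vstep_fun S s))\<^sup>2) / 2)"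
proof -
  \<comment> \<open>Adding 0 and 1 keeps the grid nonempty for the empty list.\<close>
  define P where "P = {0, 1} \<union> (\<Union>(a, b, c)\<in>set S. {a, b})"
  have P: "finite P" "P \<subseteq> {0..1}" using S by (auto simp: P_def valid_vstep_def)
  define xs where "xs = sorted_list_of_set P"
  let ?J = "\<lambda>k. {xs ! k<..xs ! Suc k}"
  have xs: "set xs = P" "sorted xs" "distinct xs" using P(1) by (auto simp: xs_def)
  define m where "m = length xs - 1"
  have "xs \<noteq> []" using xs(1) by (auto simp: P_def)
  then have len: "length xs = Suc m" by (cases xs) (auto simp: m_def)
  have sm: "strict_mono_on {..m} ((!) xs)"
    using len xs(2,3) by (intro strict_mono_onI) (simp add: sorted_wrt_nth_less strict_sorted_iff)
  have im: "(!) xs ` {..m} = P"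
    using len xs(1) by (auto simp: set_conv_nth less_Suc_eq_le image_def)
  obtain d where d: "\<And>s. vstep_fun S s = (\<Sum>k<m. indicat_real (?J k) s *\<^sub>R d k)"
    "\<And>w. vstep_int S w = (\<Sum>k<m. d k \<bullet> (w (xs ! Suc k) - w (xs ! k)))"
  proof -
    have "\<forall>(a, b, c)\<in>set S. a \<in> (!) xs ` {..m} \<and> b \<in> (!) xs ` {..m}"
      unfolding im by (auto simp: P_def)
    from vstep_partition[OF S this sm] that show ?thesis by blast
  qed
  have mono: "mono_on {..m} ((!) xs)" using sm by (rule strict_mono_on_imp_mono_on)
  have in01: "xs ! k \<in> {0..1}" if "k \<le> m" for k using im P(2) that by auto
  have le: "xs ! k \<le> xs ! Suc k" if "k < m" for k
    using mono_onD[OF mono, of k "Suc k"] that by simp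
  have "(norm (vstep_fun S s))\<^sup>2 = (\<Sum>k<m. (norm (d k))\<^sup>2 * indicat_real (?J k) s)" for s
  proof -
    have dis: "indicat_real (?J k) s * indicat_real (?J l) s
       = (if l = k then indicat_real (?J k) s else 0)" if kl: "k < m" "l < m" for k l
    proof -
      have "xs ! Suc k \<le> xs ! l" if "k < l" using mono_onD[OF mono, of "Suc k" l] that kl by simp
      moreover have "xs ! Suc l \<le> xs ! k" if "l < k" using mono_onD[OF mono, of "Suc l" k] that kl by simp
      ultimately show ?thesis by (cases k l rule: linorder_cases) (auto simp: indicator_def)
    qed
    have "(norm (vstep_fun S s))\<^sup>2 = (\<Sum>k<m. \<Sum>l<m. (indicat_real (?J k) s * indicat_real (?J l) s) * (d k \<bullet> d l))"
      unfolding d power2_norm_eq_inner inner_sum_left inner_sum_right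
      by (intro sum.cong refl) (auto simp: indicator_def inner_commute)
    also have "\<dots> = (\<Sum>k<m. \<Sum>l<m. if l = k then (norm (d k))\<^sup>2 * indicat_real (?J k) s else 0)"
      by (intro sum.cong refl) (auto simp: dis power2_norm_eq_inner)
    also have "\<dots> = (\<Sum>k<m. (norm (d k))\<^sup>2 * indicat_real (?J k) s)"
      by simp
    finally show ?thesis .
  qed
  then have "(LINT s|L01. (norm (vstep_fun S s))\<^sup>2) = (LINT s|L01. (\<Sum>k<m. (norm (d k))\<^sup>2 * indicat_real (?J k) s))"
    by simp
  also have "\<dots> = (\<Sum>k<m. (norm (d k))\<^sup>2 * measure L01 (?J k))"
  proof (subst Bochner_Integration.integral_sum)
    fix k assume k: "k \<in> {..<m}"
    have sub: "?J k \<subseteq> {0..1}" using in01[of k] in01[of "Suc k"] k by auto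
    then have "?J k \<in> sets L01" by (simp add: sets_restrict_space_iff)
    moreover have "emeasure L01 (?J k) < \<infinity>"
      using sub le[of k] k by (subst emeasure_restrict_space) auto
    ultimately show "integrable L01 (\<lambda>s. (norm (d k))\<^sup>2 * indicat_real (?J k) s)"
      by (intro integrable_mult_right integrable_real_indicator)
  next
    have "?J k \<inter> {0..1} = ?J k" if "k < m" for k
      using in01[of k] in01[of "Suc k"] that by auto
    then show "(\<Sum>k<m. LINT s|L01. (norm (d k))\<^sup>2 * indicat_real (?J k) s) = (\<Sum>k<m. (norm (d k))\<^sup>2 * measure L01 (?J k))"
      by (intro sum.cong) auto
  qed
  also have "\<dots> = (\<Sum>k<m. (xs ! Suc k - xs ! k) * (norm (d k))\<^sup>2)"
    using in01 le by (intro sum.cong refl) (subst measure_L01_Ioc, auto)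
  finally have e: "(LINT s|L01. (norm (vstep_fun S s))\<^sup>2) = (\<Sum>k<m. (xs ! Suc k - xs ! k) * (norm (d k))\<^sup>2)" .
  show ?thesis
    unfolding e d(2) using im P(2) by (intro wiener_partition_iexp[OF M mono]) auto
qed

section \<open>Mean square convergence\<close>

text \<open>The squared \<open>L\<^sup>2\<close> norm, with values in \<open>ennreal\<close> so that
  estimates carry no integrability conditions. Keeping the square matches
  \<open>wiener_integral\<close>; the triangle inequality then costs the factor 2 of
  \<open>sqnorm_add\<close>.\<close>

definition sqnorm :: "'a measure \<Rightarrow> ('a \<Rightarrow> 'b::euclidean_space) \<Rightarrow> ennreal" where
  "sqnorm M f = (\<integral>\<^sup>+ x. ennreal ((norm (f x))\<^sup>2) \<partial>M)"

lemma norm_add_sq: "(norm (a + b :: 'b::real_inner))\<^sup>2 \<le> 2 * (norm a)\<^sup>2 + 2 * (norm b)\<^sup>2"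
proof -
  have "(norm (a + b))\<^sup>2 + (norm (a - b))\<^sup>2 = 2 * (norm a)\<^sup>2 + 2 * (norm b)\<^sup>2"
    by (simp add: power2_norm_eq_inner inner_add inner_diff inner_commute)
  then show ?thesis by (smt (verit) zero_le_power2)
qed

lemma sqnorm_add:
  assumes [measurable]: "f \<in> borel_measurable M" "g \<in> borel_measurable M"
  shows "sqnorm M (\<lambda>x. f x + g x) \<le> 2 * sqnorm M f + 2 * sqnorm M g"
proof -
  have "sqnorm M (\<lambda>x. f x + g x) \<le> (\<integral>\<^sup>+ x. 2 * ennreal ((norm (f x))\<^sup>2) + 2 * ennreal ((norm (g x))\<^sup>2) \<partial>M)"
    unfolding sqnorm_def
  proof (rule nn_integral_mono)
    fix x
    have "ennreal ((norm (f x + g x))\<^sup>2) \<le> ennreal (2 * (norm (f x))\<^sup>2 + 2 * (norm (g x))\<^sup>2)"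
      by (rule ennreal_leI, rule norm_add_sq)
    then show "ennreal ((norm (f x + g x))\<^sup>2) \<le> 2 * ennreal ((norm (f x))\<^sup>2) + 2 * ennreal ((norm (g x))\<^sup>2)"
      by (simp add: ennreal_mult)
  qed
  also have "\<dots> = 2 * sqnorm M f + 2 * sqnorm M g"
    unfolding sqnorm_def by (subst nn_integral_add) (auto simp: nn_integral_cmult)
  finally show ?thesis .
qed

lemma sqnorm_scale:
  assumes [measurable]: "f \<in> borel_measurable M"
  shows "sqnorm M (\<lambda>x. c *\<^sub>R f x) = ennreal (c\<^sup>2) * sqnorm M f"
  unfolding sqnorm_def by (subst nn_integral_cmult[symmetric]) (auto simp: power_mult_distrib ennreal_mult)

lemma sqnorm_mono: "(\<And>x. x \<in> space M \<Longrightarrow> norm (f x) \<le> norm (g x)) \<Longrightarrow> sqnorm M f \<le> sqnorm M g"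
  unfolding sqnorm_def by (intro nn_integral_mono ennreal_leI power_mono) auto

text \<open>The bound \<open>e / 4\<close> pays for the factor 2 in \<open>sqnorm_add\<close>,
  twice.\<close>

lemma sqnorm_triangle_less:
  assumes [measurable]: "f \<in> borel_measurable M" "g \<in> borel_measurable M" "h \<in> borel_measurable M"
    and "sqnorm M (\<lambda>x. f x - g x) < ennreal (e / 4)" "sqnorm M (\<lambda>x. g x - h x) < ennreal (e / 4)" "0 < e"
  shows "sqnorm M (\<lambda>x. f x - h x) < ennreal e"
proof -
  have "sqnorm M (\<lambda>x. f x - h x) = sqnorm M (\<lambda>x. (f x - g x) + (g x - h x))" by simp
  also have "\<dots> \<le> 2 * sqnorm M (\<lambda>x. f x - g x) + 2 * sqnorm M (\<lambda>x. g x - h x)"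
    by (rule sqnorm_add) auto
  also have "\<dots> < 2 * ennreal (e / 4) + 2 * ennreal (e / 4)"
    using assms by (intro add_strict_mono ennreal_mult_strict_left_mono) auto
  also have "\<dots> = ennreal e"
    using assms(6) by (simp add: ennreal_plus[symmetric] ennreal_mult'[symmetric] flip: ennreal_numeral del: ennreal_plus)
  finally show ?thesis .
qed

lemma sqnorm_finite_integrable:
  assumes [measurable]: "f \<in> borel_measurable M" and "sqnorm M f < \<infinity>"
  shows "integrable M (\<lambda>x. (norm (f x))\<^sup>2)" "sqnorm M f = ennreal (LINT x|M. (norm (f x))\<^sup>2)"
proof -
  show i: "integrable M (\<lambda>x. (norm (f x))\<^sup>2)"
    using assms(2) by (intro integrableI_nonneg) (auto simp: sqnorm_def)
  show "sqnorm M f = ennreal (LINT x|M. (norm (f x))\<^sup>2)"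
    unfolding sqnorm_def using i by (intro nn_integral_eq_integral) auto
qed

text \<open>Expand \<open>a = (a - b) + b\<close> and apply Young's inequality with weight
  \<open>\<delta>\<close> to the cross term. A small \<open>\<delta>\<close> controls the fixed part
  \<open>b\<close>, and the large factor \<open>1 + 1/\<delta>\<close> falls on the difference,
  which tends to 0.\<close>

lemma norm_sq_diff_le:
  fixes a b :: "'b::real_inner"
  assumes "\<delta> > 0"
  shows "\<bar>(norm a)\<^sup>2 - (norm b)\<^sup>2\<bar> \<le> (1 + 1/\<delta>) * (norm (a - b))\<^sup>2 + \<delta> * (norm b)\<^sup>2"
proof -
  let ?x = "norm (a - b)" and ?y = "norm b"
  have "(norm a)\<^sup>2 - (norm b)\<^sup>2 = ?x\<^sup>2 + 2 * inner (a - b) b"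
    by (simp add: power2_norm_eq_inner inner_diff inner_commute)
  then have "\<bar>(norm a)\<^sup>2 - (norm b)\<^sup>2\<bar> \<le> ?x\<^sup>2 + 2 * (?x * ?y)"
    using Cauchy_Schwarz_ineq2[of "a - b" b] by (simp add: abs_le_iff) (smt (verit) zero_le_power2)
  moreover have "2 * (?x * ?y) \<le> (1/\<delta>) * ?x\<^sup>2 + \<delta> * ?y\<^sup>2"
  proof -
    have "0 \<le> (1/\<delta>) * (?x - \<delta> * ?y)\<^sup>2" using assms by simp
    also have "\<dots> = (1/\<delta>) * ?x\<^sup>2 + \<delta> * ?y\<^sup>2 - 2 * (?x * ?y)"
      using assms by (simp add: power2_eq_square field_simps)
    finally show ?thesis by simp
  qed
  ultimately show ?thesis by (simp add: algebra_simps)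
qed

lemma sqnorm_tendsto:
  fixes f :: "'a \<Rightarrow> 'b::euclidean_space"
  assumes m [measurable]: "\<And>m. f' m \<in> borel_measurable M" "f \<in> borel_measurable M"
    and fin: "sqnorm M f < \<infinity>" and lim: "(\<lambda>m. sqnorm M (\<lambda>x. f' m x - f x)) \<longlonglongrightarrow> 0"
  shows "(\<lambda>m. LINT x|M. (norm (f' m x))\<^sup>2) \<longlonglongrightarrow> (LINT x|M. (norm (f x))\<^sup>2)"
proof (rule LIMSEQ_I)
  fix r :: real assume r: "r > 0"
  define K where "K = (LINT x|M. (norm (f x))\<^sup>2)"
  have K: "K \<ge> 0" by (simp add: K_def)
  \<comment> \<open>\<open>k\<close> exceeds \<open>K\<close> so as to be positive even for
    \<open>K = 0\<close>. Then \<open>\<delta>\<close> and \<open>\<eta>\<close> are chosen to make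
    both terms of the bound equal to \<open>r / 2\<close>.\<close>
  define k where "k = K + 1"
  have k: "k > 0" "K < k" using K by (simp_all add: k_def)
  define \<delta> where "\<delta> = r / (2 * k)"
  have \<delta>: "\<delta> > 0" using k r by (simp add: \<delta>_def)
  define \<eta> where "\<eta> = r / (2 * (1 + 1/\<delta>))"
  have \<eta>: "\<eta> > 0" using r \<delta> by (simp add: \<eta>_def add_pos_pos)
  have "\<forall>\<^sub>F m in sequentially. sqnorm M (\<lambda>x. f' m x - f x) < ennreal \<eta>"
    using order_tendstoD(2)[OF lim] \<eta> by simp
  then obtain m0 where m0: "\<And>m. m \<ge> m0 \<Longrightarrow> sqnorm M (\<lambda>x. f' m x - f x) < ennreal \<eta>"
    by (auto simp: eventually_sequentially)
  have "norm ((LINT x|M. (norm (f' m x))\<^sup>2) - K) < r" if mm: "m \<ge> m0" for m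
  proof -
    have sf: "sqnorm M (\<lambda>x. f' m x - f x) < \<infinity>" using m0[OF mm] by (simp add: order.strict_trans)
    note i1 = sqnorm_finite_integrable[OF _ sf] and i2 = sqnorm_finite_integrable(1)[OF m(2) fin]
    have i1': "integrable M (\<lambda>x. (norm (f' m x - f x))\<^sup>2)" by (rule i1) measurable
    have "ennreal (LINT x|M. (norm (f' m x - f x))\<^sup>2) < ennreal \<eta>"
      using m0[OF mm] by (subst i1(2)[symmetric]) auto
    then have small: "(LINT x|M. (norm (f' m x - f x))\<^sup>2) < \<eta>" using ennreal_less_iff by fastforce
    have i3: "integrable M (\<lambda>x. (norm (f' m x))\<^sup>2)"
    proof (rule Bochner_Integration.integrable_bound)
      show "integrable M (\<lambda>x. 2 * (norm (f' m x - f x))\<^sup>2 + 2 * (norm (f x))\<^sup>2)"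
        using i1' i2 by auto
      show "AE x in M. norm ((norm (f' m x))\<^sup>2) \<le> norm (2 * (norm (f' m x - f x))\<^sup>2 + 2 * (norm (f x))\<^sup>2)"
        using norm_add_sq[of "f' m x - f x" "f x" for x] by (auto intro!: AE_I2 order_trans[OF _ abs_ge_self])
    qed measurable
    have "\<bar>(LINT x|M. (norm (f' m x))\<^sup>2) - K\<bar> = \<bar>LINT x|M. (norm (f' m x))\<^sup>2 - (norm (f x))\<^sup>2\<bar>"
      unfolding K_def using i2 i3 by (subst Bochner_Integration.integral_diff) auto
    also have "\<dots> \<le> (LINT x|M. \<bar>(norm (f' m x))\<^sup>2 - (norm (f x))\<^sup>2\<bar>)"
      by (rule integral_abs_bound)
    also have "\<dots> \<le> (LINT x|M. (1 + 1/\<delta>) * (norm (f' m x - f x))\<^sup>2 + \<delta> * (norm (f x))\<^sup>2)"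
      using i1' i2 i3 norm_sq_diff_le[OF \<delta>]
      by (intro integral_mono integrable_abs Bochner_Integration.integrable_diff
          Bochner_Integration.integrable_add integrable_mult_right) auto
    also have "\<dots> = (1 + 1/\<delta>) * (LINT x|M. (norm (f' m x - f x))\<^sup>2) + \<delta> * K"
      unfolding K_def using i1' i2 by simp
    also have "\<dots> < (1 + 1/\<delta>) * \<eta> + \<delta> * k"
      using small \<delta> k by (intro add_strict_mono mult_strict_left_mono) (auto simp: add_pos_pos)
    also have "(1 + 1/\<delta>) * \<eta> = r / 2"
    proof -
      have "1 + 1/\<delta> > 0" using \<delta> by (simp add: add_pos_pos)
      then show ?thesis unfolding \<eta>_def by (simp add: field_simps)
    qed
    also have "\<delta> * k = r / 2" 
      using k by (simp add: \<delta>_def)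
    finally show ?thesis by simp
  qed
  then show "\<exists>m0. \<forall>m\<ge>m0. norm ((LINT x|M. (norm (f' m x))\<^sup>2) - (LINT x|M. (norm (f x))\<^sup>2)) < r"
    unfolding K_def by blast
qed

lemma (in prob_space) norm_integral_sq_le:
  fixes f :: "'a \<Rightarrow> 'b::euclidean_space"
  assumes "integrable M f"
  shows "ennreal ((norm (\<integral>x. f x \<partial>M))\<^sup>2) \<le> sqnorm M f"
proof -
  have [measurable]: "f \<in> borel_measurable M" using assms by auto
  have "ennreal ((norm (\<integral>x. f x \<partial>M))\<^sup>2) = (ennreal (norm (\<integral>x. f x \<partial>M)))\<^sup>2"
    by (simp add: ennreal_power)
  also have "\<dots> \<le> (\<integral>\<^sup>+ x. norm (f x) * 1 \<partial>M)\<^sup>2"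
    using integral_norm_bound_ennreal[OF assms] by (intro power_mono) auto
  also have "\<dots> \<le> (\<integral>\<^sup>+ x. (ennreal (norm (f x)))\<^sup>2 \<partial>M) * (\<integral>\<^sup>+ x. 1\<^sup>2 \<partial>M)"
    using Cauchy_Schwarz_nn_integral[of "\<lambda>x. ennreal (norm (f x))" M "\<lambda>_. 1"] by simp
  also have "\<dots> = sqnorm M f" by (simp add: sqnorm_def ennreal_power emeasure_space_1)
  finally show ?thesis .
qed

lemma norm_iexp_diff_le: "norm (iexp x - iexp y) \<le> \<bar>x - y\<bar>"
proof -
  have "iexp x - iexp y = iexp y * (iexp (x - y) - 1)"
    by (simp add: algebra_simps exp_add[symmetric])
  then have "norm (iexp x - iexp y) = norm (iexp (x - y) - 1)"
    by (simp add: norm_mult)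
  also have "\<dots> \<le> \<bar>x - y\<bar>" using iexp_approx1[of "x - y" 0] by simp
  finally show ?thesis .
qed

text \<open>\<open>iexp\<close> is 1-Lipschitz, and on a probability space an expectation is bounded
  by the mean square.\<close>

lemma (in prob_space) iexp_tendsto:
  assumes [measurable]: "\<And>m. X' m \<in> borel_measurable M" "X \<in> borel_measurable M"
    and lim: "(\<lambda>m. sqnorm M (\<lambda>x. X' m x - X x)) \<longlonglongrightarrow> 0"
  shows "(\<lambda>m. CLINT x|M. iexp (X' m x)) \<longlonglongrightarrow> (CLINT x|M. iexp (X x))"
proof -
  let ?d = "\<lambda>m. (CLINT x|M. iexp (X' m x)) - (CLINT x|M. iexp (X x))"
  have i: "integrable M (\<lambda>x. iexp (Y x))" if [measurable]: "Y \<in> borel_measurable M" for Y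
    by (rule integrable_const_bound[where B=1]) auto
  have "(\<lambda>m. ennreal ((norm (?d m))\<^sup>2)) \<longlonglongrightarrow> 0"
  proof (rule tendsto_sandwich[OF _ _ tendsto_const lim])
    show "\<forall>\<^sub>F m in sequentially. ennreal ((norm (?d m))\<^sup>2) \<le> sqnorm M (\<lambda>x. X' m x - X x)"
    proof (rule always_eventually, rule allI)
      fix m
      have "ennreal ((norm (?d m))\<^sup>2)
         = ennreal ((norm (CLINT x|M. iexp (X' m x) - iexp (X x)))\<^sup>2)"
        using i by (subst Bochner_Integration.integral_diff) auto
      also have "\<dots> \<le> sqnorm M (\<lambda>x. iexp (X' m x) - iexp (X x))"
        by (rule norm_integral_sq_le) (use i in auto)
      also have "\<dots> \<le> sqnorm M (\<lambda>x. X' m x - X x)"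
        by (rule sqnorm_mono) (simp add: norm_iexp_diff_le)
      finally show "ennreal ((norm (?d m))\<^sup>2) \<le> sqnorm M (\<lambda>x. X' m x - X x)" .
    qed
  qed auto
  then have "(\<lambda>m. (norm (?d m))\<^sup>2) \<longlonglongrightarrow> 0"
    by (intro tendsto_ennrealD[where x=0, unfolded ennreal_0]) auto
  from tendsto_real_sqrt[OF this] show ?thesis
    by (simp add: tendsto_norm_zero_iff LIM_zero_iff)
qed

section \<open>Wiener integrals\<close>

lemma vstep_fun_measurable [measurable]: "vstep_fun S \<in> borel_measurable L01"
proof (induction S)
  case Nil
  have "vstep_fun ([] :: 'a vstep) = (\<lambda>_. 0)" by (simp add: fun_eq_iff)
  then show ?case by simp
next
  case (Cons x S)
  obtain a b c where x: "x = (a, b, c)" by (cases x)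
  have "vstep_fun (x # S) = (\<lambda>s. indicat_real {a<..b} s *\<^sub>R c + vstep_fun S s)" by (simp add: fun_eq_iff x)
  moreover have "(\<lambda>s. indicat_real {a<..b} s *\<^sub>R c) \<in> borel_measurable L01"
    by (intro borel_measurable_scaleR measurable_restrict_space1 borel_measurable_indicator) auto
  ultimately show ?case using Cons by simp
qed

lemma vstep_fun_bounded: "\<exists>B\<ge>0. \<forall>s. norm (vstep_fun S s) \<le> B"
proof (induction S)
  case Nil
  show ?case by (rule exI[of _ 0]) simp
next
  case (Cons x S)
  obtain a b c where x: "x = (a, b, c)" by (cases x)
  obtain B where B: "B \<ge> 0" "\<And>s. norm (vstep_fun S s) \<le> B" using Cons by blast
  have "norm (vstep_fun (x # S) s) \<le> norm c + B" for s
    using norm_triangle_ineq[of "indicat_real {a<..b} s *\<^sub>R c" "vstep_fun S s"] B(2)[of s]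
    by (auto simp: x indicator_def intro: order_trans split: if_splits)
  then show ?case using B(1) by (intro exI[of _ "norm c + B"]) auto
qed

lemma prob_space_L01: "prob_space L01"
  by (rule prob_spaceI) (simp add: emeasure_restrict_space)

lemma sqnorm_bounded:
  assumes "\<And>s. s \<in> space M \<Longrightarrow> norm (h s) \<le> B" "B \<ge> 0" "prob_space M"
  shows "sqnorm M h \<le> ennreal (B\<^sup>2)"
proof -
  interpret prob_space M by fact
  have "sqnorm M h \<le> (\<integral>\<^sup>+ s. ennreal (B\<^sup>2) \<partial>M)"
    unfolding sqnorm_def using assms(1,2) by (intro nn_integral_mono ennreal_leI power_mono) auto
  then show ?thesis by (simp add: emeasure_space_1)
qed

text \<open>The summand 1 in the denominator covers \<open>c = 0\<close> without a case
  distinction.\<close>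

lemma ennreal_scale_less:
  assumes e: "0 < e" and x: "x < ennreal (e / (c\<^sup>2 + 1))"
  shows "ennreal (c\<^sup>2) * x < ennreal e"
proof -
  have c: "0 < c\<^sup>2 + 1" by (simp add: add_nonneg_pos)
  have "ennreal (c\<^sup>2) * x \<le> ennreal (c\<^sup>2) * ennreal (e / (c\<^sup>2 + 1))"
    using x by (intro mult_left_mono) auto
  also have "\<dots> = ennreal (c\<^sup>2 * (e / (c\<^sup>2 + 1)))" using c e by (intro ennreal_mult[symmetric]) auto
  also have "\<dots> < ennreal e" using c e by (intro ennreal_lessI) (auto simp: field_simps)
  finally show ?thesis .
qed

locale wiener =
  fixes M :: "(real \<Rightarrow> real ^ 'n) measure"
  assumes W: "wiener_measure M"
begin

sublocale prob_space M
  using W by (simp add: wiener_measure_def)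

lemma sets_M: "sets M = sets wiener_space"
  using W by (simp add: wiener_measure_def)

lemma vstep_int_measurable [measurable]: "valid_vstep S \<Longrightarrow> vstep_int S \<in> borel_measurable M"
  by (rule measurable_vstep_int[OF sets_M])

text \<open>\<open>WI h X\<close> means that \<open>X\<close> is a version of \<open>\<integral>\<^sub>0\<^sup>1 h \<bullet> dW\<close>, the integrand \<open>h\<close> being vector-valued.\<close>

definition WI :: "(real \<Rightarrow> real ^ 'n) \<Rightarrow> ((real \<Rightarrow> real ^ 'n) \<Rightarrow> real) \<Rightarrow> bool" where
  "WI h X \<longleftrightarrow> h \<in> borel_measurable L01 \<and> X \<in> borel_measurable M \<and>
     (\<forall>e>0. \<exists>S. valid_vstep S \<and> sqnorm L01 (\<lambda>s. vstep_fun S s - h s) < ennreal e \<and>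
        sqnorm M (\<lambda>w. vstep_int S w - X w) < ennreal e)"

lemma WI_measurable: "WI h X \<Longrightarrow> h \<in> borel_measurable L01" "WI h X \<Longrightarrow> X \<in> borel_measurable M"
  by (auto simp: WI_def)

lemma WI_approx:
  assumes "WI h X" "e > 0"
  obtains S where "valid_vstep S" "sqnorm L01 (\<lambda>s. vstep_fun S s - h s) < ennreal e"
    "sqnorm M (\<lambda>w. vstep_int S w - X w) < ennreal e"
  using assms unfolding WI_def by blast

lemma WI_vstep: "valid_vstep S \<Longrightarrow> WI (vstep_fun S) (vstep_int S)"
  by (auto simp: WI_def sqnorm_def intro!: exI[of _ S])

text \<open>\<open>WI\<close> is the closure of the graph of \<open>vstep_int\<close> in the product
  of two \<open>L\<^sup>2\<close> spaces, and a closure is closed.\<close>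

lemma WI_closed:
  assumes [measurable]: "h \<in> borel_measurable L01" "X \<in> borel_measurable M"
    and cl: "\<And>e. e > 0 \<Longrightarrow> \<exists>h' X'. WI h' X' \<and> sqnorm L01 (\<lambda>s. h' s - h s) < ennreal e \<and> sqnorm M (\<lambda>w. X' w - X w) < ennreal e"
  shows "WI h X"
  unfolding WI_def
proof (intro conjI allI impI)
  fix e :: real assume e: "e > 0"
  obtain h' X' where h': "WI h' X'" "sqnorm L01 (\<lambda>s. h' s - h s) < ennreal (e/4)" "sqnorm M (\<lambda>w. X' w - X w) < ennreal (e/4)"
    using cl[of "e/4"] e by auto
  obtain S where S: "valid_vstep S" "sqnorm L01 (\<lambda>s. vstep_fun S s - h' s) < ennreal (e/4)"
      "sqnorm M (\<lambda>w. vstep_int S w - X' w) < ennreal (e/4)"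
    using WI_approx[OF h'(1), of "e/4"] e by auto
  have [measurable]: "h' \<in> borel_measurable L01" "X' \<in> borel_measurable M" using WI_measurable[OF h'(1)] .
  have [measurable]: "vstep_int S \<in> borel_measurable M" using S(1) by measurable
  show "\<exists>S. valid_vstep S \<and> sqnorm L01 (\<lambda>s. vstep_fun S s - h s) < ennreal e \<and>
        sqnorm M (\<lambda>w. vstep_int S w - X w) < ennreal e"
    using S(1) sqnorm_triangle_less[OF _ _ _ S(2) h'(2) e] sqnorm_triangle_less[OF _ _ _ S(3) h'(3) e]
    by (intro exI[of _ S]) auto
qed (use assms in auto)

lemma WI_scale:
  assumes "WI h X"
  shows "WI (\<lambda>s. c *\<^sub>R h s) (\<lambda>w. c * X w)"
proof -
  have [measurable]: "h \<in> borel_measurable L01" "X \<in> borel_measurable M" using WI_measurable[OF assms] .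
  show ?thesis
    unfolding WI_def
  proof (intro conjI allI impI)
    fix e :: real assume e: "e > 0"
    define e' where "e' = e / (c\<^sup>2 + 1)"
    have e': "e' > 0" using e by (simp add: e'_def add_nonneg_pos)
    obtain S where S: "valid_vstep S" "sqnorm L01 (\<lambda>s. vstep_fun S s - h s) < ennreal e'" "sqnorm M (\<lambda>w. vstep_int S w - X w) < ennreal e'"
      using assms e' unfolding WI_def by blast
    obtain S' where S': "valid_vstep S'" "vstep_fun S' = (\<lambda>s. c *\<^sub>R vstep_fun S s)" "vstep_int S' = (\<lambda>w. c * vstep_int S w)"
      using vstep_int_scale[OF S(1)] by blast
    have [measurable]: "vstep_int S \<in> borel_measurable M" using S(1) by measurable
    have "sqnorm L01 (\<lambda>s. vstep_fun S' s - c *\<^sub>R h s) = ennreal (c\<^sup>2) * sqnorm L01 (\<lambda>s. vstep_fun S s - h s)"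
      unfolding S' by (subst sqnorm_scale[symmetric]) (auto simp: scaleR_diff_right)
    moreover have "sqnorm M (\<lambda>w. vstep_int S' w - c * X w) = ennreal (c\<^sup>2) * sqnorm M (\<lambda>w. vstep_int S w - X w)"
      unfolding S' by (subst sqnorm_scale[symmetric]) (auto simp: right_diff_distrib)
    ultimately show "\<exists>S. valid_vstep S \<and> sqnorm L01 (\<lambda>s. vstep_fun S s - c *\<^sub>R h s) < ennreal e \<and> sqnorm M (\<lambda>w. vstep_int S w - c * X w) < ennreal e"
      using S' ennreal_scale_less[OF e S(2)[unfolded e'_def]] ennreal_scale_less[OF e S(3)[unfolded e'_def]]
      by (intro exI[of _ S']) auto
  qed measurable
qed

lemma WI_add:
  assumes "WI h X" "WI g Y"
  shows "WI (\<lambda>s. h s + g s) (\<lambda>w. X w + Y w)"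
proof -
  have [measurable]: "h \<in> borel_measurable L01" "X \<in> borel_measurable M" "g \<in> borel_measurable L01" "Y \<in> borel_measurable M"
    by (rule WI_measurable[OF assms(1)] WI_measurable[OF assms(2)])+
  show ?thesis
    unfolding WI_def
  proof (intro conjI allI impI)
    fix e :: real assume e: "e > 0"
    obtain S where S: "valid_vstep S" "sqnorm L01 (\<lambda>s. vstep_fun S s - h s) < ennreal (e/4)" "sqnorm M (\<lambda>w. vstep_int S w - X w) < ennreal (e/4)"
      using WI_approx[OF assms(1), of "e/4"] e by auto
    obtain S' where S': "valid_vstep S'" "sqnorm L01 (\<lambda>s. vstep_fun S' s - g s) < ennreal (e/4)" "sqnorm M (\<lambda>w. vstep_int S' w - Y w) < ennreal (e/4)"
      using WI_approx[OF assms(2), of "e/4"] e by auto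
    have [measurable]: "vstep_int S \<in> borel_measurable M" "vstep_int S' \<in> borel_measurable M" using S(1) S'(1) by auto
    have "sqnorm L01 (\<lambda>s. (vstep_fun S s + vstep_fun S' s) - (h s + g s)) < ennreal e"
      by (rule sqnorm_triangle_less[where g="\<lambda>s. h s + vstep_fun S' s"]) (use S S' e in auto)
    moreover have "sqnorm M (\<lambda>w. (vstep_int S w + vstep_int S' w) - (X w + Y w)) < ennreal e"
      by (rule sqnorm_triangle_less[where g="\<lambda>s. X s + vstep_int S' s"]) (use S S' e in auto)
    ultimately show "\<exists>S. valid_vstep S \<and> sqnorm L01 (\<lambda>s. vstep_fun S s - (h s + g s)) < ennreal e \<and> sqnorm M (\<lambda>w. vstep_int S w - (X w + Y w)) < ennreal e"
      using S(1) S'(1) by (intro exI[of _ "S @ S'"]) auto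
  qed measurable
qed

lemma WI_zero: "WI (\<lambda>_. 0) (\<lambda>_. 0)"
  using WI_vstep[of "[]"] by (simp add: vstep_fun_def[abs_def] vstep_int_def[abs_def])

lemma WI_sum:
  assumes "finite I" "\<And>i. i \<in> I \<Longrightarrow> WI (h i) (X i)"
  shows "WI (\<lambda>s. \<Sum>i\<in>I. h i s) (\<lambda>w. \<Sum>i\<in>I. X i w)"
  using assms by (induction I rule: finite_induct) (auto intro: WI_zero WI_add)

lemma WI_diff:
  assumes "WI h X" "WI g Y"
  shows "WI (\<lambda>s. h s - g s) (\<lambda>w. X w - Y w)"
  using WI_add[OF assms(1) WI_scale[OF assms(2), of "-1"]] by simp

lemma WI_seq:
  assumes "WI h X"
  obtains S where "\<And>m. valid_vstep (S m)" "(\<lambda>m. sqnorm L01 (\<lambda>s. vstep_fun (S m) s - h s)) \<longlonglongrightarrow> 0"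
    "(\<lambda>m. sqnorm M (\<lambda>w. vstep_int (S m) w - X w)) \<longlonglongrightarrow> 0"
proof -
  have "\<forall>m. \<exists>S. valid_vstep S \<and> sqnorm L01 (\<lambda>s. vstep_fun S s - h s) < ennreal (1 / real (Suc m)) \<and>
        sqnorm M (\<lambda>w. vstep_int S w - X w) < ennreal (1 / real (Suc m))"
  proof
    fix m
    have "0 < 1 / real (Suc m)" by simp
    from WI_approx[OF assms this] show "\<exists>S. valid_vstep S \<and> sqnorm L01 (\<lambda>s. vstep_fun S s - h s) < ennreal (1 / real (Suc m)) \<and>
        sqnorm M (\<lambda>w. vstep_int S w - X w) < ennreal (1 / real (Suc m))" by metis
  qed
  from choice[OF this] obtain S where S: "\<And>m. valid_vstep (S m)" "\<And>m. sqnorm L01 (\<lambda>s. vstep_fun (S m) s - h s) < ennreal (1 / real (Suc m))"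
        "\<And>m. sqnorm M (\<lambda>w. vstep_int (S m) w - X w) < ennreal (1 / real (Suc m))"
    by blast
  have 0: "(\<lambda>m. ennreal (1 / real (Suc m))) \<longlonglongrightarrow> 0"
    using tendsto_ennrealI[OF LIMSEQ_Suc[OF lim_1_over_n]] by simp
  show ?thesis
    by (rule that[of S, OF S(1)]; rule tendsto_sandwich[OF _ _ tendsto_const 0])
      (auto intro!: always_eventually less_imp_le S simp del: of_nat_Suc)
qed

lemma WI_finite:
  assumes "WI h X"
  shows "sqnorm L01 h < \<infinity>"
proof -
  obtain S where S: "valid_vstep S" "sqnorm L01 (\<lambda>s. vstep_fun S s - h s) < ennreal 1"
    using WI_approx[OF assms zero_less_one] by blast
  have [measurable]: "h \<in> borel_measurable L01" using WI_measurable[OF assms] by simp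
  obtain B where B: "B \<ge> 0" "\<And>s. norm (vstep_fun S s) \<le> B" using vstep_fun_bounded by blast
  have "sqnorm L01 h = sqnorm L01 (\<lambda>s. (h s - vstep_fun S s) + vstep_fun S s)" by simp
  also have "\<dots> \<le> 2 * sqnorm L01 (\<lambda>s. h s - vstep_fun S s) + 2 * sqnorm L01 (vstep_fun S)"
    by (rule sqnorm_add) auto
  also have "sqnorm L01 (\<lambda>s. h s - vstep_fun S s) = sqnorm L01 (\<lambda>s. vstep_fun S s - h s)"
    by (simp add: sqnorm_def norm_minus_commute)
  also have "2 * sqnorm L01 (\<lambda>s. vstep_fun S s - h s) + 2 * sqnorm L01 (vstep_fun S) \<le> 2 * ennreal 1 + 2 * ennreal (B\<^sup>2)"
    using S(2) B by (intro add_mono mult_left_mono sqnorm_bounded prob_space_L01) auto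
  also have "\<dots> < \<infinity>" by (simp add: ennreal_mult_less_top)
  finally show ?thesis .
qed

text \<open>Both sides are continuous under mean square convergence, so the formula passes from step
  integrands to the closure. Applied to multiples and differences of integrals it supplies the laws
  and correlations used below.\<close>

lemma WI_iexp:
  assumes "WI h X"
  shows "(CLINT w|M. iexp (X w)) = exp (- (LINT s|L01. (norm (h s))\<^sup>2) / 2)"
proof -
  have [measurable]: "h \<in> borel_measurable L01" "X \<in> borel_measurable M" using WI_measurable[OF assms] .
  obtain S where S: "\<And>m. valid_vstep (S m)" "(\<lambda>m. sqnorm L01 (\<lambda>s. vstep_fun (S m) s - h s)) \<longlonglongrightarrow> 0"
    "(\<lambda>m. sqnorm M (\<lambda>w. vstep_int (S m) w - X w)) \<longlonglongrightarrow> 0" using WI_seq[OF assms] by blast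
  have "(\<lambda>m. CLINT w|M. iexp (vstep_int (S m) w)) \<longlonglongrightarrow> (CLINT w|M. iexp (X w))"
    using S by (intro iexp_tendsto) auto
  moreover have "(\<lambda>m. CLINT w|M. iexp (vstep_int (S m) w)) \<longlonglongrightarrow> complex_of_real (exp (- (LINT s|L01. (norm (h s))\<^sup>2) / 2))"
    unfolding vstep_int_iexp[OF W S(1)]
    by (intro tendsto_of_real tendsto_exp tendsto_divide tendsto_minus tendsto_const sqnorm_tendsto S WI_finite[OF assms]) auto
  ultimately show ?thesis by (rule LIMSEQ_unique)
qed

end

section \<open>Row vectors times matrices\<close>

lemma norm_vector_matrix_le: "norm (u v* A) \<le> norm u * norm (A :: real ^ 'n ^ 'm)"
proof (rule power2_le_imp_le)
  have "(norm (u v* A))\<^sup>2 = (\<Sum>j\<in>UNIV. (u \<bullet> column j A)\<^sup>2)"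
    unfolding power2_norm_eq_inner[of "u v* A"] inner_vec_def[of "u v* A"]
    by (simp add: vector_matrix_mult_def inner_vec_def column_def power2_eq_square mult.commute)
  also have "\<dots> \<le> (\<Sum>j\<in>UNIV. (norm u)\<^sup>2 * (norm (column j A))\<^sup>2)"
    by (intro sum_mono) (metis Cauchy_Schwarz_ineq power2_norm_eq_inner)
  also have "\<dots> = (norm u)\<^sup>2 * (\<Sum>j\<in>UNIV. \<Sum>i\<in>UNIV. A $ i $ j * A $ i $ j)"
    proof -
    have "(norm (column j A))\<^sup>2 = (\<Sum>i\<in>UNIV. A $ i $ j * A $ i $ j)" for j
      by (simp add: power2_norm_eq_inner inner_vec_def column_def)
    then show ?thesis by (simp add: sum_distrib_left)
  qed
  also have "(\<Sum>j\<in>UNIV. \<Sum>i\<in>UNIV. A $ i $ j * A $ i $ j) = (norm A)\<^sup>2"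
    unfolding power2_norm_eq_inner inner_vec_def by (subst sum.swap) simp
  finally show "(norm (u v* A))\<^sup>2 \<le> (norm u * norm A)\<^sup>2" by (simp add: power_mult_distrib)
qed simp

lemma norm_vector_orthogonal_matrix:
  fixes A :: "real ^ 'n ^ 'n"
  assumes "orthogonal_matrix A"
  shows "norm (v v* A) = norm v"
proof -
  have "orthogonal_transformation ((*v) (transpose A))"
    using assms by (simp add: orthogonal_transformation_matrix orthogonal_matrix_transpose)
  then show ?thesis
    using orthogonal_transformation_norm by fastforce
qed

lemma vector_matrix_diff_left: "(u - v) v* A = u v* A - v v* (A :: real ^ 'n ^ 'm)"
  by (simp add: vec_eq_iff vector_matrix_mult_def algebra_simps sum_subtractf)

lemma vector_matrix_add_left: "(u + v) v* A = u v* A + v v* (A :: real ^ 'n ^ 'm)"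
  by (simp add: vec_eq_iff vector_matrix_mult_def algebra_simps sum.distrib)

lemma vector_matrix_scale_left: "(c *\<^sub>R u) v* A = c *\<^sub>R (u v* (A :: real ^ 'n ^ 'm))"
  by (simp add: vec_eq_iff vector_matrix_mult_def algebra_simps sum_distrib_left)

lemma vector_matrix_scale_right: "u v* (c *\<^sub>R A) = c *\<^sub>R (u v* (A :: real ^ 'n ^ 'm))"
  by (simp add: vec_eq_iff vector_matrix_mult_def algebra_simps sum_distrib_left)

lemma vector_matrix_diff_right: "u v* (A - B) = u v* A - u v* (B :: real ^ 'n ^ 'm)"
  by (simp add: vec_eq_iff vector_matrix_mult_def algebra_simps sum_subtractf)

lemma vector_matrix_add_right: "u v* (A + B) = u v* A + u v* (B :: real ^ 'n ^ 'm)"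
  by (simp add: vec_eq_iff vector_matrix_mult_def algebra_simps sum.distrib)

lemma vector_matrix_zero [simp]: "u v* 0 = 0" "0 v* A = (0 :: real ^ 'n)"
  by (simp_all add: vec_eq_iff vector_matrix_mult_def)

lemma borel_measurable_vector_matrix [measurable (raw)]:
  fixes A :: "'a \<Rightarrow> real ^ 'n ^ 'm"
  assumes "u \<in> borel_measurable N" "A \<in> borel_measurable N"
  shows "(\<lambda>s. u s v* A s) \<in> borel_measurable N"
proof -
  have "continuous_on UNIV (\<lambda>p :: (real ^ 'm) \<times> (real ^ 'n ^ 'm). fst p v* snd p)"
    unfolding vector_matrix_mult_def by (intro continuous_intros)
  then have "(\<lambda>s. (\<lambda>p. fst p v* snd p) (u s, A s)) \<in> borel_measurable N"
    using assms by (intro measurable_compose[OF borel_measurable_Pair borel_measurable_continuous_onI])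
  then show ?thesis by simp
qed

text \<open>\<open>u \<bullet> (C *v x) = (u v* C) \<bullet> x\<close>: pairing with
  \<open>u\<close> moves each coefficient onto \<open>u\<close>. This is why integrands are
  multiplied by matrices from the right, \<open>v v* \<gamma> s\<close> being
  \<open>\<gamma>(s)\<^sup>T v\<close>.\<close>

lemma vstep_of_step:
  fixes S :: "('n::finite) step" and u :: "real ^ 'n"
  assumes "valid_step S"
  defines "S' \<equiv> map (\<lambda>(a, b, C). (a, b, u v* C)) S"
  shows "valid_vstep S'" "vstep_fun S' s = u v* step_fun S s" "vstep_int S' w = u \<bullet> step_integral S w"
proof -
  show "valid_vstep S'" using assms by (auto simp: valid_step_def valid_vstep_def)
  show "vstep_fun S' s = u v* step_fun S s"
    unfolding S'_def vstep_fun_def step_fun_def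
    by (induction S) (auto simp: vector_matrix_add_right vector_matrix_scale_right)
  have "(u v* C) \<bullet> x = u \<bullet> (C *v x)" for C :: "real ^ 'n ^ 'n" and x
    by (metis dot_lmul_matrix vector_transpose_matrix)
  then show "vstep_int S' w = u \<bullet> step_integral S w"
    unfolding S'_def vstep_int_def step_integral_def
    by (induction S) (auto simp: inner_add_right)
qed

context wiener
begin

lemma WI_of_wiener_integral:
  assumes "wiener_integral M G X"
  shows "WI (\<lambda>s. u v* G s) (\<lambda>w. u \<bullet> X w)"
proof -
  have [measurable]: "G \<in> borel_measurable L01" "X \<in> borel_measurable M"
    using assms by (auto simp: wiener_integral_def)
  obtain S where S: "\<And>m. valid_step (S m)"
      "(\<lambda>m. \<integral>\<^sup>+ s. ennreal ((norm (step_fun (S m) s - G s))\<^sup>2) \<partial>L01) \<longlonglongrightarrow> 0"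
      "(\<lambda>m. \<integral>\<^sup>+ w. ennreal ((norm (step_integral (S m) w - X w))\<^sup>2) \<partial>M) \<longlonglongrightarrow> 0"
    using assms by (auto simp: wiener_integral_def)
  show ?thesis
    unfolding WI_def
  proof (intro conjI allI impI)
    fix e :: real assume e: "e > 0"
    define e' where "e' = e / ((norm u)\<^sup>2 + 1)"
    have e': "e' > 0" using e by (simp add: e'_def add_nonneg_pos)
    note le = ennreal_scale_less[OF e, of _ "norm u", folded e'_def]
    have "\<forall>\<^sub>F m in sequentially. (\<integral>\<^sup>+ s. ennreal ((norm (step_fun (S m) s - G s))\<^sup>2) \<partial>L01) < ennreal e' \<and>
      (\<integral>\<^sup>+ w. ennreal ((norm (step_integral (S m) w - X w))\<^sup>2) \<partial>M) < ennreal e'"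
      using order_tendstoD(2)[OF S(2)] order_tendstoD(2)[OF S(3)] e' by (intro eventually_conj) auto
    then obtain m where m: "(\<integral>\<^sup>+ s. ennreal ((norm (step_fun (S m) s - G s))\<^sup>2) \<partial>L01) < ennreal e'"
      "(\<integral>\<^sup>+ w. ennreal ((norm (step_integral (S m) w - X w))\<^sup>2) \<partial>M) < ennreal e'"
      by (auto simp: eventually_sequentially)
    let ?S = "map (\<lambda>(a, b, C). (a, b, u v* C)) (S m)"
    note vs = vstep_of_step[OF S(1)[of m], of u]
    have [measurable]: "vstep_int ?S \<in> borel_measurable M" using vs(1) by (rule vstep_int_measurable)
    have bd: "(\<integral>\<^sup>+ x. ennreal ((norm (f x))\<^sup>2) \<partial>N) \<le> ennreal ((norm u)\<^sup>2) * (\<integral>\<^sup>+ x. ennreal ((norm (g x))\<^sup>2) \<partial>N)"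
      if le: "\<And>x. norm (f x) \<le> norm u * norm (g x)" and g: "g \<in> borel_measurable N"
      for f :: "'x \<Rightarrow> 'y::euclidean_space" and g :: "'x \<Rightarrow> 'z::euclidean_space" and N
    proof -
      have "(\<integral>\<^sup>+ x. ennreal ((norm (f x))\<^sup>2) \<partial>N) \<le> (\<integral>\<^sup>+ x. ennreal ((norm u)\<^sup>2) * ennreal ((norm (g x))\<^sup>2) \<partial>N)"
        using le by (intro nn_integral_mono) (auto simp: ennreal_mult[symmetric] power_mult_distrib[symmetric]
            intro!: ennreal_leI power_mono)
      also have "\<dots> = ennreal ((norm u)\<^sup>2) * (\<integral>\<^sup>+ x. ennreal ((norm (g x))\<^sup>2) \<partial>N)"
        using g by (intro nn_integral_cmult) measurable
      finally show ?thesis .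
    qed
    have step_meas: "step_fun (S m) \<in> borel_measurable L01"
    proof -
      have "step_fun S \<in> borel_measurable L01" for S :: "'n step"
      proof (induction S)
        case Nil
        have "step_fun ([] :: 'n step) = (\<lambda>_. 0)" by (simp add: fun_eq_iff step_fun_def)
        then show ?case by simp
      next
        case (Cons x S)
        obtain a b c where x: "x = (a, b, c)" by (cases x)
        have "step_fun (x # S) = (\<lambda>s. indicat_real {a<..b} s *\<^sub>R c + step_fun S s)" by (simp add: fun_eq_iff x step_fun_def)
        moreover have "(\<lambda>s. indicat_real {a<..b} s *\<^sub>R c) \<in> borel_measurable L01"
          by (intro borel_measurable_scaleR measurable_restrict_space1 borel_measurable_indicator) auto
        ultimately show ?case using Cons by simp
      qed
      then show ?thesis .
    qed
    have int_meas: "step_integral (S m) \<in> borel_measurable M"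
    proof -
      have "(\<lambda>w. step_integral (S m) w \<bullet> b) \<in> borel_measurable M" for b
        using vstep_int_measurable[OF vstep_of_step(1)[OF S(1)[of m], of b]]
        by (simp add: vstep_of_step(3)[OF S(1)[of m], of b, abs_def] vstep_of_step(3)[OF S(1)] inner_commute cong: measurable_cong)
      then show ?thesis by (intro borel_measurable_euclidean_space[THEN iffD2]) auto
    qed
    have "sqnorm L01 (\<lambda>s. vstep_fun ?S s - u v* G s) < ennreal e"
      unfolding sqnorm_def
      by (rule le_less_trans[OF bd le[OF m(1)]])
        (use step_meas in \<open>auto simp: vs vector_matrix_diff_right[symmetric] norm_vector_matrix_le\<close>)
    moreover have "sqnorm M (\<lambda>w. vstep_int ?S w - u \<bullet> X w) < ennreal e"
      unfolding sqnorm_def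
      by (rule le_less_trans[OF bd le[OF m(2)]])
        (use int_meas in \<open>auto simp: vs inner_diff_right[symmetric] Cauchy_Schwarz_ineq2\<close>)
    ultimately show "\<exists>S. valid_vstep S \<and> sqnorm L01 (\<lambda>s. vstep_fun S s - u v* G s) < ennreal e \<and>
        sqnorm M (\<lambda>w. vstep_int S w - u \<bullet> X w) < ennreal e"
      using vs(1) by blast
  qed measurable
qed

end

section \<open>Action of the transformation on Wiener integrals\<close>

locale wiener_rotation = wiener M for M :: "(real \<Rightarrow> real ^ 'n) measure" +
  fixes \<gamma> :: "real \<Rightarrow> real ^ 'n ^ 'n" and T
  assumes \<gamma> [measurable]: "\<gamma> \<in> borel_measurable L01"
    and orth: "\<And>t. t \<in> {0..1} \<Longrightarrow> orthogonal_matrix (\<gamma> t)"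
    and driven: "driven_transformation M \<gamma> T"
begin

lemma T_measurable [measurable]: "T \<in> M \<rightarrow>\<^sub>M M"
  using driven by (simp add: driven_transformation_def)

lemma norm_rot: "s \<in> {0..1} \<Longrightarrow> norm (v v* \<gamma> s) = norm v"
  by (rule norm_vector_orthogonal_matrix[OF orth])

text \<open>\<open>T\<close> is known at single times only; its increment over
  \<open>{a<..b}\<close> is the difference of the integrals up to \<open>b\<close> and up to
  \<open>a\<close>, whose integrands differ by \<open>\<gamma>\<close> on
  \<open>{a<..b}\<close>.\<close>

lemma WI_vstep_T:
  assumes "valid_vstep S"
  shows "WI (\<lambda>s. vstep_fun S s v* \<gamma> s) (\<lambda>w. vstep_int S (T w))"
  using assms
proof (induction S)
  case Nil
  show ?case using WI_zero by simp
next
  case (Cons x S)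
  obtain a b c where x: "x = (a, b, c)" by (cases x)
  have t: "wiener_integral M (\<lambda>s. indicat_real {0..t} s *\<^sub>R \<gamma> s) (\<lambda>w. T w t)" if "t \<in> {0..1}" for t
    using driven that by (simp add: driven_transformation_def)
  have ab: "a \<in> {0..1}" "b \<in> {0..1}" "0 \<le> a" "a \<le> b" "valid_vstep S" using Cons.prems by (auto simp: x)
  have "WI (\<lambda>s. (c v* (indicat_real {0..b} s *\<^sub>R \<gamma> s) - c v* (indicat_real {0..a} s *\<^sub>R \<gamma> s)) + vstep_fun S s v* \<gamma> s)
     (\<lambda>w. (c \<bullet> T w b - c \<bullet> T w a) + vstep_int S (T w))"
    by (intro WI_add WI_diff WI_of_wiener_integral t ab Cons.IH)
  moreover have "(c v* (indicat_real {0..b} s *\<^sub>R \<gamma> s) - c v* (indicat_real {0..a} s *\<^sub>R \<gamma> s)) + vstep_fun S s v* \<gamma> s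
     = vstep_fun (x # S) s v* \<gamma> s" for s
  proof -
    have "indicat_real {a<..b} s = indicat_real {0..b} s - indicat_real {0..a} s"
      using ab by (auto simp: indicator_def)
    then show ?thesis
      by (simp add: x vector_matrix_add_left vector_matrix_diff_left vector_matrix_scale_left vector_matrix_scale_right scaleR_diff_left)
  qed
  ultimately show ?case by (simp add: x inner_diff_right)
qed

lemma distr_T: "distr M M T = M"
proof (rule wiener_space_measure_eqI)
  show "finite_measure (distr M M T)" by (rule finite_measure_distr) measurable
  show "finite_measure M" by (rule finite_measure_axioms)
  fix S :: "'n vstep" assume S: "valid_vstep S"
  have [measurable]: "vstep_int S \<in> borel_measurable M" using S by measurable
  have "(CLINT w|distr M M T. iexp (vstep_int S w)) = (CLINT w|M. iexp (vstep_int S (T w)))"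
    by (subst integral_distr) auto
  also have "\<dots> = exp (- (LINT s|L01. (norm (vstep_fun S s v* \<gamma> s))\<^sup>2) / 2)"
    by (rule WI_iexp[OF WI_vstep_T[OF S]])
  also have "(LINT s|L01. (norm (vstep_fun S s v* \<gamma> s))\<^sup>2) = (LINT s|L01. (norm (vstep_fun S s))\<^sup>2)"
    by (intro Bochner_Integration.integral_cong) (auto simp: norm_rot)
  also have "exp (- (LINT s|L01. (norm (vstep_fun S s))\<^sup>2) / 2) = (CLINT w|M. iexp (vstep_int S w))"
    by (rule WI_iexp[OF WI_vstep[OF S], symmetric])
  finally show "(CLINT w|distr M M T. iexp (vstep_int S w)) = (CLINT w|M. iexp (vstep_int S w))" .
qed (simp_all add: sets_M)

lemma sqnorm_T: "f \<in> borel_measurable M \<Longrightarrow> sqnorm M (\<lambda>w. f (T w)) = sqnorm M f"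
proof -
  assume [measurable]: "f \<in> borel_measurable M"
  have "sqnorm (distr M M T) f = sqnorm M (\<lambda>w. f (T w))"
    unfolding sqnorm_def by (subst nn_integral_distr) auto
  then show ?thesis by (simp add: distr_T)
qed

text \<open>Both maps, \<open>h \<mapsto> h v* \<gamma>\<close> and
  \<open>X \<mapsto> X \<circ> T\<close>, are isometries, so the formula extends from step
  integrands to the closure. The second isometry is \<open>distr_T\<close>, which therefore rests on
  step integrands alone.\<close>

lemma WI_T:
  assumes "WI h X"
  shows "WI (\<lambda>s. h s v* \<gamma> s) (\<lambda>w. X (T w))"
proof -
  have [measurable]: "h \<in> borel_measurable L01" "X \<in> borel_measurable M" using WI_measurable[OF assms] .
  show ?thesis
  proof (rule WI_closed)
    fix e :: real assume e: "e > 0"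
    obtain S where S: "valid_vstep S" "sqnorm L01 (\<lambda>s. vstep_fun S s - h s) < ennreal e" "sqnorm M (\<lambda>w. vstep_int S w - X w) < ennreal e"
      using WI_approx[OF assms e] .
    have [measurable]: "vstep_int S \<in> borel_measurable M" using S(1) by measurable
    have "sqnorm L01 (\<lambda>s. vstep_fun S s v* \<gamma> s - h s v* \<gamma> s) \<le> sqnorm L01 (\<lambda>s. vstep_fun S s - h s)"
      by (rule sqnorm_mono) (auto simp: vector_matrix_diff_left[symmetric] norm_rot)
    moreover have "sqnorm M (\<lambda>w. vstep_int S (T w) - X (T w)) = sqnorm M (\<lambda>w. vstep_int S w - X w)"
      by (rule sqnorm_T) measurable
    ultimately show "\<exists>h' X'. WI h' X' \<and> sqnorm L01 (\<lambda>s. h' s - h s v* \<gamma> s) < ennreal e \<and> sqnorm M (\<lambda>w. X' w - X (T w)) < ennreal e"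
      using WI_vstep_T[OF S(1)] S le_less_trans[OF _ S(2)] by fastforce
  qed measurable
qed

lemma WI_T_pow:
  assumes "WI h X"
  shows "WI (\<lambda>s. ((\<lambda>v. v v* \<gamma> s) ^^ k) (h s)) (\<lambda>w. X ((T ^^ k) w))"
proof (induction k)
  case (Suc k)
  from WI_T[OF this] show ?case by (simp add: funpow_swap1)
qed (simp add: assms)

lemma norm_rot_pow: "s \<in> {0..1} \<Longrightarrow> norm (((\<lambda>v. v v* \<gamma> s) ^^ k) v) = norm v"
  by (induction k) (simp_all add: norm_rot)

lemma T_pow_measurable [measurable]: "(T ^^ k) \<in> M \<rightarrow>\<^sub>M M"
  by (induction k) (auto intro: measurable_compose simp: o_def)

lemma distr_T_pow: "distr M M (T ^^ k) = M"
proof (induction k)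
  case 0
  show ?case by (simp add: id_def distr_id2)
next
  case (Suc k)
  have "distr M M (T ^^ Suc k) = distr (distr M M (T ^^ k)) M T"
    by (subst distr_distr) (auto simp: o_def)
  then show ?case by (simp only: Suc distr_T)
qed

end

section \<open>Disjoint spectra imply ergodicity\<close>

text \<open>The tensor product of two vectors. By \<open>inner_outer\<close> a product of
  correlations at \<open>s\<close> and at \<open>t\<close> becomes a single inner product of
  matrices, which linearises the squares \<open>(cor k l)\<^sup>2\<close>.\<close>

definition outer :: "real ^ 'n \<Rightarrow> real ^ 'm \<Rightarrow> real ^ 'm ^ 'n" where
  "outer a b = (\<chi> i j. a $ i * b $ j)"

lemma inner_outer: "outer a b \<bullet> outer c d = (a \<bullet> c) * (b \<bullet> d)"
proof -
  have "outer a b \<bullet> outer c d = (\<Sum>i\<in>UNIV. \<Sum>j\<in>UNIV. (a $ i * c $ i) * (b $ j * d $ j))"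
    by (simp add: outer_def inner_vec_def mult_ac)
  then show ?thesis by (simp add: inner_vec_def sum_product)
qed

lemma norm_outer: "norm (outer a b) = norm a * norm b"
  by (rule power2_eq_imp_eq) (simp_all add: power2_norm_eq_inner[of "outer a b"] inner_outer power_mult_distrib power2_norm_eq_inner)

lemma norm_sq_rows: "(norm (X :: real ^ 'n ^ 'm))\<^sup>2 = (\<Sum>i\<in>UNIV. (norm (X $ i))\<^sup>2)"
  by (simp add: power2_norm_eq_inner inner_vec_def[of X])

lemma norm_transpose: "norm (transpose X) = norm (X :: real ^ 'n ^ 'm)"
proof (rule power2_eq_imp_eq)
  show "(norm (transpose X))\<^sup>2 = (norm X)\<^sup>2"
    unfolding power2_norm_eq_inner inner_vec_def transpose_def by (subst sum.swap) simp
qed simp_all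

lemma norm_matrix_orthogonal_right:
  fixes X :: "real ^ 'n ^ 'm"
  assumes "orthogonal_matrix B"
  shows "norm (X ** B) = norm X"
proof (rule power2_eq_imp_eq)
  have "(X ** B) $ i = X $ i v* B" for i
    by (simp add: vec_eq_iff matrix_matrix_mult_def vector_matrix_mult_def mult.commute)
  then show "(norm (X ** B))\<^sup>2 = (norm X)\<^sup>2"
    by (simp add: norm_sq_rows norm_vector_orthogonal_matrix[OF assms])
qed simp_all

lemma norm_matrix_orthogonal_conj:
  fixes X :: "real ^ 'n ^ 'm"
  assumes "orthogonal_matrix A" "orthogonal_matrix B"
  shows "norm (transpose A ** X ** B) = norm X"
proof -
  have "norm (transpose A ** X) = norm (transpose X ** A)"
    by (subst norm_transpose[symmetric]) (simp add: matrix_transpose_mul)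
  then show ?thesis
    by (simp add: norm_matrix_orthogonal_right assms norm_transpose)
qed

lemma matrix_scaleR_left: "(c *\<^sub>R A) ** B = c *\<^sub>R (A ** (B :: real ^ 'n ^ 'm))"
  and matrix_scaleR_right: "A ** (c *\<^sub>R B) = c *\<^sub>R (A ** (B :: real ^ 'n ^ 'm))"
  by (simp_all add: vec_eq_iff matrix_matrix_mult_def sum_distrib_left mult_ac)

lemma outer_rot: "transpose A ** outer a b ** B = outer (a v* A) (b v* B)"
proof -
  have h1: "(transpose A ** outer a b ** B) $ i $ j = (\<Sum>k\<in>UNIV. \<Sum>n\<in>UNIV. (a $ n * A $ n $ i) * (b $ k * B $ k $ j))" for i j
    by (simp add: outer_def matrix_matrix_mult_def transpose_def sum_distrib_left sum_distrib_right mult_ac)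
  have h2: "outer (a v* A) (b v* B) $ i $ j = (\<Sum>k\<in>UNIV. \<Sum>n\<in>UNIV. (a $ n * A $ n $ i) * (b $ k * B $ k $ j))" for i j
  proof -
    have "outer (a v* A) (b v* B) $ i $ j = (\<Sum>n\<in>UNIV. a $ n * A $ n $ i) * (\<Sum>k\<in>UNIV. b $ k * B $ k $ j)"
      by (simp add: outer_def vector_matrix_mult_def mult.commute)
    then show ?thesis unfolding sum_product by (rule trans) (rule sum.swap)
  qed
  show ?thesis unfolding vec_eq_iff by (intro allI) (rule trans[OF h1 h2[symmetric]])
qed

text \<open>The limit of the means is a matrix \<open>y\<close> with \<open>A y = y B\<close>.\<close>

lemma mean_outer_tendsto_0:
  fixes A B :: "real ^ 'n ^ 'n"
  assumes "orthogonal_matrix A" "orthogonal_matrix B"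
    and no: "\<And>X. A ** X = X ** B \<Longrightarrow> X = 0"
  shows "(\<lambda>N. (1 / real N) *\<^sub>R (\<Sum>k<N. outer (((\<lambda>v. v v* A) ^^ k) a) (((\<lambda>v. v v* B) ^^ k) b))) \<longlonglongrightarrow> 0"
proof -
  \<comment> \<open>\<open>?V\<close> preserves the Frobenius norm and sends
    \<open>outer a b\<close> to \<open>outer (a v* A) (b v* B)\<close>, so its orbit consists of the
    tensors to be averaged.\<close>
  let ?V = "\<lambda>X. transpose A ** X ** B"
  have "linear ?V"
    by (rule linearI) (simp_all add: matrix_add_ldistrib matrix_add_rdistrib matrix_scaleR_left matrix_scaleR_right)
  then obtain y where y: "?V y = y" "(\<lambda>N. (1 / real N) *\<^sub>R (\<Sum>k<N. (?V ^^ k) (outer a b))) \<longlonglongrightarrow> y"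
    using mean_ergodic_finite_dim[of ?V "outer a b"] norm_matrix_orthogonal_conj[OF assms(1,2)] by blast
  have "A ** y = A ** (transpose A ** y ** B)" using y(1) by simp
  also have "\<dots> = (A ** transpose A) ** y ** B" by (simp add: matrix_mul_assoc)
  also have "\<dots> = y ** B" using assms(1) by (simp add: orthogonal_matrix_def)
  finally have "y = 0" by (rule no)
  moreover have "(?V ^^ k) (outer a b) = outer (((\<lambda>v. v v* A) ^^ k) a) (((\<lambda>v. v v* B) ^^ k) b)" for k
    by (induction k) (simp_all add: outer_rot)
  ultimately show ?thesis using y(2) by simp
qed

context wiener_rotation
begin

abbreviation rot :: "nat \<Rightarrow> real \<Rightarrow> real ^ 'n \<Rightarrow> real ^ 'n" where
  "rot k s \<equiv> (\<lambda>v. v v* \<gamma> s) ^^ k"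

lemma rot_measurable [measurable]: "g \<in> borel_measurable L01 \<Longrightarrow> (\<lambda>s. rot k s (g s)) \<in> borel_measurable L01"
  by (induction k) auto

context
  fixes S :: "'n vstep"
  assumes S: "valid_vstep S"
begin

definition cor :: "nat \<Rightarrow> nat \<Rightarrow> real" where
  "cor k l = (LINT s|L01. rot k s (vstep_fun S s) \<bullet> rot l s (vstep_fun S s))"

lemma inner_rot_bounded: "\<exists>B\<ge>0. \<forall>k l. \<forall>s\<in>{0..1}. \<bar>rot k s (vstep_fun S s) \<bullet> rot l s (vstep_fun S s)\<bar> \<le> B"
proof -
  obtain B where B: "B \<ge> 0" "\<And>s. norm (vstep_fun S s) \<le> B" using vstep_fun_bounded by blast
  have "\<bar>rot k s (vstep_fun S s) \<bullet> rot l s (vstep_fun S s)\<bar> \<le> B * B" if "s \<in> {0..1}" for k l s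
    using Cauchy_Schwarz_ineq2[of "rot k s (vstep_fun S s)" "rot l s (vstep_fun S s)"]
      mult_mono[OF B(2)[of s] B(2)[of s] B(1)] by (auto simp only: norm_rot_pow[OF that] norm_ge_zero intro: order_trans)
  then show ?thesis using B by (intro exI[of _ "B * B"]) auto
qed

lemma inner_rot_integrable: "integrable L01 (\<lambda>s. rot k s (vstep_fun S s) \<bullet> rot l s (vstep_fun S s))"
proof -
  interpret L: prob_space L01 by (rule prob_space_L01)
  obtain B where "\<And>k l s. s \<in> {0..1} \<Longrightarrow> \<bar>rot k s (vstep_fun S s) \<bullet> rot l s (vstep_fun S s)\<bar> \<le> B"
    using inner_rot_bounded by blast
  then show ?thesis by (intro L.integrable_const_bound[where B=B]) auto
qed

lemma cor_diag: "cor k k = cor 0 0"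
  unfolding cor_def by (intro Bochner_Integration.integral_cong)
    (auto simp: power2_norm_eq_inner[symmetric] norm_rot_pow)

text \<open>Rotation preserves norms, so the squared norm of the difference of the integrands has
  integral \<open>2 cor 0 0 - 2 cor k l\<close>.\<close>

lemma iexp_diff_expectation:
  "(CLINT w|M. iexp (vstep_int S ((T ^^ k) w) - vstep_int S ((T ^^ l) w))) = exp (cor k l - cor 0 0)"
proof -
  let ?g = "\<lambda>k s. rot k s (vstep_fun S s)"
  have "WI (\<lambda>s. ?g k s - ?g l s) (\<lambda>w. vstep_int S ((T ^^ k) w) - vstep_int S ((T ^^ l) w))"
    by (intro WI_diff WI_T_pow WI_vstep S)
  then have "(CLINT w|M. iexp (vstep_int S ((T ^^ k) w) - vstep_int S ((T ^^ l) w)))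
     = exp (- (LINT s|L01. (norm (?g k s - ?g l s))\<^sup>2) / 2)"
    by (rule WI_iexp)
  also have "(LINT s|L01. (norm (?g k s - ?g l s))\<^sup>2) = (LINT s|L01. (?g k s \<bullet> ?g k s + ?g l s \<bullet> ?g l s) - 2 * (?g k s \<bullet> ?g l s))"
    by (intro Bochner_Integration.integral_cong) (auto simp: power2_norm_eq_inner inner_diff inner_commute)
  also have "\<dots> = (cor k k + cor l l) - 2 * cor k l"
    unfolding cor_def using inner_rot_integrable by simp
  finally show ?thesis by (simp add: cor_diag[of k] cor_diag[of l])
qed

lemma iexp_expectation: "(CLINT w|M. iexp (vstep_int S ((T ^^ k) w))) = exp (- cor 0 0 / 2)"
proof -
  have "(CLINT w|M. iexp (vstep_int S ((T ^^ k) w))) = exp (- (LINT s|L01. (norm (rot k s (vstep_fun S s)))\<^sup>2) / 2)"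
    by (intro WI_iexp WI_T_pow WI_vstep S)
  also have "(LINT s|L01. (norm (rot k s (vstep_fun S s)))\<^sup>2) = cor k k"
    by (simp add: cor_def power2_norm_eq_inner)
  finally show ?thesis by (simp add: cor_diag[of k])
qed

text \<open>The mean over \<open>k, l < N\<close> of \<open>(cor k l)\<^sup>2\<close> is the double integral over \<open>s, t\<close> of the squared norm of the
  mean over \<open>k < N\<close> of \<open>outer (rot k s g) (rot k t g)\<close>.\<close>

lemma cor_mean_square_tendsto_0:
  assumes no: "\<And>s. s \<in> {0..1} \<Longrightarrow> AE t in L01. \<forall>X. \<gamma> s ** X = X ** \<gamma> t \<longrightarrow> X = 0"
  shows "(\<lambda>N. (1 / real N)\<^sup>2 * (\<Sum>k<N. \<Sum>l<N. (cor k l)\<^sup>2)) \<longlonglongrightarrow> 0"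
proof -
  interpret L: prob_space L01 by (rule prob_space_L01)
  let ?g = "\<lambda>k s. rot k s (vstep_fun S s)"
  let ?A = "\<lambda>N s t. (1 / real N) *\<^sub>R (\<Sum>k<N. outer (?g k s) (?g k t))"
  obtain B where B: "B \<ge> 0" "\<And>s. norm (vstep_fun S s) \<le> B" using vstep_fun_bounded by blast
  have A_sq: "(norm (?A N s t))\<^sup>2 = (1 / real N)\<^sup>2 * (\<Sum>k<N. \<Sum>l<N. (?g k s \<bullet> ?g l s) * (?g k t \<bullet> ?g l t))" for N s t
  proof -
    have "(norm (\<Sum>k<N. outer (?g k s) (?g k t)))\<^sup>2 = (\<Sum>k<N. \<Sum>l<N. (?g k s \<bullet> ?g l s) * (?g k t \<bullet> ?g l t))"
      by (simp add: power2_norm_eq_inner inner_sum_left inner_sum_right inner_outer)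
         (rule sum.swap)
    then show ?thesis by (simp add: power_mult_distrib power_divide)
  qed
  have A_bd: "norm ((norm (?A N s t))\<^sup>2) \<le> (B * B)\<^sup>2" if "s \<in> {0..1}" "t \<in> {0..1}" for N s t
  proof -
    have "norm (\<Sum>k<N. outer (?g k s) (?g k t)) \<le> (\<Sum>k<N. B * B)"
      by (rule sum_norm_le) (use B that in \<open>auto simp: norm_outer norm_rot_pow intro!: mult_mono\<close>)
    then have "norm (?A N s t) \<le> B * B"
      by (cases "N = 0") (use B in \<open>auto simp: field_simps\<close>)
    then have "(norm (?A N s t))\<^sup>2 \<le> (B * B)\<^sup>2" by (intro power_mono) auto
    then show ?thesis by simp
  qed
  \<comment> \<open>\<open>F N s\<close> is the inner integral over \<open>t\<close>. Dominated
    convergence is applied in \<open>t\<close> for each fixed \<open>s\<close> and then in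
    \<open>s\<close>, which matches the iterated form of the hypothesis and avoids the product
    measure.\<close>
  define F where "F N s = (1 / real N)\<^sup>2 * (\<Sum>k<N. \<Sum>l<N. (?g k s \<bullet> ?g l s) * cor k l)" for N s
  have F_eq: "F N s = (LINT t|L01. (norm (?A N s t))\<^sup>2)" for N s
    unfolding A_sq F_def using inner_rot_integrable
    by (simp add: cor_def)
  have F_lim: "(\<lambda>N. F N s) \<longlonglongrightarrow> 0" if s: "s \<in> {0..1}" for s
  proof -
    have "(\<lambda>N. LINT t|L01. (norm (?A N s t))\<^sup>2) \<longlonglongrightarrow> (LINT t|L01. 0)"
    proof (rule integral_dominated_convergence[where w="\<lambda>_. (B * B)\<^sup>2"])
      show "AE t in L01. (\<lambda>N. (norm (?A N s t))\<^sup>2) \<longlonglongrightarrow> 0"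
        using no[OF s] AE_space
      proof eventually_elim
        case (elim t)
        then have "(\<lambda>N. ?A N s t) \<longlonglongrightarrow> 0"
          by (intro mean_outer_tendsto_0 orth s) auto
        from tendsto_power[OF tendsto_norm[OF this], of 2] show ?case by simp
      qed
      show "AE t in L01. norm ((norm (?A N s t))\<^sup>2) \<le> (B * B)\<^sup>2" for N
        using A_bd[OF s] by (intro AE_I2) auto
      show "(\<lambda>t. (norm (?A N s t))\<^sup>2) \<in> borel_measurable L01" for N
        unfolding A_sq by measurable
    qed auto
    then show ?thesis by (simp add: F_eq)
  qed
  have "(\<lambda>N. LINT s|L01. F N s) \<longlonglongrightarrow> (LINT s|L01. 0)"
  proof (rule integral_dominated_convergence[where w="\<lambda>_. (B * B)\<^sup>2"])
    show "AE s in L01. (\<lambda>N. F N s) \<longlonglongrightarrow> 0" using F_lim by (intro AE_I2) auto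
    show "AE s in L01. norm (F N s) \<le> (B * B)\<^sup>2" for N
    proof (rule AE_I2)
      fix s assume s: "s \<in> space L01"
      have "norm (F N s) \<le> (LINT t|L01. (norm ((norm (?A N s t))\<^sup>2)))"
        unfolding F_eq by (rule integral_norm_bound)
      also have "\<dots> \<le> (LINT t|L01. (B * B)\<^sup>2)"
      proof (rule integral_mono)
        show "integrable L01 (\<lambda>t. norm ((norm (?A N s t))\<^sup>2))"
          using A_bd[of s] s unfolding A_sq
          by (intro L.integrable_const_bound[where B="(B * B)\<^sup>2"]) auto
      qed (use A_bd[of s] s in auto)
      also have "\<dots> = (B * B)\<^sup>2" using L.prob_space by simp
      finally show "norm (F N s) \<le> (B * B)\<^sup>2" .
    qed
    show "F N \<in> borel_measurable L01" for N unfolding F_def by measurable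
  qed auto
  moreover have "(LINT s|L01. F N s) = (1 / real N)\<^sup>2 * (\<Sum>k<N. \<Sum>l<N. (cor k l)\<^sup>2)" for N
    unfolding F_def using inner_rot_integrable by (simp add: cor_def power2_eq_square)
  ultimately show ?thesis by simp
qed

end

end

section \<open>From correlations to ergodic means of exponentials\<close>

lemma exp_minus_one_le:
  fixes x c :: real
  assumes "\<bar>x\<bar> \<le> c"
  shows "exp (x - c) - exp (- c) \<le> \<bar>x\<bar>"
proof (cases "x \<ge> 0")
  case True
  \<comment> \<open>This gives \<open>exp x - 1 \<le> x exp x\<close>; the factor
    \<open>exp (- c)\<close> absorbs the growth since \<open>x \<le> c\<close>, leaving the constant
    1.\<close>
  have "1 - x \<le> exp (- x)" using exp_ge_add_one_self[of "- x"] by simp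
  then have "(1 - x) * exp x \<le> exp (- x) * exp x" by (intro mult_right_mono) auto
  then have "exp x - 1 \<le> x * exp x" by (simp add: exp_minus algebra_simps)
  also have "\<dots> \<le> x * exp c" using assms True by (intro mult_left_mono) auto
  finally have "exp (- c) * (exp x - 1) \<le> exp (- c) * (x * exp c)" by (intro mult_left_mono) auto
  then show ?thesis using True by (simp add: exp_minus exp_diff field_simps)
next
  case False
  then have le: "exp (x - c) \<le> exp (- c)" by simp
  show ?thesis using le abs_ge_zero[of x] by linarith
qed

text \<open>Cauchy-Schwarz over the \<open>N\<^sup>2\<close> pairs: the mean of
  \<open>|c k l|\<close> is at most the root of the mean square.\<close>

lemma mean_abs_tendsto_0:
  fixes c :: "nat \<Rightarrow> nat \<Rightarrow> real"
  assumes "(\<lambda>N. (1 / real N)\<^sup>2 * (\<Sum>k<N. \<Sum>l<N. (c k l)\<^sup>2)) \<longlonglongrightarrow> 0"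
  shows "(\<lambda>N. (1 / real N)\<^sup>2 * (\<Sum>k<N. \<Sum>l<N. \<bar>c k l\<bar>)) \<longlonglongrightarrow> 0"
proof (rule tendsto_sandwich[OF _ _ tendsto_const])
  show "(\<lambda>N. sqrt ((1 / real N)\<^sup>2 * (\<Sum>k<N. \<Sum>l<N. (c k l)\<^sup>2))) \<longlonglongrightarrow> 0"
    using tendsto_real_sqrt[OF assms] by simp
  show "\<forall>\<^sub>F N in sequentially. 0 \<le> (1 / real N)\<^sup>2 * (\<Sum>k<N. \<Sum>l<N. \<bar>c k l\<bar>)"
    by (intro always_eventually allI mult_nonneg_nonneg sum_nonneg) auto
  show "\<forall>\<^sub>F N in sequentially. (1 / real N)\<^sup>2 * (\<Sum>k<N. \<Sum>l<N. \<bar>c k l\<bar>) \<le> sqrt ((1 / real N)\<^sup>2 * (\<Sum>k<N. \<Sum>l<N. (c k l)\<^sup>2))"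
  proof (intro always_eventually allI real_le_rsqrt)
    fix N
    have "(\<Sum>k<N. \<Sum>l<N. \<bar>c k l\<bar>)\<^sup>2 = (\<Sum>p\<in>{..<N} \<times> {..<N}. \<bar>c (fst p) (snd p)\<bar> * 1)\<^sup>2"
      by (simp add: sum.cartesian_product case_prod_unfold)
    also have "\<dots> \<le> (\<Sum>p\<in>{..<N} \<times> {..<N}. \<bar>c (fst p) (snd p)\<bar>\<^sup>2) * (\<Sum>p\<in>{..<N} \<times> {..<N}. 1\<^sup>2)"
      by (rule Cauchy_Schwarz_ineq_sum)
    also have "\<dots> = (real N)\<^sup>2 * (\<Sum>k<N. \<Sum>l<N. (c k l)\<^sup>2)"
      by (simp add: sum.cartesian_product case_prod_unfold power2_eq_square)
    finally have "((1 / real N)\<^sup>2)\<^sup>2 * (\<Sum>k<N. \<Sum>l<N. \<bar>c k l\<bar>)\<^sup>2 \<le> ((1 / real N)\<^sup>2)\<^sup>2 * ((real N)\<^sup>2 * (\<Sum>k<N. \<Sum>l<N. (c k l)\<^sup>2))"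
      by (intro mult_left_mono) auto
    then show "((1 / real N)\<^sup>2 * (\<Sum>k<N. \<Sum>l<N. \<bar>c k l\<bar>))\<^sup>2 \<le> (1 / real N)\<^sup>2 * (\<Sum>k<N. \<Sum>l<N. (c k l)\<^sup>2)"
      by (cases "N = 0") (simp_all add: power_mult_distrib power2_eq_square)
  qed
qed

context wiener_rotation
begin

lemma abs_cor_le:
  assumes S: "valid_vstep S"
  shows "\<bar>cor S k l\<bar> \<le> cor S 0 0"
proof -
  let ?g = "\<lambda>k s. rot k s (vstep_fun S s)"
  have "\<bar>cor S k l\<bar> \<le> (LINT s|L01. \<bar>?g k s \<bullet> ?g l s\<bar>)"
    unfolding cor_def[OF S] by (rule integral_abs_bound)
  also have "\<dots> \<le> (LINT s|L01. ?g 0 s \<bullet> ?g 0 s)"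
  proof (rule integral_mono)
    show "\<bar>?g k s \<bullet> ?g l s\<bar> \<le> ?g 0 s \<bullet> ?g 0 s" if "s \<in> space L01" for s
    proof -
      have "s \<in> {0..1}" using that by simp
      then show ?thesis
        using Cauchy_Schwarz_ineq2[of "?g k s" "?g l s"] by (simp only: norm_rot_pow)
          (simp add: norm_eq_sqrt_inner)
    qed
  qed (intro integrable_abs inner_rot_integrable[OF S])+
  finally show ?thesis by (simp add: cor_def[OF S])
qed

text \<open>Expanding the square leaves the covariances
  \<open>exp (cor k l - cor 0 0) - exp (- cor 0 0)\<close>, where the subtracted term is the squared
  common mean. Each is at most \<open>|cor k l|\<close>, and an upper bound suffices because their
  sum is a squared norm.\<close>

lemma mean_iexp_sq_tendsto_0:
  assumes S: "valid_vstep S"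
    and no: "\<And>s. s \<in> {0..1} \<Longrightarrow> AE t in L01. \<forall>X. \<gamma> s ** X = X ** \<gamma> t \<longrightarrow> X = 0"
  shows "(\<lambda>N. sqnorm M (\<lambda>w. (1 / real N) *\<^sub>R (\<Sum>k<N. iexp (vstep_int S ((T ^^ k) w)) - complex_of_real (exp (- cor S 0 0 / 2))))) \<longlonglongrightarrow> 0"
proof -
  have [measurable]: "vstep_int S \<in> borel_measurable M" using S by measurable
  define m where "m = exp (- cor S 0 0 / 2)"
  define E where "E k w = iexp (vstep_int S ((T ^^ k) w))" for k w
  define Z where "Z k w = E k w - complex_of_real m" for k w
  let ?Z = "\<lambda>N w. \<Sum>k<N. Z k w"
  have E_meas [measurable]: "E k \<in> borel_measurable M" for k unfolding E_def by measurable
  have [measurable]: "(\<lambda>w. cnj (E k w)) \<in> borel_measurable M" for k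
    by (rule measurable_compose[OF E_meas borel_measurable_continuous_onI]) (intro continuous_intros)
  have E_norm: "norm (E k w) = 1" for k w by (simp add: E_def)
  have iE: "integrable M (E k)" "integrable M (\<lambda>w. cnj (E k w))" "integrable M (\<lambda>w. E k w * cnj (E l w))" for k l
    by (rule integrable_const_bound[where B=1]; simp add: E_norm norm_mult)+
  have EE: "(CLINT w|M. E k w) = m" "(CLINT w|M. cnj (E k w)) = m" "(CLINT w|M. E k w * cnj (E l w)) = exp (cor S k l - cor S 0 0)" for k l
  proof -
    show 1: "(CLINT w|M. E k w) = m" for k
      unfolding E_def m_def by (rule iexp_expectation[OF S])
    show "(CLINT w|M. cnj (E k w)) = m" using 1[of k] by simp
    have "E k w * cnj (E l w) = iexp (vstep_int S ((T ^^ k) w) - vstep_int S ((T ^^ l) w))" for w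
      by (simp add: E_def exp_cnj exp_add[symmetric] algebra_simps)
    then show "(CLINT w|M. E k w * cnj (E l w)) = exp (cor S k l - cor S 0 0)"
      using iexp_diff_expectation[OF S] by simp
  qed
  have mm: "complex_of_real m * complex_of_real m = exp (- cor S 0 0)"
    by (simp add: m_def exp_add[symmetric] flip: of_real_mult)
  have ZZ_form: "Z k w * cnj (Z l w) = E k w * cnj (E l w) - m * E k w - m * cnj (E l w) + m * m" for k l w
    by (simp add: Z_def algebra_simps)
  have iZZ: "integrable M (\<lambda>w. Z k w * cnj (Z l w))" for k l
    unfolding ZZ_form using iE by auto
  have ZZ: "(CLINT w|M. Z k w * cnj (Z l w)) = exp (cor S k l - cor S 0 0) - exp (- cor S 0 0)" for k l
    unfolding ZZ_form using iE EE mm by (simp add: prob_space)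
  have sqZ: "complex_of_real ((cmod (?Z N w))\<^sup>2) = (\<Sum>k<N. \<Sum>l<N. Z k w * cnj (Z l w))" for N w
    by (simp only: complex_norm_square cnj_sum sum_product)
  have L: "(LINT w|M. (cmod (?Z N w))\<^sup>2) = (\<Sum>k<N. \<Sum>l<N. exp (cor S k l - cor S 0 0) - exp (- cor S 0 0))" for N
  proof -
    have "complex_of_real (LINT w|M. (cmod (?Z N w))\<^sup>2) = (CLINT w|M. complex_of_real ((cmod (?Z N w))\<^sup>2))"
      by (rule integral_complex_of_real[symmetric])
    also have "\<dots> = (\<Sum>k<N. \<Sum>l<N. CLINT w|M. Z k w * cnj (Z l w))"
      unfolding sqZ using iZZ by simp
    also have "\<dots> = complex_of_real (\<Sum>k<N. \<Sum>l<N. exp (cor S k l - cor S 0 0) - exp (- cor S 0 0))"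
      by (simp add: ZZ)
    finally show ?thesis by (simp only: of_real_eq_iff)
  qed
  have Z_meas [measurable]: "Z k \<in> borel_measurable M" for k unfolding Z_def by measurable
  have Z_norm: "norm (Z k w) \<le> 1 + \<bar>m\<bar>" for k w
    unfolding Z_def using norm_triangle_ineq4[of "E k w" "complex_of_real m"] by (simp add: E_norm)
  have le: "sqnorm M (\<lambda>w. (1 / real N) *\<^sub>R (?Z N w)) \<le> ennreal ((1 / real N)\<^sup>2 * (\<Sum>k<N. \<Sum>l<N. \<bar>cor S k l\<bar>))" for N
  proof -
    have "norm (?Z N w) \<le> real N * (1 + \<bar>m\<bar>)" for w
      using sum_norm_le[of "{..<N}" "\<lambda>k. Z k w" "\<lambda>_. 1 + \<bar>m\<bar>"] Z_norm by simp
    then have "sqnorm M (\<lambda>w. \<Sum>k<N. Z k w) \<le> ennreal ((real N * (1 + \<bar>m\<bar>))\<^sup>2)"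
      by (intro sqnorm_bounded prob_space_axioms) auto
    then have fin: "sqnorm M (\<lambda>w. \<Sum>k<N. Z k w) < \<infinity>" by (rule le_less_trans) simp
    have "sqnorm M (\<lambda>w. (1 / real N) *\<^sub>R (?Z N w)) = ennreal ((1 / real N)\<^sup>2) * ennreal (LINT w|M. (cmod (?Z N w))\<^sup>2)"
      by (subst sqnorm_scale) (use fin in \<open>auto simp: sqnorm_finite_integrable(2)\<close>)
    also have "\<dots> = ennreal ((1 / real N)\<^sup>2 * (LINT w|M. (cmod (?Z N w))\<^sup>2))"
      by (rule ennreal_mult[symmetric]) auto
    also have "\<dots> \<le> ennreal ((1 / real N)\<^sup>2 * (\<Sum>k<N. \<Sum>l<N. \<bar>cor S k l\<bar>))"
      unfolding L by (intro ennreal_leI mult_left_mono sum_mono exp_minus_one_le abs_cor_le S) auto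
    finally show ?thesis .
  qed
  have lim: "(\<lambda>N. ennreal ((1 / real N)\<^sup>2 * (\<Sum>k<N. \<Sum>l<N. \<bar>cor S k l\<bar>))) \<longlonglongrightarrow> 0"
    using tendsto_ennrealI[OF mean_abs_tendsto_0[OF cor_mean_square_tendsto_0[OF S no]]] by simp
  have "(\<lambda>N. sqnorm M (\<lambda>w. (1 / real N) *\<^sub>R (?Z N w))) \<longlonglongrightarrow> 0"
    by (rule tendsto_sandwich[OF always_eventually always_eventually tendsto_const lim]) (simp_all add: le)
  then show ?thesis unfolding Z_def E_def m_def .
qed

text \<open>Invariance of \<open>G\<close> allows one to replace \<open>exp (i X)\<close> by its ergodic means, which tend in mean square to
  the constant \<open>E exp (i X)\<close>.\<close>

lemma invariant_iexp_expectation: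
  fixes G :: "(real \<Rightarrow> real ^ 'n) \<Rightarrow> real"
  assumes S: "valid_vstep S"
    and no: "\<And>s. s \<in> {0..1} \<Longrightarrow> AE t in L01. \<forall>X. \<gamma> s ** X = X ** \<gamma> t \<longrightarrow> X = 0"
    and [measurable]: "G \<in> borel_measurable M" and bd: "\<And>w. \<bar>G w\<bar> \<le> B"
    and inv: "AE w in M. G (T w) = G w"
  shows "(CLINT w|M. G w *\<^sub>R iexp (vstep_int S w)) = (LINT w|M. G w) *\<^sub>R (CLINT w|M. iexp (vstep_int S w))"
proof -
  let ?E = "\<lambda>k w. iexp (vstep_int S ((T ^^ k) w))"
  have [measurable]: "vstep_int S \<in> borel_measurable M" using S by measurable
  define m where "m = exp (- cor S 0 0 / 2)"
  have B0: "B \<ge> 0" using bd[of undefined] by linarith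
  have invk: "AE w in M. G ((T ^^ k) w) = G w" for k
  proof (induction k)
    case (Suc k)
    have "AE w in distr M M (T ^^ k). G (T w) = G w" using inv by (simp only: distr_T_pow)
    then have "AE w in M. G (T ((T ^^ k) w)) = G ((T ^^ k) w)"
      by (rule AE_distrD[OF T_pow_measurable])
    then show ?case using Suc by eventually_elim simp
  qed simp
  have iG: "integrable M (\<lambda>w. G w *\<^sub>R ?E k w)" for k
    using bd by (intro integrable_const_bound[where B=B]) auto
  have iG0: "integrable M (\<lambda>w. complex_of_real (G w))"
    using bd by (intro integrable_const_bound[where B=B]) auto
  have same: "(CLINT w|M. G w *\<^sub>R iexp (vstep_int S w)) = (CLINT w|M. G w *\<^sub>R ?E k w)" for k
  proof -
    have "(CLINT w|M. G w *\<^sub>R iexp (vstep_int S w)) = (CLINT w|distr M M (T ^^ k). G w *\<^sub>R iexp (vstep_int S w))"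
      by (simp add: distr_T_pow)
    also have "\<dots> = (CLINT w|M. G ((T ^^ k) w) *\<^sub>R ?E k w)"
      by (subst integral_distr) auto
    also have "\<dots> = (CLINT w|M. G w *\<^sub>R ?E k w)"
      using invk[of k] by (intro integral_cong_AE) auto
    finally show ?thesis .
  qed
  \<comment> \<open>\<open>D\<close> is the covariance of \<open>G\<close> with the exponential. It
    is the same for every iterate, hence equals the covariance with the ergodic mean and is bounded
    by the mean square of that mean's deviation from \<open>m\<close>.\<close>
  define D where "D = (CLINT w|M. G w *\<^sub>R iexp (vstep_int S w)) - (LINT w|M. G w) *\<^sub>R complex_of_real m"
  have D_eq: "D = (CLINT w|M. G w *\<^sub>R ?E k w) - (CLINT w|M. complex_of_real (G w)) * m" for k
    unfolding D_def same[of k] by (simp only: integral_complex_of_real scaleR_conv_of_real)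
  let ?R = "\<lambda>N w. (1 / real N) *\<^sub>R (\<Sum>k<N. ?E k w - complex_of_real m)"
  have D: "D = (CLINT w|M. G w *\<^sub>R ?R N w)" if "N > 0" for N
  proof -
    have "(CLINT w|M. G w *\<^sub>R ?R N w) = (CLINT w|M. (1 / real N) *\<^sub>R (\<Sum>k<N. G w *\<^sub>R ?E k w - complex_of_real (G w) * m))"
      by (intro Bochner_Integration.integral_cong refl)
        (simp add: scaleR_conv_of_real sum_distrib_left right_diff_distrib mult_ac)
    also have "\<dots> = (1 / real N) *\<^sub>R (\<Sum>k<N. (CLINT w|M. G w *\<^sub>R ?E k w) - (CLINT w|M. complex_of_real (G w)) * m)"
      using iG iG0 by simp
    also have "\<dots> = (1 / real N) *\<^sub>R (\<Sum>k<N. D)"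
      by (simp only: D_eq[symmetric])
    also have "\<dots> = D" using that by (simp add: scaleR_conv_of_real)
    finally show ?thesis by simp
  qed
  have lim: "(\<lambda>N. sqnorm M (?R N)) \<longlonglongrightarrow> 0"
    using mean_iexp_sq_tendsto_0[OF S no] by (simp only: m_def)
  have le: "ennreal ((norm D)\<^sup>2) \<le> ennreal (B\<^sup>2) * sqnorm M (?R N)" if "N > 0" for N
  proof -
    have R_meas: "?R N \<in> borel_measurable M" by measurable
    have Rb: "norm (?R N w) \<le> 1 + \<bar>m\<bar>" for w
    proof -
      have "norm (iexp x - complex_of_real m) \<le> 1 + \<bar>m\<bar>" for x
        using norm_triangle_ineq4[of "iexp x" "complex_of_real m"] by simp
      then have "norm (\<Sum>k<N. ?E k w - complex_of_real m) \<le> (\<Sum>k<N. 1 + \<bar>m\<bar>)"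
        by (intro sum_norm_le)
      then show ?thesis using that by (simp add: field_simps)
    qed
    have "integrable M (\<lambda>w. G w *\<^sub>R ?R N w)"
    proof (rule integrable_const_bound[where B="B * (1 + \<bar>m\<bar>)"])
      show "AE w in M. norm (G w *\<^sub>R ?R N w) \<le> B * (1 + \<bar>m\<bar>)"
      proof (rule AE_I2)
        fix w
        show "norm (G w *\<^sub>R ?R N w) \<le> B * (1 + \<bar>m\<bar>)"
          using mult_mono[OF bd[of w] Rb[of w] B0 norm_ge_zero] by (simp only: norm_scaleR)
      qed
      show "(\<lambda>w. G w *\<^sub>R ?R N w) \<in> borel_measurable M" using R_meas by measurable
    qed
    then have "ennreal ((norm D)\<^sup>2) \<le> sqnorm M (\<lambda>w. G w *\<^sub>R ?R N w)"
      unfolding D[OF that] by (rule norm_integral_sq_le)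
    also have "\<dots> \<le> sqnorm M (\<lambda>w. B *\<^sub>R ?R N w)"
    proof (rule sqnorm_mono)
      fix w
      have "\<bar>G w\<bar> \<le> \<bar>B\<bar>" using bd[of w] B0 by linarith
      from mult_right_mono[OF this norm_ge_zero[of "?R N w"]]
      show "norm (G w *\<^sub>R ?R N w) \<le> norm (B *\<^sub>R ?R N w)" by (simp only: norm_scaleR)
    qed
    also have "\<dots> = ennreal (B\<^sup>2) * sqnorm M (?R N)" by (rule sqnorm_scale[OF R_meas])
    finally show ?thesis .
  qed
  have "(\<lambda>N. ennreal (B\<^sup>2) * sqnorm M (?R N)) \<longlonglongrightarrow> ennreal (B\<^sup>2) * 0"
    by (intro ennreal_tendsto_cmult lim) auto
  then have "ennreal ((norm D)\<^sup>2) \<le> 0"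
    by (intro tendsto_lowerbound[where f="\<lambda>N. ennreal (B\<^sup>2) * sqnorm M (?R N)" and F=sequentially])
      (use le in \<open>auto simp: eventually_sequentially intro!: exI[of _ 1]\<close>)
  then have "D = 0" by (simp add: ennreal_eq_0_iff)
  moreover have "(CLINT w|M. iexp (vstep_int S w)) = m"
    using iexp_expectation[OF S, of 0] by (simp add: m_def)
  ultimately show ?thesis by (simp add: D_def)
qed

lemma ergodicI:
  assumes no: "\<And>s. s \<in> {0..1} \<Longrightarrow> AE t in L01. \<forall>X. \<gamma> s ** X = X ** \<gamma> t \<longrightarrow> X = 0"
  shows "ergodic M T"
  unfolding ergodic_def
proof (intro allI impI)
  fix F :: "(real \<Rightarrow> real ^ 'n) \<Rightarrow> real"
  assume F: "F \<in> borel_measurable M \<and> (AE w in M. F (T w) = F w)"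
  then have [measurable]: "F \<in> borel_measurable M" by simp
  \<comment> \<open>\<open>arctan\<close> makes \<open>F\<close> bounded while remaining injective,
    and the shift makes it nonnegative, so that \<open>G\<close> can serve as a density. At the end
    \<open>tan\<close> recovers the constant value of \<open>F\<close>.\<close>
  define G where "G w = arctan (F w) + pi / 2" for w
  have G_meas [measurable]: "G \<in> borel_measurable M"
  proof -
    have [measurable]: "(arctan :: real \<Rightarrow> real) \<in> borel_measurable borel"
      by (intro borel_measurable_continuous_onI continuous_intros)
    show ?thesis unfolding G_def by measurable
  qed
  have G0: "0 \<le> G w" "\<bar>G w\<bar> \<le> pi" for w
    using arctan_bounded[of "F w"] unfolding G_def by linarith+
  have inv: "AE w in M. G (T w) = G w"
    using F by (auto simp: G_def)
  have iG: "integrable M G" by (rule integrable_const_bound[where B=pi]) (use G0 in auto)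
  define c where "c = (LINT w|M. G w)"
  have c0: "c \<ge> 0" using G0 by (simp add: c_def)
  have "density M (\<lambda>w. ennreal (G w)) = density M (\<lambda>w. ennreal c)"
  proof (rule wiener_space_measure_eqI)
    show "finite_measure (density M (\<lambda>w. ennreal (G w)))"
      using iG G0 by (intro finite_measureI) (simp add: emeasure_density nn_integral_eq_integral cong: nn_integral_cong)
    show "finite_measure (density M (\<lambda>w. ennreal c))"
      by (intro finite_measureI) (simp add: emeasure_density emeasure_space_1 cong: nn_integral_cong)
    fix S :: "'n vstep" assume S: "valid_vstep S"
    have [measurable]: "vstep_int S \<in> borel_measurable M" using S by measurable
    have "(CLINT w|density M (\<lambda>w. ennreal (G w)). iexp (vstep_int S w)) = (CLINT w|M. G w *\<^sub>R iexp (vstep_int S w))"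
      using G0 by (intro integral_density) auto
    also have "\<dots> = c *\<^sub>R (CLINT w|M. iexp (vstep_int S w))"
      unfolding c_def by (rule invariant_iexp_expectation[OF S no G_meas G0(2) inv])
    also have "\<dots> = (CLINT w|density M (\<lambda>w. ennreal c). iexp (vstep_int S w))"
      using c0 by (subst integral_density) auto
    finally show "(CLINT w|density M (\<lambda>w. ennreal (G w)). iexp (vstep_int S w)) = (CLINT w|density M (\<lambda>w. ennreal c). iexp (vstep_int S w))" .
  qed (simp_all add: sets_M)
  then have "AE w in M. ennreal (G w) = ennreal c"
    by (intro density_unique) auto
  then have "AE w in M. F w = tan (c - pi / 2)"
  proof eventually_elim
    case (elim w)
    then have "G w = c" using G0 c0 by (simp add: ennreal_inj)
    then have "arctan (F w) = c - pi / 2" by (simp add: G_def)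
    then show ?case by (metis tan_arctan)
  qed
  then show "\<exists>c. AE w in M. F w = c" by blast
qed

end

section \<open>A common eigenvalue on a set of positive measure prevents ergodicity\<close>

context wiener
begin

lemma WI_scaled_iexp:
  assumes "WI h X"
  shows "(CLINT w|M. iexp (t * X w)) = exp (- ((LINT s|L01. (norm (h s))\<^sup>2) * t\<^sup>2) / 2)"
proof -
  have "(CLINT w|M. iexp (t * X w)) = exp (- (LINT s|L01. (norm (t *\<^sub>R h s))\<^sup>2) / 2)"
    by (rule WI_iexp[OF WI_scale[OF assms]])
  also have "(LINT s|L01. (norm (t *\<^sub>R h s))\<^sup>2) = t\<^sup>2 * (LINT s|L01. (norm (h s))\<^sup>2)"
    by (simp add: power_mult_distrib)
  finally show ?thesis by (simp only: mult.commute)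
qed

lemma WI_normal:
  assumes "WI h X" and pos: "0 < (LINT s|L01. (norm (h s))\<^sup>2)"
  shows "distributed M lborel X (normal_density 0 (sqrt (LINT s|L01. (norm (h s))\<^sup>2)))"
proof -
  let ?\<sigma> = "sqrt (LINT s|L01. (norm (h s))\<^sup>2)"
  have [measurable]: "X \<in> borel_measurable M" using WI_measurable[OF assms(1)] by simp
  have "distr M borel X = density lborel (normal_density 0 ?\<sigma>)"
  proof (rule finite_measure_eqI_iexp)
    show "finite_measure (distr M borel X)" by (rule finite_measure_distr) measurable
    have "prob_space (density lborel (normal_density 0 ?\<sigma>))" using pos by (intro prob_space_normal_density) simp
    then show "finite_measure (density lborel (normal_density 0 ?\<sigma>))" by (rule prob_space.finite_measure)
    fix t
    have "(CLINT x|distr M borel X. iexp (t * x)) = (CLINT w|M. iexp (t * X w))"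
      by (subst integral_distr) auto
    also have "\<dots> = exp (- ((LINT s|L01. (norm (h s))\<^sup>2) * t\<^sup>2) / 2)" by (rule WI_scaled_iexp[OF assms(1)])
    also have "\<dots> = (CLINT x|lborel. normal_density 0 ?\<sigma> x *\<^sub>R iexp (t * x))"
      using pos by (subst integral_normal_density_iexp(1)) auto
    also have "\<dots> = (CLINT x|density lborel (normal_density 0 ?\<sigma>). iexp (t * x))"
      by (subst integral_density) auto
    finally show "(CLINT x|distr M borel X. iexp (t * x)) = (CLINT x|density lborel (normal_density 0 ?\<sigma>). iexp (t * x))" .
  qed simp_all
  then show ?thesis
    unfolding distributed_def by (simp cong: distr_cong)
qed

lemma WI_null:
  assumes "WI h X" and 0: "(LINT s|L01. (norm (h s))\<^sup>2) = 0"
  shows "AE w in M. X w = 0"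
proof -
  have [measurable]: "X \<in> borel_measurable M" using WI_measurable[OF assms(1)] by simp
  have eq: "distr M borel X = return borel 0"
  proof (rule finite_measure_eqI_iexp)
    show "finite_measure (distr M borel X)" by (rule finite_measure_distr) measurable
    show "finite_measure (return borel (0::real))" by (intro prob_space.finite_measure prob_space_return) simp
    fix t
    have "(CLINT x|distr M borel X. iexp (t * x)) = (CLINT w|M. iexp (t * X w))"
      by (subst integral_distr) auto
    also have "\<dots> = 1" using WI_scaled_iexp[OF assms(1), of t] 0 by simp
    also have "1 = (CLINT x|return borel 0. iexp (t * x))"
      by (subst integral_return) auto
    finally show "(CLINT x|distr M borel X. iexp (t * x)) = (CLINT x|return borel 0. iexp (t * x))" .
  qed simp_all
  have "AE x in distr M borel X. x = 0" unfolding eq by (subst AE_return) auto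
  then show ?thesis by (rule AE_distrD[rotated]) measurable
qed

text \<open>The Ito isometry, read off from the law: the second moment of a centred normal variable
  is its variance. Variance 0 has no density and is covered by \<open>WI_null\<close>.\<close>

lemma WI_sq:
  assumes "WI h X"
  shows "sqnorm M X = sqnorm L01 h"
proof -
  have [measurable]: "X \<in> borel_measurable M" "h \<in> borel_measurable L01" using WI_measurable[OF assms] by simp_all
  have h: "sqnorm L01 h = ennreal (LINT s|L01. (norm (h s))\<^sup>2)"
    using WI_finite[OF assms] by (intro sqnorm_finite_integrable) auto
  let ?v = "LINT s|L01. (norm (h s))\<^sup>2"
  have v0: "?v \<ge> 0" by simp
  show ?thesis
  proof (cases "?v = 0")
    case True
    have "sqnorm M X = (\<integral>\<^sup>+ w. 0 \<partial>M)"
      unfolding sqnorm_def using WI_null[OF assms True] by (intro nn_integral_cong_AE) auto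
    then show ?thesis using h True by simp
  next
    case False
    then have pos: "?v > 0" using v0 by linarith
    note d = WI_normal[OF assms pos]
    have "sqnorm M X = (\<integral>\<^sup>+ x. ennreal (x\<^sup>2) \<partial>distr M lborel X)"
      unfolding sqnorm_def by (subst nn_integral_distr) auto
    also have "\<dots> = (\<integral>\<^sup>+ x. ennreal (normal_density 0 (sqrt ?v) x) * ennreal (x\<^sup>2) \<partial>lborel)"
      unfolding distributed_distr_eq_density[OF d] by (subst nn_integral_density) auto
    also have "\<dots> = (\<integral>\<^sup>+ x. ennreal (normal_density 0 (sqrt ?v) x * x\<^sup>2) \<partial>lborel)"
      by (simp add: ennreal_mult)
    also have "\<dots> = ennreal (LINT x|lborel. normal_density 0 (sqrt ?v) x * x\<^sup>2)"
      using integrable_normal_moment[of "sqrt ?v" 0 2] pos by (intro nn_integral_eq_integral) auto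
    also have "(LINT x|lborel. normal_density 0 (sqrt ?v) x * x\<^sup>2) = ?v"
      using integral_normal_moment_even[of "sqrt ?v" 0 1] pos by (simp add: fact_numeral)
    finally show ?thesis by (simp add: h)
  qed
qed

text \<open>A normal density with positive variance is positive everywhere, so boundedness would
  make the interval \<open>{c<..c+1}\<close> Lebesgue null.\<close>

lemma WI_bounded_imp_null:
  assumes "WI h X" and bd: "AE w in M. \<bar>X w\<bar> \<le> c"
  shows "(LINT s|L01. (norm (h s))\<^sup>2) = 0"
proof (rule ccontr)
  let ?v = "LINT s|L01. (norm (h s))\<^sup>2"
  have [measurable]: "X \<in> borel_measurable M" using WI_measurable[OF assms(1)] by simp
  assume "?v \<noteq> 0"
  moreover have "?v \<ge> 0" by simp
  ultimately have pos: "?v > 0" by linarith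
  have "AE x in distr M lborel X. \<bar>x\<bar> \<le> c" using bd by (subst AE_distr_iff) auto
  then have "AE x in density lborel (normal_density 0 (sqrt ?v)). \<bar>x\<bar> \<le> c"
    unfolding distributed_distr_eq_density[OF WI_normal[OF assms(1) pos]] .
  then have "AE x in lborel. 0 < ennreal (normal_density 0 (sqrt ?v) x) \<longrightarrow> \<bar>x\<bar> \<le> c"
    by (subst (asm) AE_density) auto
  moreover have "0 < ennreal (normal_density 0 (sqrt ?v) x)" for x
    using pos by (simp add: normal_density_pos)
  ultimately have "AE x in lborel. \<bar>x\<bar> \<le> c" by auto
  then have "AE x in lborel. x \<notin> {c<..c+1}" by eventually_elim auto
  then have "{c<..c+1} \<in> null_sets lborel" by (subst AE_iff_null_sets) auto
  then have "emeasure lborel {c<..c+1} = 0" by (rule null_setsD1)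
  then show False by simp
qed

text \<open>The isometry turns convergence of the integrands into a Cauchy property of the
  integrals. The limit is taken pointwise along a subsequence that is almost surely Cauchy.\<close>

lemma WI_limit:
  assumes WI: "\<And>N. WI (h' N) (X' N)" and h [measurable]: "h \<in> borel_measurable L01"
    and lim: "(\<lambda>N. sqnorm L01 (\<lambda>s. h' N s - h s)) \<longlonglongrightarrow> 0"
  obtains X where "WI h X"
proof -
  have [measurable]: "X' N \<in> borel_measurable M" "h' N \<in> borel_measurable L01" for N
    using WI_measurable[OF WI[of N]] by simp_all
  have cauchy: "\<exists>N. \<forall>i\<ge>N. \<forall>j\<ge>N. sqnorm M (\<lambda>w. X' i w - X' j w) < ennreal e" if e: "e > 0" for e
  proof -
    have "\<forall>\<^sub>F N in sequentially. sqnorm L01 (\<lambda>s. h' N s - h s) < ennreal (e / 4)"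
      using order_tendstoD(2)[OF lim] e by simp
    then obtain N where N: "\<And>i. i \<ge> N \<Longrightarrow> sqnorm L01 (\<lambda>s. h' i s - h s) < ennreal (e / 4)"
      unfolding eventually_sequentially by blast
    have "sqnorm M (\<lambda>w. X' i w - X' j w) < ennreal e" if "i \<ge> N" "j \<ge> N" for i j
    proof -
      have "sqnorm L01 (\<lambda>s. h s - h' j s) < ennreal (e / 4)"
        using N[OF that(2)] by (simp add: sqnorm_def norm_minus_commute)
      then have "sqnorm L01 (\<lambda>s. h' i s - h' j s) < ennreal e"
        by (intro sqnorm_triangle_less[OF _ _ _ N[OF that(1)] _ e]) auto
      then show ?thesis using WI_sq[OF WI_diff[OF WI[of i] WI[of j]]] by simp
    qed
    then show ?thesis by blast
  qed
  have int: "integrable M (X' N)" for N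
  proof (rule square_integrable_imp_integrable)
    have "sqnorm M (X' N) < \<infinity>" using WI_sq[OF WI[of N]] WI_finite[OF WI[of N]] by simp
    from sqnorm_finite_integrable(1)[OF _ this] show "integrable M (\<lambda>w. (X' N w)\<^sup>2)" by simp
  qed measurable
  have "\<exists>N. \<forall>i\<ge>N. \<forall>j\<ge>N. (LINT w|M. norm (X' i w - X' j w)) < e" if e: "e > 0" for e
  proof -
    have "e\<^sup>2 > 0" using e by simp
    from cauchy[OF this] obtain N where N: "\<And>i j. i \<ge> N \<Longrightarrow> j \<ge> N \<Longrightarrow> sqnorm M (\<lambda>w. X' i w - X' j w) < ennreal (e\<^sup>2)"
      by blast
    have "(LINT w|M. norm (X' i w - X' j w)) < e" if ij: "i \<ge> N" "j \<ge> N" for i j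
    proof -
      have "ennreal ((norm (LINT w|M. norm (X' i w - X' j w)))\<^sup>2) \<le> sqnorm M (\<lambda>w. norm (X' i w - X' j w))"
        by (rule norm_integral_sq_le) (use int in auto)
      also have "\<dots> = sqnorm M (\<lambda>w. X' i w - X' j w)" by (simp add: sqnorm_def)
      also have "\<dots> < ennreal (e\<^sup>2)" by (rule N[OF ij])
      finally have "(norm (LINT w|M. norm (X' i w - X' j w)))\<^sup>2 < e\<^sup>2"
        by (subst (asm) ennreal_less_iff) auto
      then have "norm (LINT w|M. norm (X' i w - X' j w)) < e" using e by (simp add: power2_less_imp_less)
      then show ?thesis by simp
    qed
    then show ?thesis by blast
  qed
  from cauchy_L1_AE_cauchy_subseq[OF int this] obtain r where r: "strict_mono r" "AE w in M. Cauchy (\<lambda>i. X' (r i) w)"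
    by blast
  define X where "X w = lim (\<lambda>i. X' (r i) w)" for w
  have [measurable]: "X \<in> borel_measurable M"
    unfolding X_def by (intro borel_measurable_lim_metric) measurable
  have X: "AE w in M. (\<lambda>i. X' (r i) w) \<longlonglongrightarrow> X w"
    using r(2) by eventually_elim (auto simp: X_def Cauchy_convergent_iff convergent_LIMSEQ_iff)
  have "WI h X"
  proof (rule WI_closed[OF h])
    fix e :: real assume e: "e > 0"
    obtain N where N: "\<And>i j. i \<ge> N \<Longrightarrow> j \<ge> N \<Longrightarrow> sqnorm M (\<lambda>w. X' i w - X' j w) < ennreal (e/2)"
      using cauchy[of "e/2"] e by auto
    have "\<forall>\<^sub>F j in sequentially. sqnorm L01 (\<lambda>s. h' j s - h s) < ennreal e"
      using order_tendstoD(2)[OF lim] e by simp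
    then obtain N' where N': "\<And>i. i \<ge> N' \<Longrightarrow> sqnorm L01 (\<lambda>s. h' i s - h s) < ennreal e"
      unfolding eventually_sequentially by blast
    define j where "j = max N N'"
    let ?q = "\<lambda>i w. ennreal ((norm (X' j w - X' (r i) w))\<^sup>2)"
    have ri: "i \<le> r i" for i using seq_suble[OF r(1)] .
    \<comment> \<open>Fatou's lemma transfers the Cauchy bound to the pointwise limit; starting from
      \<open>e/2\<close> restores the strict inequality.\<close>
    have "sqnorm M (\<lambda>w. X' j w - X w) = (\<integral>\<^sup>+ w. liminf (\<lambda>i. ?q i w) \<partial>M)"
      unfolding sqnorm_def
    proof (rule nn_integral_cong_AE)
      show "AE w in M. ennreal ((norm (X' j w - X w))\<^sup>2) = liminf (\<lambda>i. ?q i w)"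
        using X
      proof eventually_elim
        case (elim w)
        have "(\<lambda>i. ?q i w) \<longlonglongrightarrow> ennreal ((norm (X' j w - X w))\<^sup>2)"
          by (intro tendsto_ennrealI tendsto_power tendsto_norm tendsto_diff tendsto_const elim)
        from lim_imp_Liminf[OF _ this] show ?case by simp
      qed
    qed
    also have "\<dots> \<le> liminf (\<lambda>i. \<integral>\<^sup>+ w. ?q i w \<partial>M)"
      by (rule nn_integral_liminf) measurable
    also have "\<dots> \<le> limsup (\<lambda>i. \<integral>\<^sup>+ w. ?q i w \<partial>M)"
      by (rule Liminf_le_Limsup) simp
    also have "\<dots> \<le> ennreal (e/2)"
    proof (rule Limsup_bounded)
      show "\<forall>\<^sub>F i in sequentially. (\<integral>\<^sup>+ w. ?q i w \<partial>M) \<le> ennreal (e/2)"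
      proof (rule eventually_sequentiallyI[of N])
        fix i assume "N \<le> i"
        then have "N \<le> r i" using ri[of i] by simp
        then show "(\<integral>\<^sup>+ w. ?q i w \<partial>M) \<le> ennreal (e/2)"
          using N[of j "r i"] by (simp add: sqnorm_def j_def less_imp_le)
      qed
    qed
    also have "\<dots> < ennreal e" using e by (intro ennreal_lessI) auto
    finally show "\<exists>h' X'. WI h' X' \<and> sqnorm L01 (\<lambda>s. h' s - h s) < ennreal e \<and> sqnorm M (\<lambda>w. X' w - X w) < ennreal e"
      using WI[of j] N'[of j] by (auto simp: j_def)
  qed measurable
  then show ?thesis by (rule that)
qed

end

text \<open>Multiplication by \<open>e^(-i\<theta>)\<close> followed by \<open>A\<^sup>T\<close> on \<open>\<complex>\<^sup>n\<close>, with \<open>x + i y\<close> represented by \<open>(x, y)\<close>.\<close>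

definition twist :: "real \<Rightarrow> real ^ 'n ^ 'n \<Rightarrow> (real ^ 'n) \<times> (real ^ 'n) \<Rightarrow> (real ^ 'n) \<times> (real ^ 'n)" where
  "twist \<theta> A p = ((cos \<theta> *\<^sub>R fst p + sin \<theta> *\<^sub>R snd p) v* A, (cos \<theta> *\<^sub>R snd p - sin \<theta> *\<^sub>R fst p) v* A)"

lemma linear_twist: "linear (twist \<theta> A)"
  by (rule linearI)
    (simp_all add: twist_def vector_matrix_add_left vector_matrix_diff_left vector_matrix_scale_left algebra_simps)

lemma norm_twist:
  assumes "orthogonal_matrix A"
  shows "norm (twist \<theta> A p) = norm p"
proof -
  obtain x y where p: "p = (x, y)" by (cases p)
  have "(norm (c *\<^sub>R x + d *\<^sub>R y))\<^sup>2 + (norm (c *\<^sub>R y - d *\<^sub>R x))\<^sup>2 = (c\<^sup>2 + d\<^sup>2) * ((norm x)\<^sup>2 + (norm y)\<^sup>2)" for c d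
    unfolding power2_norm_eq_inner by (simp add: inner_add inner_diff inner_commute power2_eq_square algebra_simps)
  from this[of "cos \<theta>" "sin \<theta>"] show ?thesis
    by (simp add: p twist_def norm_Pair norm_vector_orthogonal_matrix[OF assms])
qed

lemma vector_matrix_minus_left: "(- u) v* A = - (u v* (A :: real ^ 'n ^ 'm))"
  using vector_matrix_scale_left[of "-1" u A] by simp

lemma twist_pow_real:
  "(twist \<theta> A ^^ k) (u, 0) = (cos (k * \<theta>) *\<^sub>R ((\<lambda>v. v v* A) ^^ k) u, - sin (k * \<theta>) *\<^sub>R ((\<lambda>v. v v* A) ^^ k) u)"
proof (induction k)
  case (Suc k)
  have cs: "cos (real (Suc k) * \<theta>) = cos \<theta> * cos (k * \<theta>) - sin \<theta> * sin (k * \<theta>)"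
    "sin (real (Suc k) * \<theta>) = cos \<theta> * sin (k * \<theta>) + sin \<theta> * cos (k * \<theta>)"
    by (simp_all add: distrib_right cos_add sin_add)
  show ?case
    unfolding funpow.simps o_apply Suc cs
    by (simp add: twist_def vector_matrix_minus_left vector_matrix_add_left vector_matrix_diff_left vector_matrix_scale_left
        scaleR_add_left scaleR_diff_left algebra_simps del: of_nat_Suc)
qed simp

lemma linear_twist_pow: "linear (twist \<theta> A ^^ k)"
proof (induction k)
  case 0
  show ?case using linear_id by (simp add: id_def)
next
  case (Suc k)
  show ?case using linear_compose[OF Suc linear_twist] by (simp add: o_def)
qed

text \<open>Complex linearity in real coordinates: \<open>twist\<close> commutes with multiplication
  by \<open>i\<close>, that is \<open>(x, y) \<mapsto> (- y, x)\<close>, and \<open>(0, v)\<close>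
  is \<open>i\<close> times \<open>(v, 0)\<close>.\<close>

lemma twist_pow_imag: "(twist \<theta> A ^^ k) (0, v) = (- snd ((twist \<theta> A ^^ k) (v, 0)), fst ((twist \<theta> A ^^ k) (v, 0)))"
proof -
  have J: "twist \<theta> A (- snd p, fst p) = (- snd (twist \<theta> A p), fst (twist \<theta> A p))" for p
    by (simp add: twist_def vector_matrix_add_left vector_matrix_diff_left vector_matrix_scale_left scaleR_minus_right[symmetric]
        del: scaleR_minus_right) (simp add: vec_eq_iff vector_matrix_mult_def sum_negf[symmetric] sum.distrib[symmetric] sum_subtractf[symmetric] algebra_simps)
  show ?thesis
    by (induction k) (simp_all add: J[of "(twist \<theta> A ^^ _) (v, 0)", simplified] J)
qed

text \<open>The real and imaginary parts of an eigenvector of the transpose form the fixed pair,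
  since \<open>twist\<close> divides the eigenvalue \<open>e^(i\<theta>)\<close> out again.\<close>

lemma is_eigenvalue_cis_imp_twist_fixed:
  fixes A :: "real ^ 'n ^ 'n"
  assumes "is_eigenvalue A (cis \<theta>)"
  obtains p where "p \<noteq> 0" "twist \<theta> A p = p"
proof -
  have "is_eigenvalue (transpose A) (cis \<theta>)" using assms by (simp add: is_eigenvalue_transpose)
  then obtain x where x: "x \<noteq> 0" "map_matrix complex_of_real (transpose A) *v x = cis \<theta> *s x"
    unfolding is_eigenvalue_iff by blast
  define f :: "real ^ 'n" where "f = (\<chi> i. Re (x $ i))"
  define g :: "real ^ 'n" where "g = (\<chi> i. Im (x $ i))"
  have xi: "(\<Sum>j\<in>UNIV. complex_of_real (A $ j $ i) * x $ j) = cis \<theta> * x $ i" for i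
    using x(2) by (auto simp: vec_eq_iff matrix_vector_mult_def map_matrix_def transpose_def)
  have fA: "f v* A = cos \<theta> *\<^sub>R f - sin \<theta> *\<^sub>R g"
  proof -
    have "Re (\<Sum>j\<in>UNIV. complex_of_real (A $ j $ i) * x $ j) = Re (cis \<theta> * x $ i)" for i by (simp only: xi)
    then show ?thesis by (simp add: vec_eq_iff vector_matrix_mult_def f_def g_def mult.commute)
  qed
  have gA: "g v* A = sin \<theta> *\<^sub>R f + cos \<theta> *\<^sub>R g"
  proof -
    have "Im (\<Sum>j\<in>UNIV. complex_of_real (A $ j $ i) * x $ j) = Im (cis \<theta> * x $ i)" for i by (simp only: xi)
    then show ?thesis by (simp add: vec_eq_iff vector_matrix_mult_def f_def g_def mult.commute add.commute)
  qed
  have cs: "cos \<theta> * cos \<theta> + sin \<theta> * sin \<theta> = 1"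
    using sin_cos_squared_add[of \<theta>] by (simp add: power2_eq_square)
  have 1: "c *\<^sub>R (c *\<^sub>R f - d *\<^sub>R g) + d *\<^sub>R (d *\<^sub>R f + c *\<^sub>R g) = (c * c + d * d) *\<^sub>R f"
   and 2: "c *\<^sub>R (d *\<^sub>R f + c *\<^sub>R g) - d *\<^sub>R (c *\<^sub>R f - d *\<^sub>R g) = (c * c + d * d) *\<^sub>R g" for c d
    by (simp_all add: algebra_simps)
  have "twist \<theta> A (f, g) = (f, g)"
    by (simp only: twist_def fst_conv snd_conv vector_matrix_add_left vector_matrix_diff_left vector_matrix_scale_left
        fA gA 1 2 cs scaleR_one)
  moreover have "(f, g) \<noteq> 0"
    using x(1) by (auto simp: f_def g_def vec_eq_iff zero_prod_def complex_eq_iff)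
  ultimately show ?thesis using that by blast
qed

text \<open>The real basis vectors span \<open>\<complex>\<^sup>n\<close> over the complex numbers,
  so the means vanish in the limit at every vector. At a fixed point, however, the means equal that
  point.\<close>

lemma not_eigenvalue_if_means_vanish:
  fixes A :: "real ^ 'n ^ 'n"
  assumes lim: "\<And>i. (\<lambda>N. (1 / real N) *\<^sub>R (\<Sum>k<N. (twist \<theta> A ^^ k) (axis i 1, 0))) \<longlonglongrightarrow> 0"
  shows "\<not> is_eigenvalue A (cis \<theta>)"
proof
  assume "is_eigenvalue A (cis \<theta>)"
  then obtain p where p: "p \<noteq> 0" "twist \<theta> A p = p" by (rule is_eigenvalue_cis_imp_twist_fixed)
  let ?m = "\<lambda>N q. (1 / real N) *\<^sub>R (\<Sum>k<N. (twist \<theta> A ^^ k) q)"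
  have lin: "linear (?m N)" for N
    by (intro linear_compose_scale_right linear_compose_sum ballI linear_twist_pow)
  have fst0: "(\<lambda>N. ?m N (v, 0)) \<longlonglongrightarrow> 0" for v
  proof -
    have "v = (\<Sum>i\<in>UNIV. v $ i *\<^sub>R axis i 1)"
      using basis_expansion[of v] by (simp add: scalar_mult_eq_scaleR)
    then have v: "(v, 0 :: real ^ 'n) = (\<Sum>i\<in>UNIV. v $ i *\<^sub>R (axis i 1, 0))"
      by (simp add: prod_eq_iff fst_sum snd_sum)
    have "?m N (v, 0) = (\<Sum>i\<in>UNIV. v $ i *\<^sub>R ?m N (axis i 1, 0))" for N
      unfolding v linear_sum[OF lin] linear_scale[OF lin] by (simp add: axis_def)
    moreover have "(\<lambda>N. \<Sum>i\<in>UNIV. v $ i *\<^sub>R ?m N (axis i 1, 0)) \<longlonglongrightarrow> (\<Sum>i\<in>UNIV. v $ i *\<^sub>R 0)"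
      by (intro tendsto_sum tendsto_scaleR tendsto_const lim)
    ultimately show ?thesis by simp
  qed
  have snd0: "(\<lambda>N. ?m N (0, v)) \<longlonglongrightarrow> 0" for v
  proof -
    have eq: "?m N (0, v) = (- snd (?m N (v, 0)), fst (?m N (v, 0)))" for N
      by (simp add: twist_pow_imag prod_eq_iff fst_sum snd_sum sum_negf scaleR_sum_right)
    have "(\<lambda>N. ?m N (0, v)) \<longlonglongrightarrow> (- snd (0 :: (real ^ 'n) \<times> (real ^ 'n)), fst (0 :: (real ^ 'n) \<times> (real ^ 'n)))"
      unfolding eq by (rule tendsto_Pair[OF tendsto_minus[OF tendsto_snd[OF fst0]] tendsto_fst[OF fst0]])
    then show ?thesis by (simp add: zero_prod_def)
  qed
  have "?m N p = ?m N (fst p, 0) + ?m N (0, snd p)" for N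
    using linear_add[OF lin, of N "(fst p, 0)" "(0, snd p)"] by simp
  then have "(\<lambda>N. ?m N p) \<longlonglongrightarrow> 0 + 0"
    using tendsto_add[OF fst0 snd0] by simp
  moreover have "(\<lambda>N. ?m N p) \<longlonglongrightarrow> p"
  proof (rule Lim_transform_eventually[OF tendsto_const])
    have "(twist \<theta> A ^^ k) p = p" for k by (induction k) (simp_all add: p)
    then show "\<forall>\<^sub>F N in sequentially. p = ?m N p"
      by (intro eventually_sequentiallyI[of 1]) (simp add: sum_constant_scaleR)
  qed
  ultimately show False using p(1) LIMSEQ_unique by fastforce
qed

context wiener_rotation
begin

text \<open>The limit \<open>F + i G\<close> of the means satisfies \<open>\<gamma>\<^sup>T (F + i G) = e^(i\<theta>) (F + i G)\<close>. Hence \<open>T\<close> multiplies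
  \<open>X + i Y = \<integral> (F + i G) \<bullet> dW\<close> by \<open>e^(i\<theta>)\<close>, so \<open>X\<^sup>2 + Y\<^sup>2\<close> is invariant and thus constant; a Gaussian variable
  is bounded only if it vanishes.\<close>

lemma ergodic_imp_twist_means_vanish:
  assumes erg: "ergodic M T" and S: "valid_vstep S"
  shows "AE s in L01. (\<lambda>N. (1 / real N) *\<^sub>R (\<Sum>k<N. (twist \<theta> (\<gamma> s) ^^ k) (vstep_fun S s, 0))) \<longlonglongrightarrow> 0"
proof -
  let ?g = "vstep_fun S" and ?c = "cos \<theta>" and ?d = "sin \<theta>"
  define a where "a N k = cos (real k * \<theta>) / real N" for N k
  define b where "b N k = - sin (real k * \<theta>) / real N" for N k
  define f where "f N s = (\<Sum>k<N. a N k *\<^sub>R rot k s (?g s))" for N s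
  define g where "g N s = (\<Sum>k<N. b N k *\<^sub>R rot k s (?g s))" for N s
  have fg: "(1 / real N) *\<^sub>R (\<Sum>k<N. (twist \<theta> (\<gamma> s) ^^ k) (?g s, 0)) = (f N s, g N s)" for N s
    unfolding twist_pow_real f_def g_def a_def b_def
    by (simp add: prod_eq_iff fst_sum snd_sum scaleR_sum_right sum_negf)
  \<comment> \<open>Taken as pointwise limits, \<open>F\<close> and \<open>G\<close> are measurable
    without any selection of eigenvectors.\<close>
  define F where "F s = lim (\<lambda>N. f N s)" for s
  define G where "G s = lim (\<lambda>N. g N s)" for s
  have f_meas [measurable]: "f N \<in> borel_measurable L01" "g N \<in> borel_measurable L01" for N
    unfolding f_def g_def by measurable
  have [measurable]: "F \<in> borel_measurable L01" "G \<in> borel_measurable L01"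
    unfolding F_def G_def by (intro borel_measurable_lim_metric f_meas)+
  have FG: "(\<lambda>N. f N s) \<longlonglongrightarrow> F s" "(\<lambda>N. g N s) \<longlonglongrightarrow> G s" "twist \<theta> (\<gamma> s) (F s, G s) = (F s, G s)" if s: "s \<in> {0..1}" for s
  proof -
    obtain y where y: "twist \<theta> (\<gamma> s) y = y" "(\<lambda>N. (f N s, g N s)) \<longlonglongrightarrow> y"
      using mean_ergodic_finite_dim[OF linear_twist norm_twist[OF orth[OF s]], of \<theta> "(?g s, 0)"]
      unfolding fg by blast
    have 1: "(\<lambda>N. f N s) \<longlonglongrightarrow> fst y" "(\<lambda>N. g N s) \<longlonglongrightarrow> snd y"
      using tendsto_fst[OF y(2)] tendsto_snd[OF y(2)] by simp_all
    then have "fst y = F s" "snd y = G s" unfolding F_def G_def by (auto dest: limI)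
    then have "y = (F s, G s)" by (simp add: prod_eq_iff)
    then show "(\<lambda>N. f N s) \<longlonglongrightarrow> F s" "(\<lambda>N. g N s) \<longlonglongrightarrow> G s" "twist \<theta> (\<gamma> s) (F s, G s) = (F s, G s)"
      using 1 y(1) by simp_all
  qed
  obtain B where B: "B \<ge> 0" "\<And>s. norm (?g s) \<le> B" using vstep_fun_bounded by blast
  have sum_bd: "norm (\<Sum>k<N. c k *\<^sub>R rot k s (?g s)) \<le> B"
    if s: "s \<in> {0..1}" and c: "\<And>k. \<bar>c k\<bar> \<le> 1 / real N" for s N and c :: "nat \<Rightarrow> real"
  proof -
    have "norm (\<Sum>k<N. c k *\<^sub>R rot k s (?g s)) \<le> (\<Sum>k<N. (1 / real N) * B)"
    proof (rule sum_norm_le)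
      fix k
      show "norm (c k *\<^sub>R rot k s (?g s)) \<le> (1 / real N) * B"
        unfolding norm_scaleR norm_rot_pow[OF s] using c[of k] B by (intro mult_mono) auto
    qed
    also have "\<dots> \<le> B" using B by (cases "N = 0") auto
    finally show ?thesis .
  qed
  have ab: "\<bar>a N k\<bar> \<le> 1 / real N" "\<bar>b N k\<bar> \<le> 1 / real N" for N k
    unfolding a_def b_def by (auto simp: divide_right_mono)
  \<comment> \<open>The uniform bound \<open>B\<close> on the means passes to their limit, so
    dominated convergence turns pointwise convergence into mean square convergence, as
    \<open>WI_limit\<close> requires.\<close>
  have L2: "(\<lambda>N. sqnorm L01 (\<lambda>s. h N s - H s)) \<longlonglongrightarrow> 0"
    if [measurable]: "\<And>N. h N \<in> borel_measurable L01" "H \<in> borel_measurable L01"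
      and bd: "\<And>N s. s \<in> {0..1} \<Longrightarrow> norm (h N s) \<le> B" and cv: "\<And>s. s \<in> {0..1} \<Longrightarrow> (\<lambda>N. h N s) \<longlonglongrightarrow> H s"
    for h and H :: "real \<Rightarrow> real ^ 'n"
  proof -
    interpret L: prob_space L01 by (rule prob_space_L01)
    have H: "norm (H s) \<le> B" if "s \<in> {0..1}" for s
      by (rule tendsto_upperbound[OF tendsto_norm[OF cv[OF that]]]) (simp_all add: bd[OF that])
    have "(\<lambda>N. \<integral>\<^sup>+ s. ennreal ((norm (h N s - H s))\<^sup>2) \<partial>L01) \<longlonglongrightarrow> (\<integral>\<^sup>+ s. 0 \<partial>L01)"
    proof (rule nn_integral_dominated_convergence[where w="\<lambda>_. ennreal ((B + B)\<^sup>2)"])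
      show "AE s in L01. ennreal ((norm (h N s - H s))\<^sup>2) \<le> ennreal ((B + B)\<^sup>2)" for N
      proof (rule AE_I2)
        fix s assume "s \<in> space L01"
        then have "norm (h N s - H s) \<le> B + B"
          using norm_triangle_ineq4[of "h N s" "H s"] bd[of s N] H[of s] by simp
        then show "ennreal ((norm (h N s - H s))\<^sup>2) \<le> ennreal ((B + B)\<^sup>2)"
          by (intro ennreal_leI power_mono) auto
      qed
      show "AE s in L01. (\<lambda>N. ennreal ((norm (h N s - H s))\<^sup>2)) \<longlonglongrightarrow> 0"
      proof (rule AE_I2)
        fix s assume "s \<in> space L01"
        then have "(\<lambda>N. h N s - H s) \<longlonglongrightarrow> 0" using cv by (simp add: LIM_zero)
        from tendsto_ennrealI[OF tendsto_power[OF tendsto_norm[OF this], of 2]]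
        show "(\<lambda>N. ennreal ((norm (h N s - H s))\<^sup>2)) \<longlonglongrightarrow> 0" by simp
      qed
      show "(\<integral>\<^sup>+ s. ennreal ((B + B)\<^sup>2) \<partial>L01) < \<infinity>" using L.emeasure_space_1 by simp
    qed measurable
    then show ?thesis by (simp add: sqnorm_def)
  qed
  have WIf: "WI (f N) (\<lambda>w. \<Sum>k<N. a N k * vstep_int S ((T ^^ k) w))" for N
    unfolding f_def by (intro WI_sum WI_scale WI_T_pow WI_vstep S) auto
  have WIg: "WI (g N) (\<lambda>w. \<Sum>k<N. b N k * vstep_int S ((T ^^ k) w))" for N
    unfolding g_def by (intro WI_sum WI_scale WI_T_pow WI_vstep S) auto
  have limF: "(\<lambda>N. sqnorm L01 (\<lambda>s. f N s - F s)) \<longlonglongrightarrow> 0"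
    by (rule L2) (use FG sum_bd ab in \<open>auto simp: f_def\<close>)
  have limG: "(\<lambda>N. sqnorm L01 (\<lambda>s. g N s - G s)) \<longlonglongrightarrow> 0"
    by (rule L2) (use FG sum_bd ab in \<open>auto simp: g_def\<close>)
  obtain X where X: "WI F X" by (rule WI_limit[OF WIf _ limF]) auto
  obtain Y where Y: "WI G Y" by (rule WI_limit[OF WIg _ limG]) auto
  have [measurable]: "X \<in> borel_measurable M" "Y \<in> borel_measurable M"
    using WI_measurable[OF X] WI_measurable[OF Y] by simp_all
  have cs: "?c * ?c + ?d * ?d = 1"
    using sin_cos_squared_add[of \<theta>] by (simp add: power2_eq_square)
  have rot: "F s v* \<gamma> s = ?c *\<^sub>R F s - ?d *\<^sub>R G s" "G s v* \<gamma> s = ?c *\<^sub>R G s + ?d *\<^sub>R F s" if s: "s \<in> {0..1}" for s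
  proof -
    \<comment> \<open>The fixed point equation expresses \<open>F\<close> and \<open>G\<close>
      through their rotated versions \<open>p\<close> and \<open>q\<close>; inverting the planar
      rotation by \<open>\<theta>\<close> solves it for \<open>p\<close> and
      \<open>q\<close>.\<close>
    define p where "p = F s v* \<gamma> s"
    define q where "q = G s v* \<gamma> s"
    have 1: "F s = ?c *\<^sub>R p + ?d *\<^sub>R q" "G s = ?c *\<^sub>R q - ?d *\<^sub>R p"
      using FG(3)[OF s] by (simp_all add: p_def q_def twist_def vector_matrix_add_left vector_matrix_diff_left vector_matrix_scale_left)
    have 2: "c *\<^sub>R (c *\<^sub>R p + d *\<^sub>R q) - d *\<^sub>R (c *\<^sub>R q - d *\<^sub>R p) = (c * c + d * d) *\<^sub>R p"
      "c *\<^sub>R (c *\<^sub>R q - d *\<^sub>R p) + d *\<^sub>R (c *\<^sub>R p + d *\<^sub>R q) = (c * c + d * d) *\<^sub>R q" for c d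
      by (simp_all add: algebra_simps)
    have "p = ?c *\<^sub>R F s - ?d *\<^sub>R G s" "q = ?c *\<^sub>R G s + ?d *\<^sub>R F s"
      unfolding 1 2 cs by simp_all
    then show "F s v* \<gamma> s = ?c *\<^sub>R F s - ?d *\<^sub>R G s" "G s v* \<gamma> s = ?c *\<^sub>R G s + ?d *\<^sub>R F s"
      by (simp_all only: p_def q_def)
  qed
  have zero: "AE w in M. Z w = 0" if "WI h Z" "\<And>s. s \<in> {0..1} \<Longrightarrow> h s = 0" for h Z
  proof (rule WI_null[OF that(1)])
    have "(LINT s|L01. (norm (h s))\<^sup>2) = (LINT s|L01. 0)"
      using that(2) by (intro Bochner_Integration.integral_cong) auto
    then show "(LINT s|L01. (norm (h s))\<^sup>2) = 0" by simp
  qed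
  \<comment> \<open>By \<open>rot\<close> the integrand of this difference vanishes on
    \<open>{0..1}\<close>, so the difference is almost surely 0.\<close>
  have XT: "AE w in M. X (T w) - (?c * X w - ?d * Y w) = 0"
    by (rule zero[OF WI_diff[OF WI_T[OF X] WI_diff[OF WI_scale[OF X] WI_scale[OF Y]]]]) (simp add: rot)
  have YT: "AE w in M. Y (T w) - (?c * Y w + ?d * X w) = 0"
    by (rule zero[OF WI_diff[OF WI_T[OF Y] WI_add[OF WI_scale[OF Y] WI_scale[OF X]]]]) (simp add: rot)
  have "AE w in M. (X (T w))\<^sup>2 + (Y (T w))\<^sup>2 = (X w)\<^sup>2 + (Y w)\<^sup>2"
    using XT YT
  proof eventually_elim
    case (elim w)
    then have e: "X (T w) = ?c * X w - ?d * Y w" "Y (T w) = ?c * Y w + ?d * X w" by simp_all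
    have key: "(c * x - d * y)\<^sup>2 + (c * y + d * x)\<^sup>2 = (c * c + d * d) * (x\<^sup>2 + y\<^sup>2)" for c d x y :: real
      by (simp add: power2_eq_square algebra_simps)
    show ?case unfolding e key cs by simp
  qed
  then obtain C where C: "AE w in M. (X w)\<^sup>2 + (Y w)\<^sup>2 = C"
    using erg unfolding ergodic_def by (elim allE[of _ "\<lambda>w. (X w)\<^sup>2 + (Y w)\<^sup>2"]) auto
  have "AE w in M. \<bar>X w\<bar> \<le> sqrt C" using C
  proof eventually_elim
    case (elim w)
    show ?case by (rule real_le_rsqrt) (use elim in \<open>simp flip: elim\<close>)
  qed
  then have F0: "(LINT s|L01. (norm (F s))\<^sup>2) = 0" by (rule WI_bounded_imp_null[OF X])
  have "AE w in M. \<bar>Y w\<bar> \<le> sqrt C" using C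
  proof eventually_elim
    case (elim w)
    show ?case by (rule real_le_rsqrt) (use elim in \<open>simp flip: elim\<close>)
  qed
  then have G0: "(LINT s|L01. (norm (G s))\<^sup>2) = 0" by (rule WI_bounded_imp_null[OF Y])
  have ae0: "AE s in L01. H s = 0" if "WI H Z" "(LINT s|L01. (norm (H s))\<^sup>2) = 0" for H Z
  proof -
    have [measurable]: "H \<in> borel_measurable L01" using WI_measurable[OF that(1)] by simp
    have "integrable L01 (\<lambda>s. (norm (H s))\<^sup>2)"
      by (rule sqnorm_finite_integrable) (use WI_finite[OF that(1)] in auto)
    from integral_nonneg_eq_0_iff_AE[OF this] that(2) show ?thesis by simp
  qed
  show ?thesis
    using ae0[OF X F0] ae0[OF Y G0] AE_space
  proof eventually_elim
    case (elim s)
    then have "s \<in> {0..1}" by simp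
    from tendsto_Pair[OF FG(1)[OF this] FG(2)[OF this]] elim show ?case
      unfolding fg by (simp add: zero_prod_def)
  qed
qed

lemma ergodic_imp_not_eigenvalue:
  assumes "ergodic M T"
  shows "AE s in L01. \<not> is_eigenvalue (\<gamma> s) (cis \<theta>)"
proof -
  have "AE s in L01. (\<lambda>N. (1 / real N) *\<^sub>R (\<Sum>k<N. (twist \<theta> (\<gamma> s) ^^ k) (vstep_fun [(0, 1, axis i 1)] s, 0))) \<longlonglongrightarrow> 0" for i
    by (rule ergodic_imp_twist_means_vanish[OF assms]) simp
  then have 1: "AE s in L01. \<forall>i\<in>UNIV. (\<lambda>N. (1 / real N) *\<^sub>R (\<Sum>k<N. (twist \<theta> (\<gamma> s) ^^ k) (vstep_fun [(0, 1, axis i 1)] s, 0))) \<longlonglongrightarrow> 0"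
    by (intro AE_finite_allI) auto
  \<comment> \<open>The step \<open>(0, 1, c)\<close> lives on the half-open interval and misses
    \<open>s = 0\<close>, which is discarded as a null set.\<close>
  have "{0} \<in> null_sets L01" by (subst null_sets_restrict_space) auto
  then have "AE s in L01. s \<notin> {0}" by (rule AE_not_in)
  with 1 show ?thesis using AE_space
  proof eventually_elim
    case (elim s)
    then have "vstep_fun [(0, 1, c)] s = c" for c :: "real ^ 'n" by simp
    then show ?case using elim(1) by (intro not_eigenvalue_if_means_vanish) auto
  qed
qed

end

section \<open>Measurability of the eigenvalue arguments\<close>

text \<open>This expresses that the polynomial is monic of degree \<open>CARD('n)\<close>, without
  expanding its coefficients: dividing each entry by \<open>m\<close> turns the matrix into one that
  tends to the identity.\<close>

lemma charpoly_monic_limit: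
  fixes A :: "complex ^ 'n ^ 'n"
  shows "(\<lambda>m. poly (charpoly A) (of_nat m) / of_nat m ^ CARD('n)) \<longlonglongrightarrow> 1"
proof -
  have entry: "(\<lambda>m. (mat (of_nat m) - A) $ i $ k / of_nat m) \<longlonglongrightarrow> mat 1 $ i $ k" for i k
  proof (rule Lim_transform_eventually)
    show "(\<lambda>m. mat 1 $ i $ k - A $ i $ k * (1 / of_nat m)) \<longlonglongrightarrow> mat 1 $ i $ k"
      using tendsto_diff[OF tendsto_const tendsto_mult_right_zero[OF lim_1_over_n]] by fastforce
    show "\<forall>\<^sub>F m in sequentially. mat 1 $ i $ k - A $ i $ k * (1 / of_nat m) = (mat (of_nat m) - A) $ i $ k / of_nat m"
      by (rule eventually_sequentiallyI[of 1]) (simp add: mat_def diff_divide_distrib)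
  qed
  have "poly (charpoly A) (of_nat m) / of_nat m ^ CARD('n)
    = (\<Sum>p | p permutes (UNIV :: 'n set). of_int (sign p) * (\<Prod>i\<in>UNIV. (mat (of_nat m) - A) $ i $ p i / of_nat m))" for m
    unfolding poly_charpoly det_def by (simp add: sum_divide_distrib prod_dividef)
  moreover have "(\<lambda>m. \<Sum>p | p permutes (UNIV :: 'n set). of_int (sign p) * (\<Prod>i\<in>UNIV. (mat (of_nat m) - A) $ i $ p i / of_nat m))
     \<longlonglongrightarrow> det (mat 1 :: complex ^ 'n ^ 'n)"
    unfolding det_def by (intro tendsto_sum tendsto_mult tendsto_const tendsto_prod entry)
  ultimately show ?thesis by simp
qed

lemma prod_linear_monic_limit:
  fixes e :: "'i \<Rightarrow> complex"
  assumes "finite I"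
  shows "(\<lambda>m. (\<Prod>j\<in>I. of_nat m - e j) / of_nat m ^ card I) \<longlonglongrightarrow> 1"
proof (rule Lim_transform_eventually)
  have "(\<lambda>m. \<Prod>j\<in>I. 1 - e j * (1 / of_nat m)) \<longlonglongrightarrow> (\<Prod>j\<in>I. 1 - e j * 0)"
    by (intro tendsto_prod tendsto_diff tendsto_mult tendsto_const lim_1_over_n)
  then show "(\<lambda>m. \<Prod>j\<in>I. 1 - e j * (1 / of_nat m)) \<longlonglongrightarrow> 1" by simp
  show "\<forall>\<^sub>F m in sequentially. (\<Prod>j\<in>I. 1 - e j * (1 / of_nat m)) = (\<Prod>j\<in>I. of_nat m - e j) / of_nat m ^ card I"
  proof (rule eventually_sequentiallyI[of 1])
    fix m :: nat assume "1 \<le> m"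
    then have "1 - e j * (1 / of_nat m) = (of_nat m - e j) / of_nat m" for j by (simp add: diff_divide_distrib)
    then show "(\<Prod>j\<in>I. 1 - e j * (1 / of_nat m)) = (\<Prod>j\<in>I. of_nat m - e j) / of_nat m ^ card I"
      by (simp add: prod_dividef)
  qed
qed

lemma count_image_mset_set:
  assumes "finite I"
  shows "count (image_mset f (mset_set I)) z = card {j\<in>I. f j = z}"
  using assms
proof (induction I rule: finite_induct)
  case (insert x F)
  have "{j\<in>insert x F. f j = z} = (if f x = z then insert x {j\<in>F. f j = z} else {j\<in>F. f j = z})"
    by auto
  then show ?case using insert by simp
qed simp

lemma proots_prod_linear:
  assumes "finite I"
  shows "proots (\<Prod>j\<in>I. [:- e j, 1:]) = image_mset e (mset_set I)"
proof -
  have "proots (\<Prod>j\<in>I. [:- e j, 1:]) = (\<Sum>j\<in>I. {#e j#})"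
    by (subst proots_prod) auto
  also have "\<dots> = image_mset e (mset_set I)"
    using assms by (induction I rule: finite_induct) auto
  finally show ?thesis .
qed

text \<open>The orders in \<open>eigenvalue_arguments\<close> fix the multiset of roots, hence the
  polynomial up to its leading coefficient. Comparing the growth of both sides at large integers
  gives the coefficient 1.\<close>

lemma charpoly_eq_prod:
  fixes A :: "real ^ 'n ^ 'n"
  assumes "eigenvalue_arguments A p"
  shows "charpoly (map_matrix complex_of_real A) = (\<Prod>j\<in>{1..CARD('n)}. [:- iexp (p j), 1:])"
proof -
  let ?q = "charpoly (map_matrix complex_of_real A)" and ?e = "\<lambda>j. iexp (p j)"
  note lim = charpoly_monic_limit[of "map_matrix complex_of_real A"]
  have q0: "?q \<noteq> 0"
  proof
    assume "?q = 0"
    with lim have "(\<lambda>m::nat. 0 :: complex) \<longlonglongrightarrow> 1" by simp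
    then show False by (simp add: LIMSEQ_const_iff)
  qed
  have "proots ?q = image_mset ?e (mset_set {1..CARD('n)})"
  proof (rule multiset_eqI)
    fix z
    show "count (proots ?q) z = count (image_mset ?e (mset_set {1..CARD('n)})) z"
      using assms unfolding count_image_mset_set[OF finite_atLeastAtMost] eigenvalue_arguments_def count_proots[OF q0]
      by blast
  qed
  then have "(\<Prod>x\<in>#proots ?q. [:- x, 1:]) = (\<Prod>j\<in>{1..CARD('n)}. [:- ?e j, 1:])"
    by (simp add: image_mset.compositionality o_def prod_unfold_prod_mset)
  then have q: "?q = smult (lead_coeff ?q) (\<Prod>j\<in>{1..CARD('n)}. [:- ?e j, 1:])"
    using complex_poly_decompose_multiset[of ?q] by simp
  have "poly ?q x = lead_coeff ?q * (\<Prod>j\<in>{1..CARD('n)}. x - ?e j)" for x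
    by (subst q) (simp add: poly_prod)
  then have "(\<lambda>m. lead_coeff ?q * ((\<Prod>j\<in>{1..CARD('n)}. of_nat m - ?e j) / of_nat m ^ CARD('n))) \<longlonglongrightarrow> 1"
    using lim by simp
  moreover have "(\<lambda>m. lead_coeff ?q * ((\<Prod>j\<in>{1..CARD('n)}. of_nat m - ?e j) / of_nat m ^ CARD('n))) \<longlonglongrightarrow> lead_coeff ?q * 1"
    using prod_linear_monic_limit[of "{1..CARD('n)}" ?e] by (intro tendsto_mult tendsto_const) simp
  ultimately have "lead_coeff ?q = 1" using LIMSEQ_unique by fastforce
  then show ?thesis using q by simp
qed

lemma is_eigenvalue_iff_argument:
  fixes A :: "real ^ 'n ^ 'n"
  assumes "eigenvalue_arguments A p"
  shows "is_eigenvalue A z \<longleftrightarrow> (\<exists>j\<in>{1..CARD('n)}. iexp (p j) = z)"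
proof -
  have "is_eigenvalue A z \<longleftrightarrow> poly (charpoly (map_matrix complex_of_real A)) z = 0"
    by (simp add: is_eigenvalue_def poly_charpoly)
  then show ?thesis
    unfolding charpoly_eq_prod[OF assms] by (auto simp: poly_prod)
qed

lemma exp_i_eq_iff:
  assumes "0 < x" "x \<le> 2 * pi" "0 < y" "y \<le> 2 * pi"
  shows "iexp x = iexp y \<longleftrightarrow> x = y"
proof
  assume "iexp x = iexp y"
  then have "\<i> * complex_of_real x = \<i> * complex_of_real y"
    by (rule exp_complex_eqI[rotated]) (use assms in auto)
  then show "x = y" by simp
qed simp

text \<open>The vector \<open>z\<close> lists all roots with multiplicity, those indexed by
  \<open>J\<close> lying in \<open>K\<close>. Placing the others on the unit circle confines the
  root vectors to a compact set when \<open>K\<close> is compact.\<close>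

definition spectrum_meets :: "complex set \<Rightarrow> 'n set \<Rightarrow> (complex ^ 'n ^ 'n) set" where
  "spectrum_meets K J = {A. \<exists>z. (\<forall>i. z $ i \<in> (if i \<in> J then K else sphere 0 1)) \<and>
     (\<forall>x. det (mat x - A) = (\<Prod>i\<in>UNIV. x - z $ i))}"

text \<open>The set is the projection of a closed set along the compact set of possible root vectors \<open>z\<close>.\<close>

lemma closed_spectrum_meets:
  assumes "compact K"
  shows "closed (spectrum_meets K (J :: 'n::finite set))"
proof -
  let ?S = "{z :: complex ^ 'n. \<forall>i. z $ i \<in> (if i \<in> J then K else sphere 0 1)}"
  let ?T = "{p :: (complex ^ 'n) \<times> (complex ^ 'n ^ 'n). \<forall>x. det (mat x - snd p) = (\<Prod>i\<in>UNIV. x - fst p $ i)}"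
  have "compact ?S"
  proof (rule compact_eq_bounded_closed[THEN iffD2], intro conjI)
    show "closed ?S"
      using assms by (intro closed_vector_box) (auto simp: compact_imp_closed)
    obtain B where B: "\<And>k. k \<in> K \<Longrightarrow> norm k \<le> B"
      using compact_imp_bounded[OF assms] by (auto simp: bounded_iff)
    have "norm z \<le> (\<Sum>i\<in>(UNIV :: 'n set). \<bar>B\<bar> + 1)" if z: "z \<in> ?S" for z
    proof -
      have "norm (z $ i) \<le> \<bar>B\<bar> + 1" for i
      proof (cases "i \<in> J")
        case True
        then have "norm (z $ i) \<le> B" using z B by (metis (mono_tags, lifting) mem_Collect_eq)
        then show ?thesis by linarith
      next
        case False
        then have "z $ i \<in> sphere 0 1" using z by (metis (mono_tags, lifting) mem_Collect_eq)
        then show ?thesis by simp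
      qed
      then have "(\<Sum>i\<in>UNIV. norm (z $ i)) \<le> (\<Sum>i\<in>(UNIV :: 'n set). \<bar>B\<bar> + 1)" by (rule sum_mono)
      then show ?thesis unfolding norm_vec_def by (intro order_trans[OF L2_set_le_sum]) auto
    qed
    then show "bounded ?S" by (rule boundedI)
  qed
  moreover have "closed ?T"
  proof (rule closed_Collect_all)
    fix x
    have "continuous_on UNIV (\<lambda>p :: (complex ^ 'n) \<times> (complex ^ 'n ^ 'n). det (mat x - snd p))"
      unfolding det_def by (intro continuous_intros)
    moreover have "continuous_on UNIV (\<lambda>p :: (complex ^ 'n) \<times> (complex ^ 'n ^ 'n). \<Prod>i\<in>UNIV. x - fst p $ i)"
      by (intro continuous_intros)
    ultimately show "closed {p :: (complex ^ 'n) \<times> (complex ^ 'n ^ 'n). det (mat x - snd p) = (\<Prod>i\<in>UNIV. x - fst p $ i)}"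
      by (rule closed_Collect_eq)
  qed
  ultimately have "closed {A. \<exists>z. z \<in> ?S \<and> (z, A) \<in> ?T}"
    by (rule closed_compact_projection)
  then show ?thesis by (simp add: spectrum_meets_def)
qed

text \<open>Two lists of roots of the same polynomial agree as multisets, so they have equally many
  entries in \<open>K\<close>. The subset \<open>J\<close> may be smaller than the full set of
  indices with roots in \<open>K\<close>, hence the inequality.\<close>

lemma card_arguments_in_iff:
  fixes A :: "real ^ 'n ^ 'n"
  assumes ea: "eigenvalue_arguments A p"
  shows "m \<le> card {j\<in>{1..CARD('n)}. iexp (p j) \<in> K} \<longleftrightarrow>
    (\<exists>J :: 'n set. m \<le> card J \<and> map_matrix complex_of_real A \<in> spectrum_meets K J)"
proof -
  let ?e = "\<lambda>j. iexp (p j)" and ?I = "{1..CARD('n)}"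
  let ?q = "charpoly (map_matrix complex_of_real A)"
  have q: "?q = (\<Prod>j\<in>?I. [:- ?e j, 1:])" by (rule charpoly_eq_prod[OF ea])
  have cardm: "size (filter_mset (\<lambda>x. x \<in> K) (image_mset f (mset_set I))) = card {i\<in>I. f i \<in> K}"
    if "finite I" for f :: "'k \<Rightarrow> complex" and I
    using that by (simp add: filter_mset_image_mset)
  show ?thesis
  proof
    assume m: "m \<le> card {j\<in>?I. ?e j \<in> K}"
    obtain \<sigma> :: "'n \<Rightarrow> nat" where \<sigma>: "bij_betw \<sigma> UNIV ?I"
      using finite_same_card_bij[of "UNIV :: 'n set" ?I] by auto
    define z :: "complex ^ 'n" where "z = (\<chi> i. ?e (\<sigma> i))"
    define J where "J = {i. z $ i \<in> K}"
    have "bij_betw \<sigma> J {j\<in>?I. ?e j \<in> K}"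
      using \<sigma> by (auto simp: bij_betw_def J_def z_def inj_on_def)
    then have "card J = card {j\<in>?I. ?e j \<in> K}" by (rule bij_betw_same_card)
    moreover have "det (mat x - map_matrix complex_of_real A) = (\<Prod>i\<in>UNIV. x - z $ i)" for x
    proof -
      have "det (mat x - map_matrix complex_of_real A) = (\<Prod>j\<in>?I. x - ?e j)"
        unfolding poly_charpoly[symmetric] q by (simp add: poly_prod)
      also have "\<dots> = (\<Prod>i\<in>UNIV. x - z $ i)"
        using prod.reindex_bij_betw[OF \<sigma>, of "\<lambda>j. x - ?e j"] by (simp add: z_def)
      finally show ?thesis .
    qed
    moreover have "z $ i \<in> (if i \<in> J then K else sphere 0 1)" for i
      by (simp add: J_def) (simp add: z_def)
    ultimately show "\<exists>J :: 'n set. m \<le> card J \<and> map_matrix complex_of_real A \<in> spectrum_meets K J"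
      using m unfolding spectrum_meets_def by (intro exI[of _ J] conjI CollectI exI[of _ z] allI) simp_all
  next
    assume "\<exists>J :: 'n set. m \<le> card J \<and> map_matrix complex_of_real A \<in> spectrum_meets K J"
    then obtain J :: "'n set" and z where J: "m \<le> card J" and
      z: "\<And>i. z $ i \<in> (if i \<in> J then K else sphere 0 1)"
        "\<And>x. det (mat x - map_matrix complex_of_real A) = (\<Prod>i\<in>UNIV. x - z $ i)"
      unfolding spectrum_meets_def by blast
    have "poly ?q = poly (\<Prod>i\<in>UNIV. [:- z $ i, 1:])"
      by (simp add: fun_eq_iff poly_charpoly z(2) poly_prod)
    then have "(\<Prod>i\<in>UNIV. [:- z $ i, 1:]) = (\<Prod>j\<in>?I. [:- ?e j, 1:])"
      using q by (simp add: poly_eq_poly_eq_iff)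
    then have ms: "image_mset (\<lambda>i. z $ i) (mset_set UNIV) = image_mset ?e (mset_set ?I)"
      using proots_prod_linear[of "UNIV :: 'n set" "\<lambda>i. z $ i"] proots_prod_linear[of ?I ?e] by simp
    have "card J \<le> card {i. z $ i \<in> K}"
      using z(1) by (intro card_mono) (auto, metis)
    also have "\<dots> = card {j\<in>?I. ?e j \<in> K}"
      using cardm[of "UNIV :: 'n set" "\<lambda>i. z $ i"] cardm[of ?I ?e] ms by simp
    finally show "m \<le> card {j\<in>?I. ?e j \<in> K}" using J by simp
  qed
qed

text \<open>As the arguments are sorted, \<open>a \<le> \<psi> j t\<close> says that enough
  eigenvalues lie on the arc of arguments from \<open>a\<close> to \<open>2 * pi\<close>. This is a
  condition on the spectrum as a whole, a finite union of closed conditions on the matrix.\<close>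

lemma eigenvalue_argument_measurable:
  fixes \<gamma> :: "real \<Rightarrow> real ^ 'n ^ 'n"
  assumes \<gamma>: "\<gamma> \<in> borel_measurable L01"
    and ea: "\<And>t. t \<in> {0..1} \<Longrightarrow> eigenvalue_arguments (\<gamma> t) (\<lambda>j. \<psi> j t)"
    and j: "j \<in> {1..CARD('n)}"
  shows "\<psi> j \<in> borel_measurable L01"
  unfolding borel_measurable_iff_ge
proof
  fix a
  \<comment> \<open>\<open>?m\<close> is the number of indices from \<open>j\<close> to
    \<open>CARD('n)\<close>.\<close>
  let ?I = "{1..CARD('n)}" and ?m = "Suc (CARD('n)) - j"
  show "{t \<in> space L01. a \<le> \<psi> j t} \<in> sets L01"
  proof (cases "a \<le> 0")
    case True
    then have "{t \<in> space L01. a \<le> \<psi> j t} = space L01"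
      using ea j by (force simp: eigenvalue_arguments_def)
    then show ?thesis by (metis sets.top)
  next
    case False
    \<comment> \<open>For \<open>a > 0\<close> the arc stays within one period
      \<open>(0, 2 * pi]\<close>, so membership in \<open>K\<close> determines whether the argument
      is at least \<open>a\<close>. It is empty for \<open>a > 2 * pi\<close>.\<close>
    define K where "K = (\<lambda>x. iexp x) ` {a..2 * pi}"
    have "compact K" unfolding K_def by (intro compact_continuous_image continuous_intros) simp
    have eK: "iexp (\<psi> l t) \<in> K \<longleftrightarrow> a \<le> \<psi> l t" if "t \<in> {0..1}" "l \<in> ?I" for l t
    proof -
      have b: "0 < \<psi> l t" "\<psi> l t \<le> 2 * pi" using ea[OF that(1)] that(2) by (auto simp: eigenvalue_arguments_def)
      then show ?thesis
        using False unfolding K_def by (auto simp: exp_i_eq_iff image_iff)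
    qed
    have count: "a \<le> \<psi> j t \<longleftrightarrow> ?m \<le> card {l\<in>?I. iexp (\<psi> l t) \<in> K}" if t: "t \<in> {0..1}" for t
    proof -
    let ?B = "{l\<in>?I. a \<le> \<psi> l t}"
      have mono: "\<psi> l t \<le> \<psi> l' t" if "l \<in> ?I" "l' \<in> ?I" "l \<le> l'" for l l'
        using ea[OF t] that by (auto simp: eigenvalue_arguments_def mono_on_def)
      have eq: "{l\<in>?I. iexp (\<psi> l t) \<in> K} = ?B" using eK[OF t] by auto
      show ?thesis unfolding eq
      proof
        assume "a \<le> \<psi> j t"
        then have "{j..CARD('n)} \<subseteq> ?B" using mono[OF j] j by (auto intro: order_trans)
        from card_mono[OF _ this] show "?m \<le> card ?B" by simp
      next
        assume m: "?m \<le> card ?B"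
        show "a \<le> \<psi> j t"
        proof (rule ccontr)
          assume n: "\<not> a \<le> \<psi> j t"
          have "?B \<subseteq> {Suc j..CARD('n)}"
          proof
            fix l assume l: "l \<in> ?B"
            then have "\<not> l \<le> j" using mono[of l j] j n by auto
            with l show "l \<in> {Suc j..CARD('n)}" by auto
          qed
          from card_mono[OF _ this] have "card ?B \<le> CARD('n) - j" by simp
          with m j show False by auto
        qed
      qed
    qed
    let ?c = "map_matrix complex_of_real :: real ^ 'n ^ 'n \<Rightarrow> complex ^ 'n ^ 'n"
    have c: "continuous_on UNIV ?c"
      unfolding map_matrix_def by (intro continuous_intros)
    have "{t \<in> space L01. a \<le> \<psi> j t} = (\<Union>J\<in>{J :: 'n set. ?m \<le> card J}. {t \<in> space L01. ?c (\<gamma> t) \<in> spectrum_meets K J})"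
      using count card_arguments_in_iff[OF ea] by auto
    also have "\<dots> \<in> sets L01"
    proof (intro sets.finite_UN)
      fix J :: "'n set"
      have [measurable]: "(\<lambda>t. ?c (\<gamma> t)) \<in> borel_measurable L01"
        by (rule measurable_compose[OF \<gamma> borel_measurable_continuous_onI[OF c]])
      have [measurable]: "spectrum_meets K J \<in> sets borel"
        by (rule borel_closed[OF closed_spectrum_meets[OF \<open>compact K\<close>]])
      show "{t \<in> space L01. ?c (\<gamma> t) \<in> spectrum_meets K J} \<in> sets L01" by measurable
    qed simp
    finally show ?thesis .
  qed
qed

text \<open>The integral is the distribution function of the law of \<open>f\<close> under Lebesgue
  measure, and it is continuous at a point exactly when that point is no atom. The interior is
  immediate; the endpoints require the range of \<open>f\<close>, or one-sided continuity.\<close>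

lemma unit_step_integral_continuous_iff:
  assumes [measurable]: "f \<in> borel_measurable L01" and f: "\<And>t. t \<in> {0..1} \<Longrightarrow> 0 < f t \<and> f t \<le> c" and "0 < c"
  shows "continuous_on {0..c} (\<lambda>\<theta>. LINT t|L01. unit_step (\<theta> - f t)) \<longleftrightarrow>
    (\<forall>\<theta>\<in>{0..c}. {t\<in>{0..1}. f t = \<theta>} \<in> null_sets lebesgue)"
proof -
  interpret L: prob_space L01 by (rule prob_space_L01)
  define N where "N = distr L01 borel f"
  interpret N: finite_borel_measure N
    unfolding N_def by (intro finite_borel_measure.intro L.finite_measure_distr finite_borel_measure_axioms.intro) simp_all
  have cdf: "(LINT t|L01. unit_step (\<theta> - f t)) = cdf N \<theta>" for \<theta>
  proof -
    have "(LINT t|L01. unit_step (\<theta> - f t)) = (LINT t|L01. indicator (f -` {..\<theta>} \<inter> space L01) t)"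
      by (intro Bochner_Integration.integral_cong) (auto simp: unit_step_def indicator_def)
    also have "\<dots> = measure L01 (f -` {..\<theta>} \<inter> space L01)" by simp
    also have "\<dots> = cdf N \<theta>" unfolding cdf_def N_def by (subst measure_distr) auto
    finally show ?thesis .
  qed
  have null: "{t\<in>{0..1}. f t = \<theta>} \<in> null_sets lebesgue \<longleftrightarrow> measure N {\<theta>} = 0" for \<theta>
  proof -
    let ?A = "{t\<in>{0..1}. f t = \<theta>}"
    have eq: "?A = f -` {\<theta>} \<inter> space L01" by auto
    have A: "?A \<in> sets L01" unfolding eq by measurable
    have "measure N {\<theta>} = measure L01 ?A"
      unfolding N_def eq by (subst measure_distr) auto
    then have "measure N {\<theta>} = 0 \<longleftrightarrow> ?A \<in> null_sets L01"
      using A by (auto simp: null_sets_def L.emeasure_eq_measure)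
    also have "\<dots> \<longleftrightarrow> ?A \<in> null_sets lebesgue"
      by (subst null_sets_restrict_space) auto
    finally show ?thesis by simp
  qed
  have "continuous_on {0..c} (cdf N) \<longleftrightarrow> (\<forall>\<theta>\<in>{0..c}. measure N {\<theta>} = 0)"
  proof
    assume "\<forall>\<theta>\<in>{0..c}. measure N {\<theta>} = 0"
    then show "continuous_on {0..c} (cdf N)"
      by (intro continuous_at_imp_continuous_on) (simp add: N.isCont_cdf)
  next
    assume cont: "continuous_on {0..c} (cdf N)"
    show "\<forall>\<theta>\<in>{0..c}. measure N {\<theta>} = 0"
    proof
      fix \<theta> assume \<theta>: "\<theta> \<in> {0..c}"
      consider "\<theta> = 0" | "0 < \<theta>" "\<theta> < c" | "\<theta> = c" using \<theta> by force
      then show "measure N {\<theta>} = 0"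
      proof cases
        case 1
        have empty: "{t\<in>{0..1}. f t = 0} = {}" using f by force
        show ?thesis using null[of 0] unfolding empty 1 by simp
      next
        case 2
        then have "isCont (cdf N) \<theta>"
          using cont by (intro continuous_on_interior) auto
        then show ?thesis by (simp add: N.isCont_cdf)
      next
        case 3
        \<comment> \<open>Within \<open>{0..c}\<close>, continuity at \<open>c\<close> is continuity
          from the left, which is precisely what excludes an atom there.\<close>
        have "(cdf N \<longlongrightarrow> cdf N c) (at c within {0..c})"
          using cont \<open>0 < c\<close> by (auto simp: continuous_on_def)
        then have "(cdf N \<longlongrightarrow> cdf N c) (at_left c)"
          using at_within_Icc_at_left[OF \<open>0 < c\<close>] by simp
        then have "cdf N c = measure N {..<c}"
          by (rule tendsto_unique[OF _ _ N.cdf_at_left, rotated]) simp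
        moreover have "measure N {..c} = measure N {..<c} + measure N {c}"
          by (subst N.finite_measure_Union[symmetric]) (auto intro: arg_cong[where f="measure N"])
        ultimately show ?thesis using 3 by (simp add: cdf_def)
      qed
    qed
  qed
  then show ?thesis unfolding cdf null .
qed

lemma (in wiener_rotation) ergodic_iff_null:
  assumes ea: "\<And>t. t \<in> {0..1} \<Longrightarrow> eigenvalue_arguments (\<gamma> t) (\<lambda>j. \<psi> j t)"
  shows "ergodic M T \<longleftrightarrow> (\<forall>j\<in>{1..CARD('n)}. \<forall>\<theta>\<in>{0..2 * pi}. {t\<in>{0..1}. \<psi> j t = \<theta>} \<in> null_sets lebesgue)"
proof -
  have range: "0 < \<psi> j t" "\<psi> j t \<le> 2 * pi" if "t \<in> {0..1}" "j \<in> {1..CARD('n)}" for j t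
    using ea[OF that(1)] that(2) by (auto simp: eigenvalue_arguments_def)
  have null: "{t\<in>{0..1}. \<psi> j t = \<theta>} \<in> null_sets lebesgue \<longleftrightarrow> (AE t in L01. \<psi> j t \<noteq> \<theta>)"
    if j: "j \<in> {1..CARD('n)}" for j \<theta>
  proof -
    let ?A = "{t\<in>{0..1}. \<psi> j t = \<theta>}"
    have [measurable]: "\<psi> j \<in> borel_measurable L01" by (rule eigenvalue_argument_measurable[OF \<gamma> ea j])
    have "{t\<in>space L01. \<psi> j t = \<theta>} \<in> sets L01" by measurable
    then have A: "?A \<in> sets L01" by simp
    have "?A \<in> null_sets lebesgue \<longleftrightarrow> ?A \<in> null_sets L01"
      by (subst null_sets_restrict_space) auto
    also have "\<dots> \<longleftrightarrow> (AE t in L01. t \<notin> ?A)" by (rule AE_iff_null_sets[OF A])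
    also have "\<dots> \<longleftrightarrow> (AE t in L01. \<psi> j t \<noteq> \<theta>)" by (rule AE_cong) simp
    finally show ?thesis .
  qed
  show ?thesis
  proof
    assume erg: "ergodic M T"
    show "\<forall>j\<in>{1..CARD('n)}. \<forall>\<theta>\<in>{0..2 * pi}. {t\<in>{0..1}. \<psi> j t = \<theta>} \<in> null_sets lebesgue"
    proof (intro ballI)
      fix j \<theta> assume j: "j \<in> {1..CARD('n)}"
      have "AE t in L01. \<psi> j t \<noteq> \<theta>"
        using ergodic_imp_not_eigenvalue[OF erg, of \<theta>] AE_space
      proof eventually_elim
        case (elim t)
        then have "t \<in> {0..1}" by simp
        from elim(1) j show ?case unfolding is_eigenvalue_iff_argument[OF ea[OF \<open>t \<in> {0..1}\<close>]] cis_conv_exp by blast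
      qed
      then show "{t\<in>{0..1}. \<psi> j t = \<theta>} \<in> null_sets lebesgue" by (simp only: null[OF j])
    qed
  next
    assume all: "\<forall>j\<in>{1..CARD('n)}. \<forall>\<theta>\<in>{0..2 * pi}. {t\<in>{0..1}. \<psi> j t = \<theta>} \<in> null_sets lebesgue"
    show "ergodic M T"
    proof (rule ergodicI)
      fix s :: real assume s: "s \<in> {0..1}"
      \<comment> \<open>For fixed \<open>s\<close> only the finitely many values
        \<open>\<psi> j s\<close> have to be avoided, and each of them is taken by each
        \<open>\<psi> l\<close> on a null set only.\<close>
      have "AE t in L01. \<forall>j\<in>{1..CARD('n)}. \<forall>l\<in>{1..CARD('n)}. \<psi> l t \<noteq> \<psi> j s"
      proof (intro AE_finite_allI finite_atLeastAtMost)
        fix j l assume jl: "j \<in> {1..CARD('n)}" "l \<in> {1..CARD('n)}"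
        have "\<psi> j s \<in> {0..2 * pi}" using range[OF s jl(1)] by simp
        then show "AE t in L01. \<psi> l t \<noteq> \<psi> j s" using all jl(2) null[OF jl(2)] by blast
      qed
      then show "AE t in L01. \<forall>X. \<gamma> s ** X = X ** \<gamma> t \<longrightarrow> X = 0"
        using AE_space
      proof eventually_elim
        case (elim t)
        then have t: "t \<in> {0..1}" by simp
        show ?case
        proof (intro allI impI)
          fix X assume X: "\<gamma> s ** X = X ** \<gamma> t"
          show "X = 0"
          proof (rule ccontr)
            assume "X \<noteq> 0"
            then obtain z where "is_eigenvalue (\<gamma> s) z" "is_eigenvalue (\<gamma> t) z"
              using X by (rule common_eigenvalue)
            then obtain j l where jl: "j \<in> {1..CARD('n)}" "l \<in> {1..CARD('n)}"
              "iexp (\<psi> j s) = iexp (\<psi> l t)"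
              unfolding is_eigenvalue_iff_argument[OF ea[OF s]] is_eigenvalue_iff_argument[OF ea[OF t]] by metis
            then have "\<psi> j s = \<psi> l t"
              using range[OF s jl(1)] range[OF t jl(2)] by (simp add: exp_i_eq_iff)
            with elim(1) jl show False by metis
          qed
        qed
      qed
    qed
  qed
qed

theorem theorem4:
  fixes \<mu> :: "(real \<Rightarrow> real ^ 'n) measure"
    and \<gamma> :: "real \<Rightarrow> real ^ 'n ^ 'n"
    and T :: "(real \<Rightarrow> real ^ 'n) \<Rightarrow> (real \<Rightarrow> real ^ 'n)"
    and \<psi> :: "nat \<Rightarrow> real \<Rightarrow> real"
  assumes "wiener_measure \<mu>"
    and "\<gamma> \<in> borel_measurable (lebesgue_on {0..1})"
    and "\<And>t. t \<in> {0..1} \<Longrightarrow> orthogonal_matrix (\<gamma> t)"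
    and "driven_transformation \<mu> \<gamma> T"
    and "\<And>t. t \<in> {0..1} \<Longrightarrow> eigenvalue_arguments (\<gamma> t) (\<lambda>j. \<psi> j t)"
  shows "measure_preserving \<mu> T \<and>
    (ergodic \<mu> T \<longleftrightarrow>
      (\<forall>j\<in>{1..CARD('n)}.
        continuous_on {0..2 * pi}
          (\<lambda>\<theta>. LINT t|lebesgue_on {0..1}. unit_step (\<theta> - \<psi> j t)))) \<and>
    (ergodic \<mu> T \<longleftrightarrow>
      (\<forall>j\<in>{1..CARD('n)}. \<forall>\<theta>\<in>{0..2 * pi}.
        {t\<in>{0..1}. \<psi> j t = \<theta>} \<in> null_sets lebesgue))"
proof -
  interpret wiener_rotation \<mu> \<gamma> T
    by (rule wiener_rotation.intro[OF wiener.intro[OF assms(1)] wiener_rotation_axioms.intro[OF assms(2,3,4)]])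
  have cont: "continuous_on {0..2 * pi} (\<lambda>\<theta>. LINT t|L01. unit_step (\<theta> - \<psi> j t)) \<longleftrightarrow>
      (\<forall>\<theta>\<in>{0..2 * pi}. {t\<in>{0..1}. \<psi> j t = \<theta>} \<in> null_sets lebesgue)"
    if j: "j \<in> {1..CARD('n)}" for j
  proof (rule unit_step_integral_continuous_iff)
    show "\<psi> j \<in> borel_measurable L01" by (rule eigenvalue_argument_measurable[OF assms(2,5) j])
    show "0 < \<psi> j t \<and> \<psi> j t \<le> 2 * pi" if "t \<in> {0..1}" for t
      using assms(5)[OF that] j by (simp add: eigenvalue_arguments_def)
  qed simp
  have "measure_preserving \<mu> T"
    unfolding measure_preserving_def using T_measurable distr_T by blast
  then show ?thesis
    using ergodic_iff_null[OF assms(5)] cont by simp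
qed

end
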